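(* The directed infinite-volume IDLA forest $\mathcal{F}_\infty$ satisfies the following properties: (i) Almost surely, the random forest $\mathcal{F}_\infty$ spans the whole set $\mathbb{Z}^2$, i.e. $V(\mathcal{F}_\infty)=\mathbb{Z}^2$, and its edge set $E(\mathcal{F}_\infty)$ is made up of edges of the square lattice $\mathbb{Z}^2$ plus a direction (i.e. directed nearest-neighbour edges). (ii) Almost surely, $\mathcal{F}_\infty$ is a countable (infinite) union of directed trees rooted at sites of $I(\infty)=\{0\}\times\mathbb{Z}$. (iii) The distributions of $\mathcal{F}_\infty$ and of $\mathcal{F}_n$, $n\geq 1$, are invariant with respect to vertical translations. (iv) The distributions of $\mathcal{F}_\infty$ and of $\mathcal{F}_n$, $n\geq 1$, are mixing with respect to vertical translations. (v) The distributions of $\mathcal{F}_\infty$ and of $\mathcal{F}_n$, $n\geq 1$, are invariant under the symmetry with respect to the $y$-axis and under the symmetries $S_{k/2}$, $k\in\mathbb{Z}$.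
   Context: Randomness. Let $(\mathcal{N}_i)_{i\in\mathbb{Z}}$ be i.i.d. Poisson point processes on $\mathbb{R}^+$ with intensity $1$; write $T_{i,1}<T_{i,2}<\dots$ for the points of $\mathcal{N}_i$. Let $(S_{i,j})_{i\in\mathbb{Z},j\geq1}$ be independent simple symmetric random walks on $\mathbb{Z}^2$, independent of the point processes, $S_{i,j}$ starting at $(0,i)$. Particle rule. When the current aggregate is $A\subset\mathbb{Z}^2$, launching particle $(i,j)$ means: follow $S_{i,j}$ until the first time (possibly time $0$) it is at a site $z\notin A$; the particle stops there and the aggregate becomes $A\cup\{z\}$. The whole trajectory is realized instantaneously. Finite aggregates and forests. For integers $n,M\ge0$, $A_n^\dag[M]$ is the aggregate obtained from $\emptyset$ by launching, in increasing order of the times $T_{i,j}$ (a.s. all distinct), all particles $(i,j)$ with $|i|\leq M$ and $T_{i,j}\leq n$. The finite directed forest $\mathcal{F}_n^\dag[M]$, with vertex set $A_n^\dag[M]$, is built along the same procedure, starting from the empty graph: each time a particle adds a site $z$, the vertex $z$ is added to the graph; if $z$ is the starting site of the particle (the particle stops at time $0$) then $z$ is the root of a new tree and no edge is added; otherwise the directed edge $(z',z)$ is added, where $z'$ is the last site of the current aggregate visited by the particle before reaching $z$. Infinite forests. Let $\mathbb{Z}_K=\mathbb{Z}\times([-K,K]\cap\mathbb{Z})$. Almost surely, for each $K$ there is a random integer $M_0(K)$ such that the restrictions $\mathcal{F}_n^\dag[M]\cap\mathbb{Z}_K$ coincide for all $M\geq M_0(K)$; one sets $\mathcal{F}_n=\bigcup_{K\geq0}\uparrow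 \mathcal{F}_n^\dag[M_0(K)]\cap\mathbb{Z}_K$, which has vertex set $\bigcup_{M\ge 0} A_n^\dag[M]$. The sequence $(\mathcal{F}_n)_{n\geq1}$ is a.s. increasing (both for vertex sets and edge sets) and $\mathcal{F}_\infty=\bigcup_{n\geq1}\uparrow\mathcal{F}_n$. $V(\cdot)$ and $E(\cdot)$ denote vertex and edge sets. For $k\in\mathbb{Z}$, $\tau_k$ is the translation by the vector $(0,k)$, and $S_{k/2}$ is the symmetry with respect to the horizontal axis $\mathbb{R}\times\{k/2\}$, i.e. $(x,y)\mapsto(x,k-y)$. The distribution of a random forest $\mathcal{F}$ is mixing with respect to vertical translations if $\lim_{|k|\to\infty}\mathbb{P}(\mathcal{F}\in\mathcal{A},\mathcal{F}\in\tau_k\mathcal{B})=\mathbb{P}(\mathcal{F}\in\mathcal{A})\mathbb{P}(\mathcal{F}\in\mathcal{B})$ for all events $\mathcal{A},\mathcal{B}$. *)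

theory Defs
  imports "HOL-Probability.Probability" "Graph_Theory.Pair_Digraph"
begin

section \<open>Poisson point processes on the half-line\<close>

definition locally_finite_configs :: "real set set" where
  "locally_finite_configs = {\<eta>. \<eta> \<subseteq> {0..} \<and> (\<forall>t. finite {s \<in> \<eta>. s \<le> t})}"

text \<open>The usual sigma-algebra on point configurations, generated by the counts of bounded Borel sets.\<close>

definition config_space :: "real set measure" where
  "config_space = sigma locally_finite_configs
     {{\<eta> \<in> locally_finite_configs. card (\<eta> \<inter> B) = k} | B k. B \<in> sets borel \<and> bounded B}"

text \<open>The law of a count is given by its probability mass function because \<open>poisson_pmf\<close> is
  unspecified at rate zero, whereas null sets \<open>B\<close> are allowed here.\<close>

definition poisson_point_process :: "'a measure \<Rightarrow> ('a \<Rightarrow> real set) \<Rightarrow> bool" where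
  "poisson_point_process M X \<longleftrightarrow>
     X \<in> M \<rightarrow>\<^sub>M config_space \<and>
     (\<forall>B \<in> sets borel. bounded B \<and> B \<subseteq> {0..} \<longrightarrow>
        (\<forall>k. measure M {\<omega> \<in> space M. card (X \<omega> \<inter> B) = k}
               = exp (- measure lborel B) * measure lborel B ^ k / fact k)) \<and>
     (\<forall>(B :: nat \<Rightarrow> real set) m.
        (\<forall>l<m. B l \<in> sets borel \<and> bounded (B l) \<and> B l \<subseteq> {0..}) \<and> disjoint_family_on B {..<m} \<longrightarrow>
        prob_space.indep_vars M (\<lambda>_. count_space UNIV) (\<lambda>l \<omega>. card (X \<omega> \<inter> B l)) {..<m})"

text \<open>The \<open>j\<close>-th smallest point, counted from \<open>j = 1\<close>.\<close>

definition nth_point :: "real set \<Rightarrow> nat \<Rightarrow> real" where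
  "nth_point \<eta> j = (THE t. t \<in> \<eta> \<and> card {s \<in> \<eta>. s \<le> t} = j)"

section \<open>Simple symmetric random walks on the square lattice\<close>

type_synonym site = "int \<times> int"

definition unit_steps :: "site set" where
  "unit_steps = {(1, 0), (-1, 0), (0, 1), (0, -1)}"

definition walk_space :: "(nat \<Rightarrow> site) measure" where
  "walk_space = (\<Pi>\<^sub>M k\<in>UNIV. count_space UNIV)"

definition simple_random_walk :: "'a measure \<Rightarrow> ('a \<Rightarrow> nat \<Rightarrow> site) \<Rightarrow> site \<Rightarrow> bool" where
  "simple_random_walk M X x \<longleftrightarrow>
     X \<in> M \<rightarrow>\<^sub>M walk_space \<and>
     (AE \<omega> in M. X \<omega> 0 = x) \<and>
     prob_space.indep_vars M (\<lambda>_. count_space UNIV) (\<lambda>k \<omega>. X \<omega> (Suc k) - X \<omega> k) UNIV \<and>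
     (\<forall>k. distr M (count_space UNIV) (\<lambda>\<omega>. X \<omega> (Suc k) - X \<omega> k) = measure_pmf (pmf_of_set unit_steps))"

section \<open>The random input\<close>

text \<open>Only the walks \<open>S i j\<close> with \<open>j \<ge> 1\<close> are constrained (and used).\<close>

locale idla = prob_space M
  for M :: "'a measure" +
  fixes N :: "int \<Rightarrow> 'a \<Rightarrow> real set"
    and S :: "int \<Rightarrow> nat \<Rightarrow> 'a \<Rightarrow> nat \<Rightarrow> site"
  assumes poisson: "\<And>i. poisson_point_process M (N i)"
    and indep_poisson: "indep_vars (\<lambda>_. config_space) N UNIV"
    and walk: "\<And>i j. j \<ge> 1 \<Longrightarrow> simple_random_walk M (S i j) (0, i)"
    and indep_walks: "indep_vars (\<lambda>_. walk_space) (\<lambda>(i, j). S i j) (UNIV \<times> {1..})"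
    and indep_poisson_walks:
      "indep_set
         (sets (vimage_algebra (space M) (\<lambda>\<omega> i. N i \<omega>) (\<Pi>\<^sub>M i\<in>UNIV. config_space)))
         (sets (vimage_algebra (space M) (\<lambda>\<omega>. \<lambda>(i, j)\<in>UNIV \<times> {1..}. S i j \<omega>)
            (\<Pi>\<^sub>M p\<in>UNIV \<times> {1..}. walk_space)))"

section \<open>Directed graphs\<close>

type_synonym site_graph = "site pair_pre_digraph"

definition graph_Union :: "'v pair_pre_digraph set \<Rightarrow> 'v pair_pre_digraph" where
  "graph_Union \<G> = \<lparr>pverts = (\<Union>G\<in>\<G>. pverts G), parcs = (\<Union>G\<in>\<G>. parcs G)\<rparr>"

definition graph_restrict :: "'v pair_pre_digraph \<Rightarrow> 'v set \<Rightarrow> 'v pair_pre_digraph" where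
  "graph_restrict G W = \<lparr>pverts = pverts G \<inter> W, parcs = parcs G \<inter> W \<times> W\<rparr>"

definition graph_image :: "('v \<Rightarrow> 'w) \<Rightarrow> 'v pair_pre_digraph \<Rightarrow> 'w pair_pre_digraph" where
  "graph_image f G = \<lparr>pverts = f ` pverts G, parcs = map_prod f f ` parcs G\<rparr>"

text \<open>Uniqueness at \<open>v = r\<close>, where the empty walk always qualifies, excludes arcs into the root.\<close>

definition directed_tree :: "'v pair_pre_digraph \<Rightarrow> 'v \<Rightarrow> bool" where
  "directed_tree G r \<longleftrightarrow>
     pair_wf_digraph G \<and> r \<in> pverts G \<and>
     (\<forall>v \<in> pverts G. \<exists>!p. pre_digraph.awalk (with_proj G) r p v)"

definition lattice_arcs :: "(site \<times> site) set" where
  "lattice_arcs = {((x, y), (x', y')). \<bar>x - x'\<bar> + \<bar>y - y'\<bar> = 1}"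

section \<open>Finite-volume forests\<close>

text \<open>Here \<open>\<eta> i\<close> and \<open>w i j\<close> are realisations of the point process at level \<open>i\<close> and of the trajectory
  of particle \<open>(i, j)\<close>.  Ties, infinitely many particles, or walks that never leave the aggregate
  occur with probability zero and are resolved arbitrarily.\<close>

definition particles :: "(int \<Rightarrow> real set) \<Rightarrow> nat \<Rightarrow> nat \<Rightarrow> (int \<times> nat) list" where
  "particles \<eta> n m =
     sort_key (\<lambda>(i, j). nth_point (\<eta> i) j)
       (concat (map (\<lambda>i. map (Pair i) (sorted_list_of_set {j. j \<ge> 1 \<and> nth_point (\<eta> i) j \<le> real n}))
          [- int m..int m]))"

text \<open>All sites visited before the stopping index \<open>k\<close> lie in the aggregate, so the last aggregate
  site visited before \<open>s k\<close> is \<open>s (k - 1)\<close>.\<close>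

definition launch :: "(nat \<Rightarrow> site) \<Rightarrow> site_graph \<Rightarrow> site_graph" where
  "launch s G =
     (if \<exists>k. s k \<notin> pverts G
      then let k = (LEAST k. s k \<notin> pverts G)
           in \<lparr>pverts = insert (s k) (pverts G),
               parcs = (if k = 0 then parcs G else insert (s (k - 1), s k) (parcs G))\<rparr>
      else G)"

definition finite_forest ::
  "(int \<Rightarrow> real set) \<Rightarrow> (int \<Rightarrow> nat \<Rightarrow> nat \<Rightarrow> site) \<Rightarrow> nat \<Rightarrow> nat \<Rightarrow> site_graph" where
  "finite_forest \<eta> w n m =
     fold (\<lambda>(i, j). launch (w i j)) (particles \<eta> n m) \<lparr>pverts = {}, parcs = {}\<rparr>"

section \<open>Infinite-volume forests\<close>

definition strip :: "nat \<Rightarrow> site set" where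
  "strip K = {(x, y). \<bar>y\<bar> \<le> int K}"

text \<open>\<open>stable_level \<eta> w n K\<close> is the random index \<open>M\<^sub>0(K)\<close>.  Its defining property holds only almost
  surely; where no such index exists, \<open>LEAST\<close> returns an unspecified value.\<close>

definition stable_level ::
  "(int \<Rightarrow> real set) \<Rightarrow> (int \<Rightarrow> nat \<Rightarrow> nat \<Rightarrow> site) \<Rightarrow> nat \<Rightarrow> nat \<Rightarrow> nat" where
  "stable_level \<eta> w n K =
     (LEAST m0. \<forall>m\<ge>m0. graph_restrict (finite_forest \<eta> w n m) (strip K)
                        = graph_restrict (finite_forest \<eta> w n m0) (strip K))"

definition forest_at ::
  "(int \<Rightarrow> real set) \<Rightarrow> (int \<Rightarrow> nat \<Rightarrow> nat \<Rightarrow> site) \<Rightarrow> nat \<Rightarrow> site_graph" where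
  "forest_at \<eta> w n =
     graph_Union (range (\<lambda>K. graph_restrict (finite_forest \<eta> w n (stable_level \<eta> w n K)) (strip K)))"

definition forest_limit ::
  "(int \<Rightarrow> real set) \<Rightarrow> (int \<Rightarrow> nat \<Rightarrow> nat \<Rightarrow> site) \<Rightarrow> site_graph" where
  "forest_limit \<eta> w = graph_Union (forest_at \<eta> w ` {1..})"

definition idla_forest ::
  "(int \<Rightarrow> 'a \<Rightarrow> real set) \<Rightarrow> (int \<Rightarrow> nat \<Rightarrow> 'a \<Rightarrow> nat \<Rightarrow> site) \<Rightarrow> nat \<Rightarrow> 'a \<Rightarrow> site_graph" where
  "idla_forest N S n \<omega> = forest_at (\<lambda>i. N i \<omega>) (\<lambda>i j. S i j \<omega>) n"

definition idla_forest_inf ::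
  "(int \<Rightarrow> 'a \<Rightarrow> real set) \<Rightarrow> (int \<Rightarrow> nat \<Rightarrow> 'a \<Rightarrow> nat \<Rightarrow> site) \<Rightarrow> 'a \<Rightarrow> site_graph" where
  "idla_forest_inf N S \<omega> = forest_limit (\<lambda>i. N i \<omega>) (\<lambda>i j. S i j \<omega>)"

section \<open>Distributions of random forests\<close>

definition forest_space :: "site_graph measure" where
  "forest_space = sigma UNIV (range (\<lambda>v. {G. v \<in> pverts G}) \<union> range (\<lambda>e. {G. e \<in> parcs G}))"

definition vshift :: "int \<Rightarrow> site \<Rightarrow> site" where
  "vshift k = (\<lambda>(x, y). (x, y + k))"

definition reflect_y_axis :: "site \<Rightarrow> site" where
  "reflect_y_axis = (\<lambda>(x, y). (- x, y))"

text \<open>The symmetry with respect to the horizontal line at height \<open>k/2\<close>.\<close>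

definition reflect_half :: "int \<Rightarrow> site \<Rightarrow> site" where
  "reflect_half k = (\<lambda>(x, y). (x, k - y))"

definition invariant_distribution ::
  "'a measure \<Rightarrow> ('a \<Rightarrow> site_graph) \<Rightarrow> (site \<Rightarrow> site) \<Rightarrow> bool" where
  "invariant_distribution M F f \<longleftrightarrow>
     distr M forest_space (\<lambda>\<omega>. graph_image f (F \<omega>)) = distr M forest_space F"

definition mixing_distribution :: "'a measure \<Rightarrow> ('a \<Rightarrow> site_graph) \<Rightarrow> bool" where
  "mixing_distribution M F \<longleftrightarrow>
     (\<forall>A \<in> sets forest_space. \<forall>B \<in> sets forest_space.
        ((\<lambda>k. measure M {\<omega> \<in> space M. F \<omega> \<in> A \<and> F \<omega> \<in> graph_image (vshift k) ` B})
           \<longlongrightarrow> measure M {\<omega> \<in> space M. F \<omega> \<in> A} * measure M {\<omega> \<in> space M. F \<omega> \<in> B})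
        (filtercomap abs at_top))"

end

theory Submission
  imports Defs
begin

text \<open>Adding sources enlarges every aggregate, and by vertical invariance together with a count of the
  launched particles, level \<open>0\<close> receives finitely many sites in expectation, uniformly in the window of
  sources.  A particle that reaches level \<open>0\<close> while this level carries at most \<open>W\<close> sites settles there with
  probability at least \<open>4\<^sup>-\<^sup>W\<close>, because it may walk straight to the right; hence only finitely many
  particles ever visit level \<open>0\<close>, and none of them comes from a sufficiently far source.  Combined with
  the independent event that the near sources launch nothing up to time \<open>n\<close>, this gives level \<open>0\<close> a
  positive probability to be empty at time \<open>n\<close>.  Since independent inputs are mixing under shifts, almost
  surely there are empty levels arbitrarily high and arbitrarily low.  Two empty levels isolate the
  region between them, where the forest is a finite deterministic function of the input: this yields
  the stabilisation, the finiteness of all backward chains of arcs, and the equivariance of the limits,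
  from which invariance and mixing follow.  Every site is eventually covered, since infinitely many
  particles walk straight to it, and every region that contains a launched particle contains a root.\<close>

section \<open>Growing finite forests\<close>

text \<open>The obstacle is that the influence of far sources has no a priori bound. Vertex sets are
  monotone in the sources while arcs are not, so the estimates concern occupied sites only, and arcs
  are handled inside a block cut out by two empty levels. A level that is empty at time
  \<open>n\<close> need not stay empty, so every argument about arcs of the limit first returns to a
  time at which the cut is still empty. The bound \<open>W\<close> is random; the visits are
  therefore summed on the event that a fixed \<open>W\<close> works, with a Borel-Cantelli argument
  for each \<open>W\<close>. Finally, the probability space of the statement carries no translation.
  The input is carried over to a product space on which translations and reflections act on
  coordinates; this uses that the defining counts of a Poisson process determine its law, and that
  the forests are measurable functions of the input.\<close>

definition grow :: "(int \<Rightarrow> nat \<Rightarrow> nat \<Rightarrow> site) \<Rightarrow> (int \<times> nat) list \<Rightarrow> site_graph" where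
  "grow w l = fold (\<lambda>(i, j). launch (w i j)) l \<lparr>pverts = {}, parcs = {}\<rparr>"

abbreviation walk_of :: "(int \<Rightarrow> nat \<Rightarrow> nat \<Rightarrow> site) \<Rightarrow> int \<times> nat \<Rightarrow> nat \<Rightarrow> site" where
  "walk_of w p \<equiv> w (fst p) (snd p)"

text \<open>A relation instead of a \<open>LEAST\<close>: it remains meaningful for a walk that
  never leaves \<open>A\<close>, and it turns membership in \<open>launch s G\<close> into a
  countable existential formula, which is what measurability requires later.\<close>

definition first_exit :: "(nat \<Rightarrow> 'v) \<Rightarrow> 'v set \<Rightarrow> nat \<Rightarrow> bool" where
  "first_exit s A k \<longleftrightarrow> s k \<notin> A \<and> (\<forall>k'<k. s k' \<in> A)"

definition level :: "int \<Rightarrow> site set" where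
  "level y = {v. snd v = y}"

definition slab :: "int \<Rightarrow> int \<Rightarrow> site set" where
  "slab a b = {v. a < snd v \<and> snd v < b}"

definition lattice_walks :: "(int \<Rightarrow> nat \<Rightarrow> nat \<Rightarrow> site) \<Rightarrow> bool" where
  "lattice_walks w \<longleftrightarrow> (\<forall>i j. w i j 0 = (0, i) \<and> (\<forall>k. w i j (Suc k) - w i j k \<in> unit_steps))"

lemma first_exit_unique: "first_exit s A k \<Longrightarrow> first_exit s A k' \<Longrightarrow> k = k'"
  unfolding first_exit_def by (metis linorder_neqE_nat)

lemma first_exit_iff: "first_exit s A k \<Longrightarrow> first_exit s A k' \<longleftrightarrow> k' = k"
  using first_exit_unique by blast

lemma first_exit_exists: "s k \<notin> A \<Longrightarrow> \<exists>k'\<le>k. first_exit s A k'"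
  using LeastI[of "\<lambda>k. s k \<notin> A"] Least_le[of "\<lambda>k. s k \<notin> A"] not_less_Least[of _ "\<lambda>k. s k \<notin> A"]
  unfolding first_exit_def by metis

lemma launch_no_exit: "\<forall>k. s k \<in> pverts G \<Longrightarrow> launch s G = G"
  by (simp add: launch_def)

lemma launch_first_exit:
  assumes "first_exit s (pverts G) k"
  shows "launch s G = \<lparr>pverts = insert (s k) (pverts G),
           parcs = (if k = 0 then parcs G else insert (s (k - 1), s k) (parcs G))\<rparr>"
proof -
  have "(LEAST k. s k \<notin> pverts G) = k"
    using assms unfolding first_exit_def by (intro Least_equality) (auto simp: not_less[symmetric])
  moreover have "\<exists>k. s k \<notin> pverts G" using assms by (auto simp: first_exit_def)
  ultimately show ?thesis by (simp add: launch_def Let_def)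
qed

lemma launch_cases:
  obtains "\<forall>k. s k \<in> pverts G" "launch s G = G"
  | k where "first_exit s (pverts G) k" "launch s G = \<lparr>pverts = insert (s k) (pverts G),
           parcs = (if k = 0 then parcs G else insert (s (k - 1), s k) (parcs G))\<rparr>"
  using launch_no_exit launch_first_exit first_exit_exists by metis

lemma pverts_launch_iff:
  "v \<in> pverts (launch s G) \<longleftrightarrow> v \<in> pverts G \<or> (\<exists>k. s k = v \<and> first_exit s (pverts G) k)"
proof (rule launch_cases[of s G])
  fix k assume k: "first_exit s (pverts G) k" and *: "launch s G = \<lparr>pverts = insert (s k) (pverts G),
           parcs = (if k = 0 then parcs G else insert (s (k - 1), s k) (parcs G))\<rparr>"
  show ?thesis by (auto simp: * first_exit_iff[OF k])
qed (auto simp: first_exit_def)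

text \<open>The exit index is a successor because a particle that stops at time 0 creates a root and
  no arc.\<close>

lemma parcs_launch_iff:
  "e \<in> parcs (launch s G) \<longleftrightarrow>
     e \<in> parcs G \<or> (\<exists>k. e = (s k, s (Suc k)) \<and> first_exit s (pverts G) (Suc k))"
proof (rule launch_cases[of s G])
  fix k assume k: "first_exit s (pverts G) k" and *: "launch s G = \<lparr>pverts = insert (s k) (pverts G),
           parcs = (if k = 0 then parcs G else insert (s (k - 1), s k) (parcs G))\<rparr>"
  show ?thesis
  proof (cases k)
    case 0
    then show ?thesis by (simp add: * first_exit_iff[OF k])
  next
    case (Suc m)
    then show ?thesis by (auto simp: * first_exit_iff[OF k])
  qed
qed (auto simp: first_exit_def)

lemma grow_Nil [simp]: "grow w [] = \<lparr>pverts = {}, parcs = {}\<rparr>"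
  by (simp add: grow_def)

lemma grow_snoc [simp]: "grow w (l @ [p]) = launch (walk_of w p) (grow w l)"
  by (simp add: grow_def case_prod_unfold)

lemma grow_cong:
  assumes "\<And>p. p \<in> set l \<Longrightarrow> walk_of w p = walk_of w' p"
  shows "grow w l = grow w' l"
  using assms by (induction l rule: rev_induct) auto

section \<open>Monotonicity and arc structure of grown forests\<close>

lemma launch_mono:
  "pverts G \<subseteq> pverts (launch s G)" "parcs G \<subseteq> parcs (launch s G)"
  by (auto simp: pverts_launch_iff parcs_launch_iff)

lemma grow_prefix_mono:
  "pverts (grow w l) \<subseteq> pverts (grow w (l @ l'))" "parcs (grow w l) \<subseteq> parcs (grow w (l @ l'))"
proof (induction l' rule: rev_induct)
  case (snoc p l')
  { case 1 then show ?case using snoc launch_mono(1)[of "grow w (l @ l')" "walk_of w p"]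
      by (metis append_assoc grow_snoc subset_trans) }
  { case 2 then show ?case using snoc launch_mono(2)[of "grow w (l @ l')" "walk_of w p"]
      by (metis append_assoc grow_snoc subset_trans) }
qed auto

text \<open>A particle stops later in a larger aggregate; if it leaves the smaller aggregate at a site
  outside the larger one, then it stops there in both.\<close>

lemma pverts_launch_mono:
  assumes "pverts G \<subseteq> pverts G'"
  shows "pverts (launch s G) \<subseteq> pverts (launch s G')"
proof
  fix v assume "v \<in> pverts (launch s G)"
  then consider "v \<in> pverts G" | k where "s k = v" "first_exit s (pverts G) k"
    unfolding pverts_launch_iff by blast
  then show "v \<in> pverts (launch s G')"
  proof cases
    case 2
    then have "v \<in> pverts G' \<or> first_exit s (pverts G') k"
      using assms unfolding first_exit_def by blast
    then show ?thesis using 2 unfolding pverts_launch_iff by blast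
  qed (use assms pverts_launch_iff in blast)
qed

text \<open>A dropped particle only enlarges the right-hand side, and a kept one is compared by
  \<open>pverts_launch_mono\<close>. Arcs obey no such inclusion: an additional particle may occupy
  a site first and from another neighbour, or as a root.\<close>

lemma grow_filter_subset: "pverts (grow w (filter Q l)) \<subseteq> pverts (grow w l)"
proof (induction l rule: rev_induct)
  case (snoc p l)
  then show ?case
    using pverts_launch_mono[OF snoc, of "walk_of w p"] launch_mono(1)[of "grow w l" "walk_of w p"]
    by (cases "Q p") auto
qed simp

lemma grow_finite: "finite (pverts (grow w l))" and card_grow: "card (pverts (grow w l)) \<le> length l"
proof (induction l rule: rev_induct)
  case (snoc p l)
  show "finite (pverts (grow w (l @ [p])))"
    using snoc(1) by (rule_tac launch_cases[of "walk_of w p" "grow w l"]) auto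
  show "card (pverts (grow w (l @ [p]))) \<le> length (l @ [p])"
    using snoc by (rule_tac launch_cases[of "walk_of w p" "grow w l"]) (auto simp: card_insert_if)
qed auto

lemma parcs_grow_subset: "parcs (grow w l) \<subseteq> pverts (grow w l) \<times> pverts (grow w l)"
proof (induction l rule: rev_induct)
  case (snoc p l)
  show ?case
  proof (rule launch_cases[of "walk_of w p" "grow w l"])
    fix k assume "first_exit (walk_of w p) (pverts (grow w l)) k"
      and *: "launch (walk_of w p) (grow w l) = \<lparr>pverts = insert (walk_of w p k) (pverts (grow w l)),
         parcs = (if k = 0 then parcs (grow w l)
                  else insert (walk_of w p (k - 1), walk_of w p k) (parcs (grow w l)))\<rparr>"
    then have "k \<noteq> 0 \<Longrightarrow> walk_of w p (k - 1) \<in> pverts (grow w l)" by (auto simp: first_exit_def)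
    then show ?thesis using snoc by (auto simp: *)
  qed (use snoc in auto)
qed auto

lemma new_arc_target:
  assumes "e \<in> parcs (launch s G)" "e \<notin> parcs G"
  shows "snd e \<notin> pverts G" "fst e \<in> pverts G"
  using assms by (auto simp: parcs_launch_iff first_exit_def)

text \<open>Every new arc points at a vertex that was absent before, and old arcs join old vertices,
  so no path of old arcs leaves its head and no cycle can close.\<close>

lemma wf_parcs_grow: "wf (parcs (grow w l))"
proof (induction l rule: rev_induct)
  case (snoc p l)
  show ?case
  proof (rule launch_cases[of "walk_of w p" "grow w l"])
    fix k assume k: "first_exit (walk_of w p) (pverts (grow w l)) k"
      and *: "launch (walk_of w p) (grow w l) = \<lparr>pverts = insert (walk_of w p k) (pverts (grow w l)),
         parcs = (if k = 0 then parcs (grow w l)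
                  else insert (walk_of w p (k - 1), walk_of w p k) (parcs (grow w l)))\<rparr>"
    have "(walk_of w p k, walk_of w p (k - 1)) \<notin> (parcs (grow w l))\<^sup>*" if "k \<noteq> 0"
    proof
      assume "(walk_of w p k, walk_of w p (k - 1)) \<in> (parcs (grow w l))\<^sup>*"
      moreover have "walk_of w p (k - 1) \<in> pverts (grow w l)" "walk_of w p k \<notin> pverts (grow w l)"
        using k that by (auto simp: first_exit_def)
      ultimately show False using parcs_grow_subset[of w l] by (auto elim: converse_rtranclE)
    qed
    then show ?thesis using snoc by (simp add: * wf_insert)
  qed (use snoc in auto)
qed auto

text \<open>A vertex is added only once, and at most one arc is created along with it.\<close>

lemma grow_in_unique:
  assumes "(u, v) \<in> parcs (grow w l)" "(u', v) \<in> parcs (grow w l)"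
  shows "u = u'"
  using assms
proof (induction l rule: rev_induct)
  case (snoc p l)
  show ?case
  proof (cases "v \<in> pverts (grow w l)")
    case True
    then show ?thesis using snoc new_arc_target(1) by (metis grow_snoc snd_conv)
  next
    case False
    then have "(u, v) \<notin> parcs (grow w l)" "(u', v) \<notin> parcs (grow w l)"
      using parcs_grow_subset by blast+
    then show ?thesis using snoc(2,3)
      using first_exit_unique by (fastforce simp: parcs_launch_iff)
  qed
qed simp

text \<open>Arcs into a vertex appear at the moment when the vertex is added and never later. In the
  limit this lets the incoming arc of a vertex be traced back to an earlier time.\<close>

lemma grow_old_arcs:
  assumes "(u, v) \<in> parcs (grow w (l @ l'))" "v \<in> pverts (grow w l)"
  shows "(u, v) \<in> parcs (grow w l)"
  using assms
proof (induction l' rule: rev_induct)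
  case (snoc p l')
  have "v \<in> pverts (grow w (l @ l'))" using snoc grow_prefix_mono(1) by blast
  then have "(u, v) \<in> parcs (grow w (l @ l'))"
    using snoc new_arc_target(1)[of "(u, v)" "walk_of w p" "grow w (l @ l')"]
    by (metis append_assoc grow_snoc snd_conv)
  then show ?case using snoc by blast
qed simp

text \<open>A particle that stops at time 0 stops at its source, which lies on the axis; any other
  particle brings an arc with it.\<close>

lemma grow_root_or_arc:
  assumes "lattice_walks w" "v \<in> pverts (grow w l)"
  shows "fst v = 0 \<or> (\<exists>u. (u, v) \<in> parcs (grow w l))"
  using assms(2)
proof (induction l rule: rev_induct)
  case (snoc p l)
  consider "v \<in> pverts (grow w l)"
    | k where "v = walk_of w p k" "first_exit (walk_of w p) (pverts (grow w l)) k"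
    using snoc(2) by (auto simp: pverts_launch_iff)
  then show ?case
  proof cases
    case 1
    then show ?thesis using snoc(1) launch_mono(2)[of "grow w l"] by auto
  next
    case 2
    show ?thesis
    proof (cases k)
      case 0
      then show ?thesis using assms(1) 2 by (simp add: lattice_walks_def)
    next
      case (Suc m)
      then have "(walk_of w p m, v) \<in> parcs (grow w (l @ [p]))"
        using 2 by (auto simp: parcs_launch_iff)
      then show ?thesis by blast
    qed
  qed
qed simp

lemma parcs_grow_lattice:
  assumes "lattice_walks w"
  shows "parcs (grow w l) \<subseteq> lattice_arcs"
proof (induction l rule: rev_induct)
  case (snoc p l)
  have "(walk_of w p k, walk_of w p (Suc k)) \<in> lattice_arcs" for k
  proof -
    have "walk_of w p (Suc k) - walk_of w p k \<in> unit_steps"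
      using assms by (auto simp: lattice_walks_def)
    then show ?thesis
      by (cases "walk_of w p (Suc k)"; cases "walk_of w p k") (auto simp: unit_steps_def lattice_arcs_def)
  qed
  then show ?case using snoc by (auto simp: parcs_launch_iff)
qed simp

lemma grow_nonempty:
  assumes "l \<noteq> []"
  shows "pverts (grow w l) \<noteq> {}"
proof -
  obtain p l' where l: "l = [p] @ l'" using assms by (cases l) auto
  have "pverts (grow w [p]) \<noteq> {}"
    using grow_snoc[of w "[]" p] launch_first_exit[of "walk_of w p" "grow w []" 0]
    by (simp add: first_exit_def)
  then show ?thesis unfolding l using grow_prefix_mono(1)[of w "[p]" l'] by auto
qed

text \<open>A step changes the height by at most 1, so a walk cannot pass row \<open>a\<close> or
  row \<open>b\<close> without standing on it.\<close>

lemma walk_confined: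
  assumes steps: "\<And>k. s (Suc k) - s k \<in> unit_steps" and "a < b"
    and "\<And>k'. k' \<le> k \<Longrightarrow> s k' \<notin> level a \<union> level b"
  shows "s k \<in> slab a b \<longleftrightarrow> s 0 \<in> slab a b"
  using assms(3)
proof (induction k)
  case (Suc k)
  have "\<bar>snd (s (Suc k)) - snd (s k)\<bar> \<le> 1"
    using steps[of k] by (cases "s (Suc k)"; cases "s k") (auto simp: unit_steps_def)
  moreover have "s k \<notin> level a \<union> level b" "s (Suc k) \<notin> level a \<union> level b"
    using Suc(2)[of k] Suc(2)[of "Suc k"] by auto
  ultimately have "s (Suc k) \<in> slab a b \<longleftrightarrow> s k \<in> slab a b"
    using \<open>a < b\<close> by (auto simp: level_def slab_def)
  then show ?case using Suc by simp
qed simp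

text \<open>No particle crosses a row that stays empty, so the region between two empty rows evolves
  autonomously.\<close>

lemma grow_between:
  assumes w: "lattice_walks w" and ab: "a < b"
    and "pverts (grow w l) \<inter> (level a \<union> level b) = {}"
  shows "graph_restrict (grow w l) (slab a b) = grow w (filter (\<lambda>p. a < fst p \<and> fst p < b) l)"
  using assms(3)
proof (induction l rule: rev_induct)
  case (snoc p l)
  define s where "s = walk_of w p"
  define G where "G = grow w l"
  define U where "U = slab a b"
  define H where "H = grow w (filter (\<lambda>p. a < fst p \<and> fst p < b) l)"
  have s: "s (Suc k) - s k \<in> unit_steps" "s 0 = (0, fst p)" for k
    using w by (auto simp: lattice_walks_def s_def)
  have U0: "s 0 \<in> U \<longleftrightarrow> a < fst p \<and> fst p < b" by (auto simp: s U_def slab_def)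
  have e: "pverts (launch s G) \<inter> (level a \<union> level b) = {}" using snoc(2) by (simp add: s_def G_def)
  then have eG: "pverts G \<inter> (level a \<union> level b) = {}" using launch_mono(1)[of G s] by blast
  have IH: "graph_restrict G U = H" using snoc(1) eG by (auto simp: G_def U_def H_def)
  then have pH: "pverts H = pverts G \<inter> U" "parcs H = parcs G \<inter> U \<times> U"
    by (auto simp: graph_restrict_def)
  have "graph_restrict (launch s G) U = (if s 0 \<in> U then launch s H else H)"
  proof (rule launch_cases[of s G])
    assume *: "\<forall>k. s k \<in> pverts G" "launch s G = G"
    have "s k \<in> U \<longleftrightarrow> s 0 \<in> U" for k
      unfolding U_def by (rule walk_confined) (use s ab * eG in auto)
    then have "s 0 \<in> U \<Longrightarrow> launch s H = H" using * pH by (intro launch_no_exit) auto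
    then show ?thesis using * IH by auto
  next
    fix k assume k: "first_exit s (pverts G) k" and *: "launch s G = \<lparr>pverts = insert (s k) (pverts G),
           parcs = (if k = 0 then parcs G else insert (s (k - 1), s k) (parcs G))\<rparr>"
    \<comment> \<open>Up to and including time \<open>k\<close> the walk stays in the aggregate
      after the launch, which misses both rows; the exit site is covered because it has just been
      added.\<close>
    have n: "s k' \<in> pverts (launch s G)" if "k' \<le> k" for k'
      using k that unfolding * by (cases "k' = k") (auto simp: first_exit_def)
    have conf: "s k' \<in> U \<longleftrightarrow> s 0 \<in> U" if "k' \<le> k" for k'
      unfolding U_def
    proof (rule walk_confined)
      show "s k'' \<notin> level a \<union> level b" if "k'' \<le> k'" for k''
        using n[of k''] that \<open>k' \<le> k\<close> e by auto
    qed (use s ab in auto)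
    show ?thesis
    proof (cases "s 0 \<in> U")
      case True
      then have inU: "s k' \<in> U" if "k' \<le> k" for k' using conf[OF that] by blast
      have "first_exit s (pverts H) k" using k inU by (simp add: first_exit_def pH)
      from launch_first_exit[OF this] show ?thesis
        using True inU[of k] inU[of "k - 1"] by (auto simp: * graph_restrict_def pH)
    next
      case False
      then show ?thesis using conf[of k] IH by (auto simp: * graph_restrict_def)
    qed
  qed
  then show ?case using U0 by (simp add: G_def H_def U_def s_def)
qed (simp add: graph_restrict_def)

section \<open>Images of grown forests under injective site maps\<close>

lemma launch_image:
  assumes "inj f"
  shows "launch (\<lambda>k. f (s k)) (graph_image f G) = graph_image f (launch s G)"
proof (rule launch_cases[of s G])
  assume "\<forall>k. s k \<in> pverts G" "launch s G = G"
  then show ?thesis by (simp add: launch_no_exit graph_image_def)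
next
  fix k assume k: "first_exit s (pverts G) k" and *: "launch s G = \<lparr>pverts = insert (s k) (pverts G),
           parcs = (if k = 0 then parcs G else insert (s (k - 1), s k) (parcs G))\<rparr>"
  have "first_exit (\<lambda>k. f (s k)) (pverts (graph_image f G)) k"
    using k assms by (auto simp: first_exit_def graph_image_def inj_image_mem_iff)
  from launch_first_exit[OF this] show ?thesis by (auto simp: * graph_image_def)
qed

lemma grow_image:
  assumes "inj f" "\<And>p k. p \<in> set l \<Longrightarrow> walk_of w' (\<phi> p) k = f (walk_of w p k)"
  shows "grow w' (map \<phi> l) = graph_image f (grow w l)"
  using assms(2)
proof (induction l rule: rev_induct)
  case Nil then show ?case by (simp add: graph_image_def)
next
  case (snoc p l)
  have "walk_of w' (\<phi> p) = (\<lambda>k. f (walk_of w p k))" using snoc(2)[of p] by (intro ext) simp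
  moreover have "grow w' (map \<phi> l) = graph_image f (grow w l)" using snoc by simp
  ultimately show ?case using launch_image[OF assms(1)] by simp
qed

text \<open>As long as the path \<open>c\<close> is not fully occupied, every particle that follows
  it exits on it and claims a new site of it. The induction keeps this alternative: the path is
  full, or the particles counted so far do not outnumber its occupied sites.\<close>

lemma straight_walks_fill:
  fixes c :: "nat \<Rightarrow> site"
  assumes "length (filter (\<lambda>p. \<forall>k\<le>m. walk_of w p k = c k) l) \<ge> Suc m"
  shows "c ` {..m} \<subseteq> pverts (grow w l)"
proof -
  let ?C = "c ` {..m}"
  have "?C \<subseteq> pverts (grow w l) \<or>
    length (filter (\<lambda>p. \<forall>k\<le>m. walk_of w p k = c k) l) \<le> card (pverts (grow w l) \<inter> ?C)"
  proof (induction l rule: rev_induct)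
    case (snoc p l)
    let ?G = "grow w l" and ?s = "walk_of w p"
    have fin: "finite (pverts (launch ?s ?G) \<inter> ?C)" by auto
    have le: "pverts ?G \<inter> ?C \<subseteq> pverts (launch ?s ?G) \<inter> ?C" using launch_mono(1)[of ?G ?s] by auto
    show ?case
    proof (cases "?C \<subseteq> pverts (launch ?s ?G)")
      case False
      then have nG: "\<not> ?C \<subseteq> pverts ?G" using launch_mono(1)[of ?G ?s] by blast
      with snoc have IH: "length (filter (\<lambda>p. \<forall>k\<le>m. walk_of w p k = c k) l) \<le> card (pverts ?G \<inter> ?C)"
        by auto
      show ?thesis
      proof (cases "\<forall>k\<le>m. ?s k = c k")
        case True
        then obtain k where "k \<le> m" "?s k \<notin> pverts ?G" using nG by (metis atMost_iff image_subsetI)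
        then obtain k' where k': "k' \<le> m" "first_exit ?s (pverts ?G) k'"
          using first_exit_exists by (metis order_trans)
        have "?s k' \<in> ?C" using k' True by auto
        then have "pverts ?G \<inter> ?C \<subset> pverts (launch ?s ?G) \<inter> ?C"
          using k' by (auto simp: launch_first_exit first_exit_def)
        then have "card (pverts ?G \<inter> ?C) < card (pverts (launch ?s ?G) \<inter> ?C)"
          using fin psubset_card_mono by blast
        then show ?thesis using IH True by simp
      next
        case False
        then show ?thesis using IH card_mono[OF fin le] by auto
      qed
    qed auto
  qed simp
  moreover have "?C \<subseteq> pverts (grow w l)" if "Suc m \<le> card (pverts (grow w l) \<inter> ?C)"
  proof -
    have "card ?C \<le> card (pverts (grow w l) \<inter> ?C)" using that card_image_le[of "{..m}" c] by simp
    then have "pverts (grow w l) \<inter> ?C = ?C" by (intro card_seteq) auto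
    then show ?thesis by blast
  qed
  ultimately show ?thesis using assms by linarith
qed

section \<open>Particles that visit or settle in a region\<close>

definition before :: "'p \<Rightarrow> 'p list \<Rightarrow> 'p list" where
  "before p l = takeWhile (\<lambda>q. q \<noteq> p) l"

lemma before_snoc: "p \<noteq> q \<or> p \<in> set l \<Longrightarrow> p \<in> set l \<Longrightarrow> before p (l @ [q]) = before p l"
  "p \<notin> set l \<Longrightarrow> before p (l @ [p]) = l"
  by (auto simp: before_def takeWhile_append)

lemma before_filter: "Q p \<Longrightarrow> before p (filter Q l) = filter Q (before p l)"
  by (induction l) (auto simp: before_def)

lemma before_notin: "p \<notin> set (before p l)"
  by (auto simp: before_def dest: set_takeWhileD)

lemma grow_before_subset: "pverts (grow w (before p l)) \<subseteq> pverts (grow w l)"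
  using grow_prefix_mono(1)[of w "before p l" "dropWhile (\<lambda>q. q \<noteq> p) l"] by (simp add: before_def)

text \<open>Only the sites strictly before time \<open>k\<close> must be occupied, so a particle
  that stops in \<open>R\<close> is counted as well. The aggregate met by \<open>p\<close> at its
  launch is \<open>grow w (before p l)\<close>.\<close>

definition visitors :: "(int \<Rightarrow> nat \<Rightarrow> nat \<Rightarrow> site) \<Rightarrow> site set \<Rightarrow> (int \<times> nat) list \<Rightarrow> (int \<times> nat) set" where
  "visitors w R l = {p \<in> set l. \<exists>k. walk_of w p k \<in> R \<and> (\<forall>k'<k. walk_of w p k' \<in> pverts (grow w (before p l)))}"

definition settlers :: "(int \<Rightarrow> nat \<Rightarrow> nat \<Rightarrow> site) \<Rightarrow> site set \<Rightarrow> (int \<times> nat) list \<Rightarrow> (int \<times> nat) set" where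
  "settlers w R l = {p \<in> set l. \<exists>k. walk_of w p k \<in> R \<and> first_exit (walk_of w p) (pverts (grow w (before p l))) k}"

text \<open>With more particles the aggregate is larger and the same walk is followed at least as
  far, so visits persist. Settling has no such monotonicity, which is why the finiteness argument is
  about visitors.\<close>

lemma visitors_filter: "visitors w R (filter Q l) \<subseteq> visitors w R l"
  unfolding visitors_def using grow_filter_subset[of w Q "before _ l"]
  by (fastforce simp: before_filter)

lemma settlers_visitors: "settlers w R l \<subseteq> visitors w R l"
  by (auto simp: visitors_def settlers_def first_exit_def)

text \<open>Each occupied site is the stopping place of exactly one particle. This converts a sum of
  settling probabilities over particles into the mean number of occupied sites.\<close>

lemma card_settlers:
  assumes "distinct l"
  shows "card (settlers w R l) = card (pverts (grow w l) \<inter> R)"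
  using assms
proof (induction l rule: rev_induct)
  case Nil then show ?case by (simp add: settlers_def)
next
  case (snoc p l)
  let ?s = "walk_of w p" and ?G = "grow w l"
  have p: "p \<notin> set l" using snoc by auto
  have eq: "settlers w R (l @ [p]) = settlers w R l \<union>
      (if \<exists>k. ?s k \<in> R \<and> first_exit ?s (pverts ?G) k then {p} else {})"
    using p by (auto simp: settlers_def before_snoc)
  have np: "p \<notin> settlers w R l" and fin: "finite (settlers w R l)" using p by (auto simp: settlers_def)
  have IH: "card (settlers w R l) = card (pverts ?G \<inter> R)" using snoc by auto
  show ?case
  proof (rule launch_cases[of ?s ?G])
    assume "\<forall>k. ?s k \<in> pverts ?G" "launch ?s ?G = ?G"
    then show ?thesis using IH by (simp add: eq first_exit_def)
  next
    fix k assume k: "first_exit ?s (pverts ?G) k" and *: "launch ?s ?G = \<lparr>pverts = insert (?s k) (pverts ?G),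
           parcs = (if k = 0 then parcs ?G else insert (?s (k - 1), ?s k) (parcs ?G))\<rparr>"
    have "(\<exists>k. ?s k \<in> R \<and> first_exit ?s (pverts ?G) k) \<longleftrightarrow> ?s k \<in> R"
      by (auto simp: first_exit_iff[OF k])
    moreover have "?s k \<notin> pverts ?G" using k by (auto simp: first_exit_def)
    ultimately show ?thesis using IH np fin grow_finite[of w l]
      by (auto simp: eq * Int_insert_left)
  qed
qed

lemma no_visitors: "distinct l \<Longrightarrow> visitors w R l = {} \<Longrightarrow> pverts (grow w l) \<inter> R = {}"
  using card_settlers[of l w R] settlers_visitors[of w R l] grow_finite[of w l] by auto

section \<open>Particle schedules\<close>

text \<open>\<open>particles\<close> for an arbitrary list of levels: blocks, far sources and images
  of windows under translations are not symmetric windows.\<close>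

definition schedule :: "(int \<Rightarrow> real set) \<Rightarrow> nat \<Rightarrow> int list \<Rightarrow> (int \<times> nat) list" where
  "schedule \<eta> n is =
     sort_key (\<lambda>(i, j). nth_point (\<eta> i) j)
       (concat (map (\<lambda>i. map (Pair i) (sorted_list_of_set {j. j \<ge> 1 \<and> nth_point (\<eta> i) j \<le> real n})) is))"

definition npoints :: "real set \<Rightarrow> real \<Rightarrow> nat" where
  "npoints e t = card {s \<in> e. s \<le> t}"

text \<open>Infinitely many points give every label a genuine launch time; disjointness excludes
  ties between levels, so that the order of launching is unique.\<close>

definition admissible :: "(int \<Rightarrow> real set) \<Rightarrow> bool" where
  "admissible \<eta> \<longleftrightarrow> (\<forall>i. \<eta> i \<in> locally_finite_configs \<and> infinite (\<eta> i)) \<and>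
     (\<forall>i i'. i \<noteq> i' \<longrightarrow> \<eta> i \<inter> \<eta> i' = {})"

lemma finite_forest_eq: "finite_forest \<eta> w n m = grow w (schedule \<eta> n [- int m..int m])"
  by (simp add: finite_forest_def grow_def particles_def schedule_def)

section \<open>Ranks and launch times of points\<close>

lemma npoints_less:
  assumes "e \<in> locally_finite_configs" "t \<in> e" "s < t"
  shows "npoints e s < npoints e t"
  unfolding npoints_def
proof (rule psubset_card_mono)
  have "t \<in> {s \<in> e. s \<le> t}" "t \<notin> {s' \<in> e. s' \<le> s}" using assms by auto
  then show "{s' \<in> e. s' \<le> s} \<subset> {s \<in> e. s \<le> t}" using assms(3) by force
qed (use assms in \<open>auto simp: locally_finite_configs_def\<close>)

lemma npoints_mono: "e \<in> locally_finite_configs \<Longrightarrow> s \<le> t \<Longrightarrow> npoints e s \<le> npoints e t"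
  unfolding npoints_def by (rule card_mono) (auto simp: locally_finite_configs_def)

lemma npoints_inj: "e \<in> locally_finite_configs \<Longrightarrow> inj_on (npoints e) e"
  by (rule linorder_inj_onI) (auto dest: npoints_less simp: order_less_imp_not_eq)

text \<open>The rank map is injective, takes values in the right-hand interval, and both sets have
  the same cardinality; hence no rank is skipped.\<close>

lemma npoints_image:
  assumes "e \<in> locally_finite_configs"
  shows "npoints e ` {s \<in> e. s \<le> t} = {1..npoints e t}"
proof (rule card_subset_eq)
  have fin: "finite {s \<in> e. s \<le> t'}" for t' using assms by (auto simp: locally_finite_configs_def)
  show "npoints e ` {s \<in> e. s \<le> t} \<subseteq> {1..npoints e t}"
  proof clarsimp
    fix s assume "s \<in> e" "s \<le> t"
    then have "{s' \<in> e. s' \<le> s} \<noteq> {}" by auto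
    then have "0 < npoints e s" using fin[of s] by (auto simp: npoints_def card_gt_0_iff)
    then show "Suc 0 \<le> npoints e s \<and> npoints e s \<le> npoints e t" using npoints_mono[OF assms \<open>s \<le> t\<close>] by auto
  qed
  have "inj_on (npoints e) {s \<in> e. s \<le> t}" using npoints_inj[OF assms] by (rule inj_on_subset) auto
  then show "card (npoints e ` {s \<in> e. s \<le> t}) = card {1..npoints e t}"
    by (simp add: card_image) (simp add: npoints_def)
qed auto

lemma nth_point_eq:
  assumes "e \<in> locally_finite_configs" "u \<in> e"
  shows "nth_point e (npoints e u) = u"
  unfolding nth_point_def npoints_def[symmetric]
  by (rule the_equality) (use assms npoints_inj[OF assms(1)] in \<open>auto dest: inj_onD\<close>)

lemma nth_point_in:
  assumes "e \<in> locally_finite_configs" "1 \<le> j" "j \<le> npoints e t"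
  shows "nth_point e j \<in> e" "npoints e (nth_point e j) = j" "nth_point e j \<le> t"
proof -
  have "j \<in> npoints e ` {s \<in> e. s \<le> t}" using assms by (simp add: npoints_image)
  then obtain s where "s \<in> e" "s \<le> t" "j = npoints e s" by auto
  then show "nth_point e j \<in> e" "npoints e (nth_point e j) = j" "nth_point e j \<le> t"
    using nth_point_eq[OF assms(1)] by auto
qed

lemma nth_point_le_iff:
  assumes "e \<in> locally_finite_configs" "1 \<le> j" "j \<le> npoints e t'"
  shows "nth_point e j \<le> t \<longleftrightarrow> j \<le> npoints e t"
  using nth_point_in[OF assms] nth_point_in(3)[OF assms(1,2), of t] npoints_mono[OF assms(1)] by metis

lemma npoints_unbounded:
  assumes "e \<in> locally_finite_configs" "infinite e"
  obtains t where "j \<le> npoints e t"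
proof -
  obtain B where B: "B \<subseteq> e" "finite B" "card B = j"
    using infinite_arbitrarily_large[OF assms(2)] by blast
  have fin: "finite {s \<in> e. s \<le> Max B}" using assms by (auto simp: locally_finite_configs_def)
  have "card B \<le> npoints e (Max B)"
    unfolding npoints_def by (rule card_mono) (use fin B Max_ge[OF B(2)] in auto)
  then show ?thesis using that B by blast
qed

lemma infinite_nth_point:
  assumes "e \<in> locally_finite_configs" "infinite e" "1 \<le> j"
  shows "nth_point e j \<in> e" "npoints e (nth_point e j) = j" "nth_point e j \<le> t \<longleftrightarrow> j \<le> npoints e t"
proof -
  obtain t' where "j \<le> npoints e t'" using npoints_unbounded[OF assms(1,2)] by blast
  then show "nth_point e j \<in> e" "npoints e (nth_point e j) = j" "nth_point e j \<le> t \<longleftrightarrow> j \<le> npoints e t"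
    using nth_point_in nth_point_le_iff assms by blast+
qed

section \<open>Order, restriction and extension of schedules\<close>

lemma schedule_labels:
  assumes "p \<in> set (schedule \<eta> n is)"
  shows "fst p \<in> set is" "1 \<le> snd p"
proof -
  have "set (sorted_list_of_set A) \<subseteq> A" for A :: "nat set" by (cases "finite A") auto
  from this[of "{j. j \<ge> 1 \<and> nth_point (\<eta> (fst p)) j \<le> real n}"]
  show "fst p \<in> set is" "1 \<le> snd p" using assms by (auto simp: schedule_def)
qed

lemma sort_key_cong: "(\<And>x. x \<in> set xs \<Longrightarrow> f x = g x) \<Longrightarrow> sort_key f xs = sort_key g xs"
proof (induction xs)
  case (Cons x xs)
  have "insort_key f x ys = insort_key g x ys" if "set ys \<subseteq> set xs" for ys
    using that Cons.prems by (induction ys) auto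
  then show ?case using Cons by simp
qed simp

lemma schedule_cong: "(\<And>i. i \<in> set is \<Longrightarrow> \<eta> i = \<eta>' i) \<Longrightarrow> schedule \<eta> n is = schedule \<eta>' n is"
  unfolding schedule_def by (intro trans[OF sort_key_cong arg_cong[where f = "sort_key _"]]) (auto cong: map_cong)

lemma schedule_sorted: "sorted (map (\<lambda>(i, j). nth_point (\<eta> i) j) (schedule \<eta> n is))"
  by (simp add: schedule_def)

lemma schedule_distinct:
  assumes "distinct is"
  shows "distinct (schedule \<eta> n is)"
  unfolding schedule_def distinct_sort using assms
  by (induction "is") (auto simp: distinct_map inj_on_def)

context
  fixes \<eta> assumes adm: "admissible \<eta>"
begin

lemma admissible_nth_point:
  assumes "1 \<le> j"
  shows "nth_point (\<eta> i) j \<in> \<eta> i" "npoints (\<eta> i) (nth_point (\<eta> i) j) = j"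
    "nth_point (\<eta> i) j \<le> t \<longleftrightarrow> j \<le> npoints (\<eta> i) t"
  using infinite_nth_point[of "\<eta> i" j] adm assms by (auto simp: admissible_def)

lemma set_schedule: "set (schedule \<eta> n is) = {(i, j). i \<in> set is \<and> 1 \<le> j \<and> j \<le> npoints (\<eta> i) n}"
proof -
  have "{j. 1 \<le> j \<and> nth_point (\<eta> i) j \<le> real n} = {1..npoints (\<eta> i) n}" for i
    by (auto simp: admissible_nth_point)
  then have "schedule \<eta> n is = sort_key (\<lambda>(i, j). nth_point (\<eta> i) j)
     (concat (map (\<lambda>i. map (Pair i) (sorted_list_of_set {1..npoints (\<eta> i) n})) is))"
    unfolding schedule_def by simp
  then show ?thesis by (auto simp: set_concat)
qed

lemma launch_times_inj: "inj_on (\<lambda>(i, j). nth_point (\<eta> i) j) {(i, j). 1 \<le> j}"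
proof (rule inj_onI, clarify)
  fix i i' :: int and j j' :: nat
  assume j: "1 \<le> j" "1 \<le> j'" and eq: "nth_point (\<eta> i) j = nth_point (\<eta> i') j'"
  have "i = i'" using admissible_nth_point(1)[of j i] admissible_nth_point(1)[of j' i'] j eq adm
    unfolding admissible_def by (metis disjoint_iff)
  then show "i = i' \<and> j = j'" using admissible_nth_point(2) j eq by metis
qed

text \<open>Launch times separate labels, so a duplicate-free schedule is determined by its set and
  its order. Statements about rearranged schedules thereby reduce to equalities of sets.\<close>

lemma schedule_eqI:
  assumes "distinct is" "distinct xs" "set xs = set (schedule \<eta> n is)"
    "sorted (map (\<lambda>(i, j). nth_point (\<eta> i) j) xs)"
  shows "schedule \<eta> n is = xs"
proof (rule map_sorted_distinct_set_unique)
  let ?f = "\<lambda>(i, j). nth_point (\<eta> i) j"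
  have inj: "inj_on ?f (set (schedule \<eta> n is))"
    using launch_times_inj by (rule inj_on_subset) (auto dest: schedule_labels)
  then show "inj_on ?f (set (schedule \<eta> n is) \<union> set xs)" using assms by simp
  show "distinct (map ?f (schedule \<eta> n is))" "distinct (map ?f xs)"
    using inj assms schedule_distinct by (auto simp: distinct_map)
qed (use assms schedule_sorted in auto)

lemma schedule_filter:
  assumes "distinct is" "distinct is'" "set is' = {i \<in> set is. Q i}"
  shows "schedule \<eta> n is' = filter (\<lambda>p. Q (fst p)) (schedule \<eta> n is)"
  using assms schedule_distinct[of "is"] schedule_sorted
  by (intro schedule_eqI) (auto simp: set_schedule sorted_filter)

text \<open>Points up to time \<open>n\<close> precede all others, so for fixed sources the forest
  at time \<open>n\<close> is an intermediate stage of the one at time \<open>n'\<close>; this is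
  what gives monotonicity in time for arcs as well.\<close>

lemma schedule_prefix:
  assumes "distinct is" "n \<le> n'"
  shows "\<exists>l. schedule \<eta> n' is = schedule \<eta> n is @ l"
proof -
  let ?f = "\<lambda>(i, j). nth_point (\<eta> i) j"
  let ?l = "schedule \<eta> n' is"
  have "sorted (map ?f (filter (\<lambda>p. ?f p \<le> n) ?l @ filter (\<lambda>p. \<not> ?f p \<le> n) ?l))"
    using schedule_sorted[of \<eta> n' "is"] by (auto simp: sorted_append sorted_filter)
  moreover have "distinct (filter (\<lambda>p. ?f p \<le> n) ?l @ filter (\<lambda>p. \<not> ?f p \<le> n) ?l)"
    using schedule_distinct[OF assms(1)] by auto
  ultimately have "?l = filter (\<lambda>p. ?f p \<le> n) ?l @ filter (\<lambda>p. \<not> ?f p \<le> n) ?l"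
    using assms by (intro schedule_eqI) auto
  moreover have "schedule \<eta> n is = filter (\<lambda>p. ?f p \<le> n) ?l"
  proof (rule schedule_eqI)
    have "npoints (\<eta> i) n \<le> npoints (\<eta> i) n'" for i
      using adm assms by (intro npoints_mono) (auto simp: admissible_def)
    then have "j \<le> npoints (\<eta> i) n' \<and> j \<le> npoints (\<eta> i) n \<longleftrightarrow> j \<le> npoints (\<eta> i) n" for i j
      using le_trans by blast
    then show "set (filter (\<lambda>p. ?f p \<le> n) ?l) = set (schedule \<eta> n is)"
      by (auto simp: set_schedule admissible_nth_point(3) intro: le_trans)
  qed (rule assms(1), simp add: schedule_distinct assms(1), rule sorted_filter[OF schedule_sorted])
  ultimately show ?thesis by metis
qed

end

lemma schedule_image:
  assumes adm: "admissible \<eta>" and "inj g" "\<And>i. \<eta>' (g i) = \<eta> i" "admissible \<eta>'" "distinct is" "distinct is'" "set is' = g ` set is"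
  shows "schedule \<eta>' n is' = map (\<lambda>(i, j). (g i, j)) (schedule \<eta> n is)"
proof -
  have "map (\<lambda>(i, j). nth_point (\<eta>' i) j) (map (\<lambda>(i, j). (g i, j)) (schedule \<eta> n is)) =
      map (\<lambda>(i, j). nth_point (\<eta> i) j) (schedule \<eta> n is)"
    using assms(3) by auto
  then have sd: "sorted (map (\<lambda>(i, j). nth_point (\<eta>' i) j) (map (\<lambda>(i, j). (g i, j)) (schedule \<eta> n is)))"
    by (simp only: schedule_sorted)
  show ?thesis
  proof (rule schedule_eqI[OF assms(4) assms(6) _ _ sd])
    show "distinct (map (\<lambda>(i, j). (g i, j)) (schedule \<eta> n is))"
      using assms schedule_distinct[OF assms(5)] by (auto simp: distinct_map inj_on_def inj_def)
    show "set (map (\<lambda>(i, j). (g i, j)) (schedule \<eta> n is)) = set (schedule \<eta>' n is')"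
      using assms(3) by (fastforce simp: set_schedule[OF adm] set_schedule[OF assms(4)] assms(7))
  qed
qed

section \<open>Decomposition of a forest into trees\<close>

text \<open>In-degree at most one and well-foundedness take the place of finiteness: the limit graph
  is infinite, but every backward path in it ends.\<close>

locale forest =
  fixes G :: "'v pair_pre_digraph"
  assumes arcs_verts: "parcs G \<subseteq> pverts G \<times> pverts G"
    and in_unique: "\<And>u u' v. (u, v) \<in> parcs G \<Longrightarrow> (u', v) \<in> parcs G \<Longrightarrow> u = u'"
    and wf_arcs: "wf (parcs G)"
begin

definition roots :: "'v set" where
  "roots = {r \<in> pverts G. \<forall>u. (u, r) \<notin> parcs G}"

definition tree :: "'v \<Rightarrow> 'v pair_pre_digraph" where
  "tree r = graph_restrict G {v. (r, v) \<in> (parcs G)\<^sup>*}"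

text \<open>Predecessors are unique, so two paths into the same vertex coincide backwards until one
  of them starts, and a root has no predecessor by which the other could continue.\<close>

lemma root_unique: "(r, v) \<in> (parcs G)\<^sup>* \<Longrightarrow> (r', v) \<in> (parcs G)\<^sup>* \<Longrightarrow> r \<in> roots \<Longrightarrow> r' \<in> roots \<Longrightarrow> r = r'"
proof (induction arbitrary: rule: rtrancl_induct)
  case base
  then show ?case by (auto simp: roots_def elim: rtranclE)
next
  case (step u v)
  have "v \<noteq> r'" using step by (auto simp: roots_def)
  with step.prems(1) obtain u' where "(r', u') \<in> (parcs G)\<^sup>*" "(u', v) \<in> parcs G"
    by (auto elim: rtranclE)
  then show ?case using step in_unique by blast
qed

lemma root_exists: "v \<in> pverts G \<Longrightarrow> \<exists>r\<in>roots. (r, v) \<in> (parcs G)\<^sup>*"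
proof (induction v rule: wf_induct_rule[OF wf_arcs])
  case (1 v)
  then show ?case
  proof (cases "v \<in> roots")
    case False
    then obtain u where u: "(u, v) \<in> parcs G" using 1 by (auto simp: roots_def)
    then show ?thesis using 1(1)[OF u] arcs_verts by (meson SigmaD1 rtrancl_into_rtrancl subsetD)
  qed auto
qed

lemma tree_directed:
  assumes r: "r \<in> roots"
  shows "directed_tree (tree r) r"
  unfolding directed_tree_def
proof (intro conjI ballI)
  let ?T = "with_proj (tree r)"
  show "r \<in> pverts (tree r)" using r by (auto simp: tree_def graph_restrict_def roots_def)
  interpret T: pair_wf_digraph "tree r"
    by unfold_locales (use arcs_verts in \<open>auto simp: tree_def graph_restrict_def\<close>)
  show "pair_wf_digraph (tree r)" ..
  fix v assume v: "v \<in> pverts (tree r)"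
  then have "(r, v) \<in> (parcs G)\<^sup>*" by (auto simp: tree_def graph_restrict_def)
  then have ex: "\<exists>p. pre_digraph.awalk ?T r p v"
  proof (induction rule: rtrancl_induct)
    case base
    then show ?case using \<open>r \<in> pverts (tree r)\<close>
      by (intro exI[of _ "[]"]) (simp add: pre_digraph.awalk_def pre_digraph.cas.simps)
  next
    case (step u v)
    then obtain p where p: "pre_digraph.awalk ?T r p u" by blast
    have "(u, v) \<in> parcs (tree r)"
      using step arcs_verts rtrancl_into_rtrancl[OF step(1,2)]
      by (auto simp: tree_def graph_restrict_def)
    then have "T.awalk r (p @ [(u, v)]) v"
      using p T.arc_implies_awalk[of "(u, v)"] by (intro T.awalk_appendI) auto
    then show ?case by blast
  qed
  \<comment> \<open>Both walks are peeled from the end: in-uniqueness forces equal last arcs, and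
    neither walk can be exhausted first because no arc enters the root.\<close>
  have "p = q" if "pre_digraph.awalk ?T r p v" "pre_digraph.awalk ?T r q v" for p q
    using that
  proof (induction p arbitrary: v q rule: rev_induct)
    case Nil
    show ?case
    proof (cases q rule: rev_cases)
      case (snoc q' e)
      then have "e \<in> parcs (tree r)" "snd e = r" using Nil
        by (auto simp: pre_digraph.awalk_def pre_digraph.cas_append_iff pre_digraph.cas.simps)
      then show ?thesis using r by (cases e) (auto simp: roots_def tree_def graph_restrict_def)
    qed simp
  next
    case (snoc e p)
    have e: "e \<in> parcs (tree r)" "snd e = v" "pre_digraph.awalk ?T r p (fst e)"
      using snoc by (auto simp: pre_digraph.awalk_def pre_digraph.cas_append_iff pre_digraph.cas.simps)
    show ?case
    proof (cases q rule: rev_cases)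
      case Nil
      then have "v = r" using snoc by (auto simp: pre_digraph.awalk_def pre_digraph.cas.simps)
      then show ?thesis using r e by (cases e) (auto simp: roots_def tree_def graph_restrict_def)
    next
      case q: (snoc q' e')
      have e': "e' \<in> parcs (tree r)" "snd e' = v" "pre_digraph.awalk ?T r q' (fst e')"
        using snoc q by (auto simp: pre_digraph.awalk_def pre_digraph.cas_append_iff pre_digraph.cas.simps)
      have "fst e = fst e'" using e e' in_unique[of "fst e" v "fst e'"]
        by (cases e; cases e') (auto simp: tree_def graph_restrict_def)
      then have "e = e'" using e e' by (cases e; cases e') auto
      then show ?thesis using snoc.IH[OF e(3)] e' q by auto
    qed
  qed
  with ex show "\<exists>!p. pre_digraph.awalk ?T r p v" by blast
qed

lemma tree_disjoint: "disjoint_family_on (\<lambda>r. pverts (tree r)) roots"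
  using root_unique by (auto simp: disjoint_family_on_def tree_def graph_restrict_def)

lemma tree_Union: "graph_Union (tree ` roots) = G"
proof (rule pair_pre_digraph.equality)
  show "pverts (graph_Union (tree ` roots)) = pverts G"
    using root_exists by (auto simp: graph_Union_def tree_def graph_restrict_def)
  show "parcs (graph_Union (tree ` roots)) = parcs G"
  proof
    show "parcs G \<subseteq> parcs (graph_Union (tree ` roots))"
    proof
      fix e assume e: "e \<in> parcs G"
      then obtain r where r: "r \<in> roots" "(r, fst e) \<in> (parcs G)\<^sup>*"
        using root_exists[of "fst e"] subsetD[OF arcs_verts e] by (auto simp: mem_Times_iff)
      then have "(r, snd e) \<in> (parcs G)\<^sup>*" using e by (cases e) auto
      then show "e \<in> parcs (graph_Union (tree ` roots))"
        using e r by (cases e) (auto simp: graph_Union_def tree_def graph_restrict_def)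
    qed
  qed (auto simp: graph_Union_def tree_def graph_restrict_def)
qed simp

end

section \<open>Empty levels and the structure of the infinite forest\<close>

text \<open>Emptiness is asked in all symmetric windows at once; for admissible points monotonicity
  extends it to every finite list of distinct sources.\<close>

definition empty_level :: "(int \<Rightarrow> real set) \<Rightarrow> (int \<Rightarrow> nat \<Rightarrow> nat \<Rightarrow> site) \<Rightarrow> nat \<Rightarrow> int \<Rightarrow> bool" where
  "empty_level \<eta> w n y \<longleftrightarrow> (\<forall>m. pverts (finite_forest \<eta> w n m) \<inter> level y = {})"

definition block :: "(int \<Rightarrow> real set) \<Rightarrow> (int \<Rightarrow> nat \<Rightarrow> nat \<Rightarrow> site) \<Rightarrow> nat \<Rightarrow> int \<Rightarrow> int \<Rightarrow> site_graph" where
  "block \<eta> w n a b = grow w (schedule \<eta> n [a+1..b-1])"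

text \<open>Given \<open>regular_input\<close>, the existence and the forest structure of the limit
  are deterministic consequences of this property; probability enters only to show that it holds
  almost surely.\<close>

definition separated :: "(int \<Rightarrow> real set) \<Rightarrow> (int \<Rightarrow> nat \<Rightarrow> nat \<Rightarrow> site) \<Rightarrow> bool" where
  "separated \<eta> w \<longleftrightarrow> (\<forall>n Y. (\<exists>y>Y. empty_level \<eta> w n y) \<and> (\<exists>y<Y. empty_level \<eta> w n y))"

lemma subset_symmetric_window:
  obtains m where "set is \<subseteq> {- int m..int m}"
proof
  define B where "B = Max (insert 0 (abs ` set is))"
  have "\<bar>i\<bar> \<le> B" if "i \<in> set is" for i unfolding B_def using that by (intro Max_ge) auto
  then show "set is \<subseteq> {- int (nat B)..int (nat B)}" by force
qed

lemma grow_window_mono: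
  assumes "admissible \<eta>" "distinct is" "distinct is'" "set is' \<subseteq> set is"
  shows "pverts (grow w (schedule \<eta> n is')) \<subseteq> pverts (grow w (schedule \<eta> n is))"
proof -
  have "set is' = {i \<in> set is. i \<in> set is'}" using assms(4) by blast
  from schedule_filter[OF assms(1-3) this] show ?thesis using grow_filter_subset by metis
qed

section \<open>Windows restricted to the slab between two empty levels\<close>

locale regular_input =
  fixes \<eta> :: "int \<Rightarrow> real set" and w :: "int \<Rightarrow> nat \<Rightarrow> nat \<Rightarrow> site"
  assumes adm: "admissible \<eta>" and walks: "lattice_walks w"
begin

lemma empty_level_window:
  assumes "empty_level \<eta> w n y" "distinct is"
  shows "pverts (grow w (schedule \<eta> n is)) \<inter> level y = {}"
proof -
  obtain m where "set is \<subseteq> {- int m..int m}" using subset_symmetric_window by blast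
  then have "pverts (grow w (schedule \<eta> n is)) \<subseteq> pverts (finite_forest \<eta> w n m)"
    unfolding finite_forest_eq using assms adm by (intro grow_window_mono) auto
  then show ?thesis using assms(1) by (auto simp: empty_level_def)
qed

lemma grow_time_mono:
  assumes "n \<le> n'" "distinct is"
  shows "pverts (grow w (schedule \<eta> n is)) \<subseteq> pverts (grow w (schedule \<eta> n' is))"
    "parcs (grow w (schedule \<eta> n is)) \<subseteq> parcs (grow w (schedule \<eta> n' is))"
  using schedule_prefix[OF adm assms(2,1)] grow_prefix_mono by force+

text \<open>Particles from outside cannot enter the slab and those from inside cannot leave it, so
  the part of a window between two empty levels is the same for all windows that contain the sources
  in between.\<close>

lemma restrict_between:
  assumes "a < b" "empty_level \<eta> w n a" "empty_level \<eta> w n b" "distinct is" "{a<..<b} \<subseteq> set is"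
  shows "graph_restrict (grow w (schedule \<eta> n is)) (slab a b) = block \<eta> w n a b"
proof -
  have "schedule \<eta> n [a+1..b-1] = filter (\<lambda>p. a < fst p \<and> fst p < b) (schedule \<eta> n is)"
    using assms by (intro schedule_filter[OF adm]) auto
  moreover have "pverts (grow w (schedule \<eta> n is)) \<inter> (level a \<union> level b) = {}"
    using empty_level_window[OF assms(2,4)] empty_level_window[OF assms(3,4)] by auto
  ultimately show ?thesis using grow_between[OF walks assms(1)] by (simp add: block_def)
qed

lemma block_verts:
  assumes "a < b" "empty_level \<eta> w n a" "empty_level \<eta> w n b"
  shows "pverts (block \<eta> w n a b) \<subseteq> slab a b"
proof -
  \<comment> \<open>A block is itself a window containing the sources in between, so it equals its
    own restriction to the slab.\<close>
  have "graph_restrict (block \<eta> w n a b) (slab a b) = block \<eta> w n a b"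
    unfolding block_def[of _ _ _ a b] by (subst restrict_between[OF assms]) (auto simp: block_def)
  then have "pverts (block \<eta> w n a b) = pverts (block \<eta> w n a b) \<inter> slab a b"
    by (metis graph_restrict_def pair_pre_digraph.select_convs(1))
  then show ?thesis by blast
qed

lemma block_nested:
  assumes "a < b" "empty_level \<eta> w n a" "empty_level \<eta> w n b" "a' \<le> a" "b \<le> b'"
  shows "graph_restrict (block \<eta> w n a' b') (slab a b) = block \<eta> w n a b"
  unfolding block_def[of _ _ _ a' b'] using assms by (intro restrict_between) auto

lemma block_subset:
  assumes "a < b" "empty_level \<eta> w n a" "empty_level \<eta> w n b" "a' \<le> a" "b \<le> b'"
  shows "pverts (block \<eta> w n a b) \<subseteq> pverts (block \<eta> w n a' b')"
    "parcs (block \<eta> w n a b) \<subseteq> parcs (block \<eta> w n a' b')"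
  using block_nested[OF assms] by (metis Int_lower1 graph_restrict_def pair_pre_digraph.select_convs)+

lemma block_time_mono:
  assumes "n \<le> n'"
  shows "pverts (block \<eta> w n a b) \<subseteq> pverts (block \<eta> w n' a b)"
    "parcs (block \<eta> w n a b) \<subseteq> parcs (block \<eta> w n' a b)"
  unfolding block_def using grow_time_mono[OF assms, of "[a+1..b-1]"] by auto

end

section \<open>The limit forest of a separated input\<close>

locale separated_input = regular_input +
  assumes sep: "separated \<eta> w"
begin

definition cut :: "nat \<Rightarrow> int \<Rightarrow> int \<Rightarrow> bool" where
  "cut n a b \<longleftrightarrow> a < b \<and> empty_level \<eta> w n a \<and> empty_level \<eta> w n b"

lemma cut_exists:
  assumes "finite Y"
  obtains a b where "cut n a b" "\<And>y. y \<in> Y \<Longrightarrow> a < y \<and> y < b"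
proof -
  obtain b where b: "Max (insert 0 Y) < b" "empty_level \<eta> w n b"
    using sep unfolding separated_def by blast
  obtain a where a: "Min (insert 0 Y) > a" "empty_level \<eta> w n a"
    using sep unfolding separated_def by blast
  show ?thesis
  proof (rule that[of a b])
    show "cut n a b" using a b assms unfolding cut_def by (auto simp: less_trans)
    show "a < y \<and> y < b" if "y \<in> Y" for y using a b assms that by auto
  qed
qed

text \<open>From \<open>m1\<close> on, every window contains all sources of the slab, so its
  restriction is that of the block. The property minimised in \<open>stable_level\<close> therefore
  holds somewhere, and the \<open>LEAST\<close> in it has its intended meaning.\<close>

lemma restrict_stable:
  assumes "cut n a b" "strip K \<subseteq> slab a b"
  shows "graph_restrict (finite_forest \<eta> w n (stable_level \<eta> w n K)) (strip K) =
    graph_restrict (block \<eta> w n a b) (strip K)"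
proof -
  have rr: "graph_restrict (graph_restrict G (slab a b)) (strip K) = graph_restrict G (strip K)"
    for G :: site_graph using assms(2) by (auto simp: graph_restrict_def)
  define m1 where "m1 = nat (max \<bar>a\<bar> \<bar>b\<bar>)"
  have ev: "graph_restrict (finite_forest \<eta> w n m) (strip K) = graph_restrict (block \<eta> w n a b) (strip K)"
    if "m \<ge> m1" for m
  proof -
    have "graph_restrict (finite_forest \<eta> w n m) (slab a b) = block \<eta> w n a b"
      unfolding finite_forest_eq using assms that
      by (intro restrict_between) (auto simp: cut_def m1_def)
    then show ?thesis using rr by metis
  qed
  let ?P = "\<lambda>m0. \<forall>m\<ge>m0. graph_restrict (finite_forest \<eta> w n m) (strip K)
                        = graph_restrict (finite_forest \<eta> w n m0) (strip K)"
  have "?P m1" using ev by simp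
  then have "?P (stable_level \<eta> w n K)" unfolding stable_level_def by (rule LeastI)
  \<comment> \<open>The two descriptions are compared in a window beyond both indices, where both
    are valid.\<close>
  then show ?thesis using ev[of "max m1 (stable_level \<eta> w n K)"] by (metis max.cobounded1 max.cobounded2)
qed

text \<open>Strips centred at height 0 are replaced by all cuts. The new description mentions
  neither \<open>stable_level\<close> nor the origin, and so is compatible with translations and
  reflections.\<close>

lemma forest_at_eq:
  "pverts (forest_at \<eta> w n) = (\<Union>(a, b)\<in>{(a, b). cut n a b}. pverts (block \<eta> w n a b))"
  "parcs (forest_at \<eta> w n) = (\<Union>(a, b)\<in>{(a, b). cut n a b}. parcs (block \<eta> w n a b))"
proof -
  define R where "R K = graph_restrict (finite_forest \<eta> w n (stable_level \<eta> w n K)) (strip K)" for K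
  have F: "pverts (forest_at \<eta> w n) = (\<Union>K. pverts (R K))" "parcs (forest_at \<eta> w n) = (\<Union>K. parcs (R K))"
    by (simp_all add: forest_at_def graph_Union_def R_def)
  have 1: "\<exists>a b. cut n a b \<and> pverts (R K) \<subseteq> pverts (block \<eta> w n a b) \<and> parcs (R K) \<subseteq> parcs (block \<eta> w n a b)" for K
  proof -
    obtain a b where ab: "cut n a b" "\<And>y. y \<in> {- int K, int K} \<Longrightarrow> a < y \<and> y < b"
      using cut_exists[of "{- int K, int K}" n] by auto
    have "a < - int K" "int K < b" using ab(2)[of "int K"] ab(2)[of "- int K"] by simp_all
    then have "strip K \<subseteq> slab a b" by (auto simp: strip_def slab_def)
    from restrict_stable[OF ab(1) this] show ?thesis
      using ab(1) by (intro exI[of _ a] exI[of _ b]) (simp add: R_def graph_restrict_def)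
  qed
  have 2: "\<exists>K. pverts (block \<eta> w n a b) \<subseteq> pverts (R K) \<and> parcs (block \<eta> w n a b) \<subseteq> parcs (R K)" if "cut n a b" for a b
  proof -
    define K where "K = nat (max \<bar>a\<bar> \<bar>b\<bar>)"
    obtain a' b' where ab: "cut n a' b'" "\<And>y. y \<in> {- int K, int K} \<Longrightarrow> a' < y \<and> y < b'"
      using cut_exists[of "{- int K, int K}" n] by auto
    have aK: "a' < - int K" "int K < b'" using ab(2)[of "int K"] ab(2)[of "- int K"] by simp_all
    then have "strip K \<subseteq> slab a' b'" by (auto simp: strip_def slab_def)
    then have R: "R K = graph_restrict (block \<eta> w n a' b') (strip K)"
      using restrict_stable[OF ab(1)] by (simp add: R_def)
    have "\<bar>a\<bar> \<le> int K" "\<bar>b\<bar> \<le> int K" by (auto simp: K_def)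
    then have "a' \<le> a" "b \<le> b'" using aK by auto
    then have sub: "pverts (block \<eta> w n a b) \<subseteq> pverts (block \<eta> w n a' b')"
       "parcs (block \<eta> w n a b) \<subseteq> parcs (block \<eta> w n a' b')"
      using that block_subset by (auto simp: cut_def)
    have "slab a b \<subseteq> strip K" by (auto simp: slab_def strip_def K_def)
    then have "pverts (block \<eta> w n a b) \<subseteq> strip K" using block_verts[of a b n] that by (auto simp: cut_def)
    moreover have "parcs (block \<eta> w n a b) \<subseteq> pverts (block \<eta> w n a b) \<times> pverts (block \<eta> w n a b)"
      unfolding block_def by (rule parcs_grow_subset)
    ultimately show ?thesis using sub by (intro exI[of _ K]) (auto simp: R graph_restrict_def)
  qed
  show "pverts (forest_at \<eta> w n) = (\<Union>(a, b)\<in>{(a, b). cut n a b}. pverts (block \<eta> w n a b))"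
    unfolding F using 1 2 by fast
  show "parcs (forest_at \<eta> w n) = (\<Union>(a, b)\<in>{(a, b). cut n a b}. parcs (block \<eta> w n a b))"
    unfolding F using 1 2 by fast
qed

definition F where "F = forest_limit \<eta> w"

lemma limit_verts: "v \<in> pverts F \<longleftrightarrow> (\<exists>n\<ge>1. \<exists>a b. cut n a b \<and> v \<in> pverts (block \<eta> w n a b))"
  and limit_arcs: "e \<in> parcs F \<longleftrightarrow> (\<exists>n\<ge>1. \<exists>a b. cut n a b \<and> e \<in> parcs (block \<eta> w n a b))"
  by (auto simp: F_def forest_limit_def graph_Union_def forest_at_eq)

lemma common_block:
  assumes "cut n a b" "cut n' a' b'"
  obtains N A B where "n \<le> N" "n' \<le> N" "cut N A B" "A \<le> a" "b \<le> B" "A \<le> a'" "b' \<le> B"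
proof -
  obtain A B where "cut (max n n') A B" "\<And>y. y \<in> {a, a', b, b'} \<Longrightarrow> A < y \<and> y < B"
    using cut_exists[of "{a, a', b, b'}" "max n n'"] by auto
  then show ?thesis using that[of "max n n'" A B] by force
qed

lemma block_subset':
  assumes "cut n a b" "n \<le> N" "A \<le> a" "b \<le> B"
  shows "pverts (block \<eta> w n a b) \<subseteq> pverts (block \<eta> w N A B)"
    "parcs (block \<eta> w n a b) \<subseteq> parcs (block \<eta> w N A B)"
  using block_subset[of a b n A B] block_time_mono[OF assms(2), of A B] assms
  by (auto simp: cut_def)

text \<open>Backward paths of the limit cannot leave a block. The arc lies in some larger and later
  block, at whose time the rows \<open>a\<close> and \<open>b\<close> may be occupied; since its
  head was present at time \<open>n\<close>, \<open>grow_old_arcs\<close> returns it to that time,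
  when both rows are still empty.\<close>

lemma limit_arcs_into_block:
  assumes "cut n a b" "v \<in> pverts (block \<eta> w n a b)" "(u, v) \<in> parcs F"
  shows "(u, v) \<in> parcs (block \<eta> w n a b)"
proof -
  obtain n' a' b' where n': "cut n' a' b'" "(u, v) \<in> parcs (block \<eta> w n' a' b')"
    using assms(3) limit_arcs by blast
  obtain N A B where N: "n \<le> N" "n' \<le> N" "cut N A B" "A \<le> a" "b \<le> B" "A \<le> a'" "b' \<le> B"
    using common_block[OF assms(1) n'(1)] by blast
  have ab: "a < b" "empty_level \<eta> w n a" "empty_level \<eta> w n b" using assms(1) by (auto simp: cut_def)
  have "(u, v) \<in> parcs (block \<eta> w N A B)" using n' N block_subset'(2)[OF n'(1)] by blast
  moreover have "v \<in> pverts (block \<eta> w n A B)" using block_subset(1)[OF ab N(4,5)] assms(2) by blast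
  moreover obtain l where "schedule \<eta> N [A+1..B-1] = schedule \<eta> n [A+1..B-1] @ l"
    using schedule_prefix[OF adm _ N(1), of "[A+1..B-1]"] by auto
  ultimately have arc: "(u, v) \<in> parcs (block \<eta> w n A B)"
    unfolding block_def using grow_old_arcs by metis
  have v: "v \<in> slab a b" using block_verts[OF ab] assms(2) by blast
  have "u \<in> pverts (block \<eta> w n A B)" using arc parcs_grow_subset unfolding block_def by blast
  \<comment> \<open>The tail is a lattice neighbour of \<open>v\<close> and stands on neither empty
    row, so it lies in the same slab.\<close>
  then have "u \<notin> level a" "u \<notin> level b"
    using empty_level_window[OF ab(2), of "[A+1..B-1]"] empty_level_window[OF ab(3), of "[A+1..B-1]"]
    by (auto simp: block_def)
  moreover have "\<bar>snd u - snd v\<bar> \<le> 1"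
    using arc parcs_grow_lattice[OF walks] unfolding block_def by (force simp: lattice_arcs_def)
  ultimately have "u \<in> slab a b" using v by (auto simp: level_def slab_def)
  then have "(u, v) \<in> parcs (graph_restrict (block \<eta> w n A B) (slab a b))"
    using arc v by (simp add: graph_restrict_def)
  then show ?thesis using block_nested[OF ab N(4,5)] by simp
qed

sublocale forest F
proof
  show "parcs F \<subseteq> pverts F \<times> pverts F"
  proof
    fix e assume "e \<in> parcs F"
    then obtain n a b where "n \<ge> 1" "cut n a b" "e \<in> parcs (block \<eta> w n a b)" using limit_arcs by blast
    then show "e \<in> pverts F \<times> pverts F"
      using parcs_grow_subset[of w "schedule \<eta> n [a+1..b-1]"] by (fastforce simp: limit_verts block_def)
  qed
  then have tgt: "v \<in> pverts F" if "(u, v) \<in> parcs F" for u v using that by auto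
  show "u = u'" if uv: "(u, v) \<in> parcs F" "(u', v) \<in> parcs F" for u u' v
  proof -
    obtain n a b where "cut n a b" "v \<in> pverts (block \<eta> w n a b)" using tgt[OF uv(1)] limit_verts by blast
    then show ?thesis using limit_arcs_into_block uv grow_in_unique unfolding block_def by blast
  qed
  \<comment> \<open>Accessibility of a vertex is proved inside one finite block that contains it,
    since its predecessors stay there; a point outside the vertex set has no predecessor.\<close>
  have "v \<in> Wellfounded.acc (parcs F)" for v
  proof (cases "v \<in> pverts F")
    case True
    then obtain n a b where n: "cut n a b" "v \<in> pverts (block \<eta> w n a b)" using limit_verts by blast
    have "wf (parcs (block \<eta> w n a b))" unfolding block_def by (rule wf_parcs_grow)
    then show ?thesis using n(2)
    proof (induction v rule: wf_induct_rule)
      case (less v)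
      show ?case
      proof (rule accI)
        fix u assume "(u, v) \<in> parcs F"
        then have "(u, v) \<in> parcs (block \<eta> w n a b)" using limit_arcs_into_block n less.prems by blast
        then show "u \<in> Wellfounded.acc (parcs F)"
          using less.IH parcs_grow_subset unfolding block_def by blast
      qed
    qed
  next
    case False
    show ?thesis by (rule accI) (use tgt False in blast)
  qed
  then show "wf (parcs F)" by (rule wf_iff_acc[THEN iffD2, OF allI])
qed

lemma limit_lattice: "parcs F \<subseteq> lattice_arcs"
  using limit_arcs parcs_grow_lattice[OF walks] unfolding block_def by blast

lemma roots_on_axis: "roots \<subseteq> {0} \<times> UNIV"
proof
  fix v assume v: "v \<in> roots"
  then obtain n a b where n: "n \<ge> 1" "cut n a b" "v \<in> pverts (block \<eta> w n a b)"
    unfolding roots_def using limit_verts by blast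
  have "(u, v) \<notin> parcs F" for u using v unfolding roots_def by blast
  then have "(u, v) \<notin> parcs (block \<eta> w n a b)" for u using n limit_arcs by blast
  then have "fst v = 0" using grow_root_or_arc[OF walks] n(3) unfolding block_def by blast
  then show "v \<in> {0} \<times> UNIV" by (cases v) auto
qed

lemma infinite_roots:
  assumes "\<And>Y. \<exists>i>Y. npoints (\<eta> i) 1 \<ge> 1"
  shows "infinite roots"
proof
  assume "finite roots"
  define Y where "Y = Max (insert 0 (snd ` roots))"
  obtain a where a: "a > Y" "empty_level \<eta> w 1 a" using sep unfolding separated_def by blast
  obtain i where i: "i > a" "npoints (\<eta> i) 1 \<ge> 1" using assms by blast
  obtain b where b: "b > i" "empty_level \<eta> w 1 b" using sep unfolding separated_def by blast
  have ab: "cut 1 a b" using a b i by (simp add: cut_def)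
  let ?B = "block \<eta> w 1 a b"
  have "(i, 1) \<in> set (schedule \<eta> 1 [a+1..b-1])" using i b by (simp add: set_schedule[OF adm])
  then have "pverts ?B \<noteq> {}" unfolding block_def by (intro grow_nonempty) auto
  \<comment> \<open>A vertex of the block minimal for its well-founded arcs has no incoming arc
    there, and by \<open>limit_arcs_into_block\<close> none in the limit. The block was chosen above
    all roots.\<close>
  then obtain v where v: "v \<in> pverts ?B" "\<And>u. (u, v) \<in> parcs ?B \<Longrightarrow> u \<notin> pverts ?B"
    using wf_parcs_grow[of w "schedule \<eta> 1 [a+1..b-1]"] unfolding block_def
    by (metis ex_in_conv wfE_min)
  then have nv: "(u, v) \<notin> parcs ?B" for u using parcs_grow_subset unfolding block_def by blast
  then have "(u, v) \<notin> parcs F" for u using limit_arcs_into_block[OF ab v(1)] by blast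
  moreover have "v \<in> pverts F" using ab v(1) limit_verts by blast
  ultimately have "v \<in> roots" by (auto simp: roots_def)
  moreover have "snd v > Y" using block_verts[of a b 1] ab v(1) a(1) by (auto simp: cut_def slab_def)
  ultimately show False using \<open>finite roots\<close> unfolding Y_def
    by (metis Max_ge finite_imageI finite_insert image_eqI insertCI leD)
qed

lemma straight_walks_reach:
  assumes "infinite {j. j \<ge> 1 \<and> (\<forall>k\<le>m. w y j k = (c k, y))}"
  shows "(c m, y) \<in> pverts F"
proof -
  obtain J where J: "J \<subseteq> {j. j \<ge> 1 \<and> (\<forall>k\<le>m. w y j k = (c k, y))}" "finite J" "card J = Suc m"
    using infinite_arbitrarily_large[OF assms] by blast
  define t where "t = Max (nth_point (\<eta> y) ` J)"
  \<comment> \<open>All particles of \<open>J\<close> are launched by time \<open>t\<close>, and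
    times below 1 do not occur in the union defining the limit.\<close>
  define n where "n = max 1 (nat \<lceil>t\<rceil>)"
  have "nth_point (\<eta> y) j \<le> real n" if "j \<in> J" for j
  proof -
    have "nth_point (\<eta> y) j \<le> t" unfolding t_def using J that by auto
    also have "t \<le> real n" unfolding n_def by linarith
    finally show ?thesis .
  qed
  then have jn: "j \<le> npoints (\<eta> y) n" if "j \<in> J" for j
    using admissible_nth_point(3)[OF adm, of j y n] J that by auto
  obtain a b where ab: "cut n a b" "a < y" "y < b"
    by (rule cut_exists[of "{y}" n]) auto
  let ?l = "schedule \<eta> n [a+1..b-1]" and ?Q = "\<lambda>p. \<forall>k\<le>m. walk_of w p k = (c k, y)"
  have "Pair y ` J \<subseteq> set (filter ?Q ?l)" using J jn ab by (auto simp: set_schedule[OF adm])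
  then have "card (Pair y ` J) \<le> card (set (filter ?Q ?l))" by (intro card_mono) auto
  then have "Suc m \<le> length (filter ?Q ?l)"
    using J(3) card_image[of "Pair y" J] card_length[of "filter ?Q ?l"] by (auto simp: inj_on_def)
  then have "(\<lambda>k. (c k, y)) ` {..m} \<subseteq> pverts (block \<eta> w n a b)"
    unfolding block_def by (rule straight_walks_fill)
  moreover have "n \<ge> 1" by (simp add: n_def)
  ultimately show ?thesis using ab(1) limit_verts by blast
qed

end

section \<open>Equivariance\<close>

lemma closed_interval_eq: "{a + 1..b - 1} = {a<..<b :: int}"
  by auto

lemma open_interval_image:
  fixes k :: int
  shows "(\<lambda>i. i + k) ` {a<..<b} = {a + k<..<b + k}" "(\<lambda>i. k - i) ` {a<..<b} = {k - b<..<k - a}"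
proof -
  have "x \<in> (\<lambda>i. i + k) ` {a<..<b}" if "x \<in> {a + k<..<b + k}" for x
    using that by (intro image_eqI[of _ _ "x - k"]) auto
  then show "(\<lambda>i. i + k) ` {a<..<b} = {a + k<..<b + k}" by auto
  have "x \<in> (\<lambda>i. k - i) ` {a<..<b}" if "x \<in> {k - b<..<k - a}" for x
    using that by (intro image_eqI[of _ _ "k - x"]) auto
  then show "(\<lambda>i. k - i) ` {a<..<b} = {k - b<..<k - a}" by auto
qed

text \<open>Covers vertical translations and the reflections in both axes at once: \<open>f\<close>
  acts on sites and \<open>g\<close> is its trace on levels. Launch times travel with the sources,
  so the order of launching is preserved.\<close>

locale site_symmetry = regular_input \<eta> w + im: regular_input \<eta>' w' for \<eta> w \<eta>' w' +
  fixes f :: "site \<Rightarrow> site" and g :: "int \<Rightarrow> int" and k :: int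
  assumes f: "bij f" "\<And>v. snd (f v) = g (snd v)"
    and g: "g = (\<lambda>i. i + k) \<or> g = (\<lambda>i. k - i)"
    and points: "\<And>i. \<eta>' (g i) = \<eta> i"
    and walks_image: "\<And>i j l. j \<ge> 1 \<Longrightarrow> w' (g i) j l = f (w i j l)"
begin

lemma bij_g: "bij g"
  using g
proof
  assume "g = (\<lambda>i. i + k)"
  then show ?thesis by (intro o_bij[of "\<lambda>i. i - k"]) auto
next
  assume "g = (\<lambda>i. k - i)"
  then show ?thesis by (intro o_bij[of "\<lambda>i. k - i"]) auto
qed

lemma grow_window_image:
  assumes "distinct is" "distinct is'" "set is' = g ` set is"
  shows "grow w' (schedule \<eta>' n is') = graph_image f (grow w (schedule \<eta> n is))"
proof -
  have "schedule \<eta>' n is' = map (\<lambda>(i, j). (g i, j)) (schedule \<eta> n is)"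
    using assms bij_g points by (intro schedule_image[OF adm _ _ im.adm]) (auto simp: bij_is_inj)
  moreover have "grow w' (map (\<lambda>(i, j). (g i, j)) (schedule \<eta> n is)) = graph_image f (grow w (schedule \<eta> n is))"
    using f(1) walks_image by (intro grow_image) (auto simp: bij_is_inj dest: schedule_labels)
  ultimately show ?thesis by simp
qed

text \<open>The image of a symmetric window under \<open>g\<close> is in general not symmetric;
  \<open>empty_level_window\<close>, which allows any distinct list of sources, bridges the gap in
  both directions.\<close>

lemma empty_level_image: "empty_level \<eta>' w' n (g y) \<longleftrightarrow> empty_level \<eta> w n y"
proof
  assume *: "empty_level \<eta> w n y"
  show "empty_level \<eta>' w' n (g y)"
    unfolding empty_level_def
  proof
    fix m
    have "grow w' (schedule \<eta>' n [- int m..int m]) = graph_image f (grow w (schedule \<eta> n (map (inv g) [- int m..int m])))"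
      using bij_g by (intro grow_window_image)
        (auto simp: distinct_map image_image bij_is_surj surj_f_inv_f intro: inj_on_subset[OF bij_is_inj[OF bij_imp_bij_inv]])
    moreover have "pverts (grow w (schedule \<eta> n (map (inv g) [- int m..int m]))) \<inter> level y = {}"
      using bij_g by (intro empty_level_window[OF *])
        (auto simp: distinct_map intro: inj_on_subset[OF bij_is_inj[OF bij_imp_bij_inv]])
    moreover have "snd (f v) = g y \<longleftrightarrow> snd v = y" for v
      using bij_g by (auto simp: f(2) dest: injD[OF bij_is_inj])
    ultimately show "pverts (finite_forest \<eta>' w' n m) \<inter> level (g y) = {}"
      unfolding finite_forest_eq level_def graph_image_def by auto
  qed
next
  assume *: "empty_level \<eta>' w' n (g y)"
  show "empty_level \<eta> w n y"
    unfolding empty_level_def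
  proof
    fix m
    have "grow w' (schedule \<eta>' n (map g [- int m..int m])) = graph_image f (grow w (schedule \<eta> n [- int m..int m]))"
      using bij_g by (intro grow_window_image) (auto simp: distinct_map intro: inj_on_subset[OF bij_is_inj])
    moreover have "pverts (grow w' (schedule \<eta>' n (map g [- int m..int m]))) \<inter> level (g y) = {}"
      using bij_g by (intro im.empty_level_window[OF *]) (auto simp: distinct_map intro: inj_on_subset[OF bij_is_inj])
    ultimately show "pverts (finite_forest \<eta> w n m) \<inter> level y = {}"
      using f(2) unfolding finite_forest_eq level_def graph_image_def by auto
  qed
qed

text \<open>Cuts of the image input are exactly the images of cuts, with corresponding blocks; the
  union over cuts in \<open>forest_at_eq\<close> then commutes with \<open>f\<close>.\<close>

lemma forest_at_image:
  assumes "separated \<eta> w"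
  shows "forest_at \<eta>' w' n = graph_image f (forest_at \<eta> w n)"
proof -
  interpret s: separated_input \<eta> w by unfold_locales (rule assms)
  have "separated \<eta>' w'"
    unfolding separated_def
  proof (intro allI)
    fix n Y
    have "\<exists>y>Y. empty_level \<eta>' w' n (g y')" if "Y < g y'" "empty_level \<eta> w n y'" for y'
      using that empty_level_image by blast
    have up: "\<exists>y. Z < y \<and> empty_level \<eta> w n y" and down: "\<exists>y. y < Z \<and> empty_level \<eta> w n y" for Z
      using assms unfolding separated_def by blast+
    show "(\<exists>y>Y. empty_level \<eta>' w' n y) \<and> (\<exists>y<Y. empty_level \<eta>' w' n y)"
      using g
    proof
      assume g: "g = (\<lambda>i. i + k)"
      obtain y1 y2 where "Y - k < y1" "empty_level \<eta> w n y1" "y2 < Y - k" "empty_level \<eta> w n y2"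
        using up down by meson
      then show ?thesis using empty_level_image[of n y1] empty_level_image[of n y2] unfolding g
        by (metis diff_less_eq less_diff_eq)
    next
      assume g: "g = (\<lambda>i. k - i)"
      obtain y1 y2 where "k - Y < y1" "empty_level \<eta> w n y1" "y2 < k - Y" "empty_level \<eta> w n y2"
        using up down by meson
      then show ?thesis using empty_level_image[of n y1] empty_level_image[of n y2] unfolding g
        by (metis diff_less_eq less_diff_eq add.commute)
    qed
  qed
  then interpret s': separated_input \<eta>' w' by unfold_locales
  have cut_fwd: "\<exists>a' b'. s'.cut n a' b' \<and> block \<eta>' w' n a' b' = graph_image f (block \<eta> w n a b)"
    if "s.cut n a b" for a b
  proof -
    \<comment> \<open>\<open>min\<close> and \<open>max\<close> treat both forms of \<open>g\<close>
      together: a reflection exchanges the two ends of the cut.\<close>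
    define a' where "a' = min (g a) (g b)"
    define b' where "b' = max (g a) (g b)"
    have "g a \<noteq> g b" using that bij_g by (auto simp: s.cut_def dest: injD[OF bij_is_inj])
    then have "s'.cut n a' b'"
      using that empty_level_image unfolding s.cut_def s'.cut_def a'_def b'_def
      by (auto simp: min_def max_def)
    moreover have "{a'<..<b'} = g ` {a<..<b}"
      using g
    proof
      assume g: "g = (\<lambda>i. i + k)"
      show ?thesis
        using that unfolding a'_def b'_def s.cut_def g
        by (simp add: min_def max_def open_interval_image)
    next
      assume g: "g = (\<lambda>i. k - i)"
      show ?thesis
        using that unfolding a'_def b'_def s.cut_def g
        by (simp add: min_def max_def open_interval_image)
    qed
    then have "block \<eta>' w' n a' b' = graph_image f (block \<eta> w n a b)"
      unfolding block_def by (intro grow_window_image) (simp_all add: closed_interval_eq)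
    ultimately show ?thesis by blast
  qed
  have cut_bwd: "\<exists>a b. s.cut n a b \<and> block \<eta>' w' n a' b' = graph_image f (block \<eta> w n a b)"
    if "s'.cut n a' b'" for a' b'
  proof -
    have gi: "g (inv g i) = i" for i using bij_g by (simp add: bij_is_surj surj_f_inv_f)
    define a where "a = min (inv g a') (inv g b')"
    define b where "b = max (inv g a') (inv g b')"
    have "inv g a' \<noteq> inv g b'" using that gi by (metis less_irrefl s'.cut_def)
    then have "s.cut n a b"
      using that gi empty_level_image[of n "inv g a'"] empty_level_image[of n "inv g b'"]
      unfolding s.cut_def s'.cut_def a_def b_def by (auto simp: min_def max_def)
    moreover have "{a'<..<b'} = g ` {a<..<b}"
      using g
    proof
      assume g: "g = (\<lambda>i. i + k)"
      have "inv g = (\<lambda>i. i - k)" using gi unfolding g by (auto simp: fun_eq_iff algebra_simps)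
      then show ?thesis
        using that unfolding a_def b_def s'.cut_def unfolding g
        by (simp add: min_def max_def open_interval_image)
    next
      assume g: "g = (\<lambda>i. k - i)"
      have "inv g = (\<lambda>i. k - i)" using gi unfolding g by (auto simp: fun_eq_iff algebra_simps)
      then show ?thesis
        using that unfolding a_def b_def s'.cut_def unfolding g
        by (simp add: min_def max_def open_interval_image)
    qed
    then have "block \<eta>' w' n a' b' = graph_image f (block \<eta> w n a b)"
      unfolding block_def by (intro grow_window_image) (simp_all add: closed_interval_eq)
    ultimately show ?thesis by blast
  qed
  show ?thesis
  proof (rule pair_pre_digraph.equality)
    show "pverts (forest_at \<eta>' w' n) = pverts (graph_image f (forest_at \<eta> w n))"
    proof
      show "pverts (forest_at \<eta>' w' n) \<subseteq> pverts (graph_image f (forest_at \<eta> w n))"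
        using cut_bwd by (fastforce simp: s.forest_at_eq s'.forest_at_eq graph_image_def)
      show "pverts (graph_image f (forest_at \<eta> w n)) \<subseteq> pverts (forest_at \<eta>' w' n)"
        using cut_fwd by (fastforce simp: s.forest_at_eq s'.forest_at_eq graph_image_def)
    qed
    show "parcs (forest_at \<eta>' w' n) = parcs (graph_image f (forest_at \<eta> w n))"
    proof
      show "parcs (forest_at \<eta>' w' n) \<subseteq> parcs (graph_image f (forest_at \<eta> w n))"
      proof
        fix e assume "e \<in> parcs (forest_at \<eta>' w' n)"
        then obtain a' b' where "s'.cut n a' b'" "e \<in> parcs (block \<eta>' w' n a' b')" by (auto simp: s'.forest_at_eq)
        moreover obtain a b where "s.cut n a b" "block \<eta>' w' n a' b' = graph_image f (block \<eta> w n a b)"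
          using cut_bwd calculation(1) by blast
        ultimately show "e \<in> parcs (graph_image f (forest_at \<eta> w n))"
          by (auto simp: s.forest_at_eq graph_image_def)
      qed
      show "parcs (graph_image f (forest_at \<eta> w n)) \<subseteq> parcs (forest_at \<eta>' w' n)"
      proof
        fix e assume "e \<in> parcs (graph_image f (forest_at \<eta> w n))"
        then obtain a b e' where "s.cut n a b" "e' \<in> parcs (block \<eta> w n a b)" "e = map_prod f f e'"
          by (auto simp: s.forest_at_eq graph_image_def)
        moreover obtain a' b' where "s'.cut n a' b'" "block \<eta>' w' n a' b' = graph_image f (block \<eta> w n a b)"
          using cut_fwd calculation(1) by blast
        ultimately have "s'.cut n a' b'" "e \<in> parcs (block \<eta>' w' n a' b')" by (simp_all add: graph_image_def)
        then show "e \<in> parcs (forest_at \<eta>' w' n)"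
          unfolding s'.forest_at_eq by blast
      qed
    qed
  qed simp
qed

lemma forest_limit_image:
  assumes "separated \<eta> w"
  shows "forest_limit \<eta>' w' = graph_image f (forest_limit \<eta> w)"
  unfolding forest_limit_def
  by (simp add: forest_at_image[OF assms] graph_Union_def graph_image_def image_UN)

end

section \<open>Measurability\<close>

lemma space_config_space [simp]: "space config_space = locally_finite_configs"
  by (auto simp: config_space_def space_measure_of_conv)

lemma sets_config_space: "sets config_space = sigma_sets locally_finite_configs
     {{\<eta> \<in> locally_finite_configs. card (\<eta> \<inter> B) = k} | B k. B \<in> sets borel \<and> bounded B}"
  unfolding config_space_def by (rule sets_measure_of) auto

lemma measurable_card_config:
  assumes "B \<in> sets borel" "bounded B"
  shows "(\<lambda>e. card (e \<inter> B)) \<in> config_space \<rightarrow>\<^sub>M count_space UNIV"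
proof (subst measurable_count_space_eq2_countable, intro conjI ballI)
  fix k
  have "(\<lambda>e. card (e \<inter> B)) -` {k} \<inter> space config_space = {\<eta> \<in> locally_finite_configs. card (\<eta> \<inter> B) = k}"
    by auto
  also have "\<dots> \<in> sets config_space" unfolding sets_config_space
    using assms by (intro sigma_sets.Basic) auto
  finally show "(\<lambda>e. card (e \<inter> B)) -` {k} \<inter> space config_space \<in> sets config_space" .
qed auto

lemma npoints_eq_card:
  assumes "e \<in> locally_finite_configs"
  shows "npoints e t = card (e \<inter> {0..t})"
proof -
  have "{s \<in> e. s \<le> t} = e \<inter> {0..t}" using assms by (auto simp: locally_finite_configs_def)
  then show ?thesis by (simp add: npoints_def)
qed

lemma measurable_npoints [measurable]: "(\<lambda>e. npoints e t) \<in> config_space \<rightarrow>\<^sub>M count_space UNIV"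
  using measurable_card_config[of "{0..t}"] by (subst measurable_cong[OF npoints_eq_card]) auto

lemma measurable_nth_point [measurable]: "(\<lambda>e. nth_point e j) \<in> borel_measurable config_space"
proof (rule borel_measurableI_le)
  fix a :: real
  \<comment> \<open>If no point of rank \<open>j\<close> exists, the defining predicate is
    identically false and \<open>THE\<close> returns one fixed real, the same for all such
    configurations; the sublevel set stays measurable.\<close>
  have eq: "nth_point e j \<le> a \<longleftrightarrow> (if 1 \<le> j \<and> (\<exists>m::nat. j \<le> npoints e m) then j \<le> npoints e a else (THE t::real. False) \<le> a)"
    if e: "e \<in> space config_space" for e
  proof (cases "1 \<le> j \<and> (\<exists>m::nat. j \<le> npoints e m)")
    case True
    then show ?thesis using nth_point_le_iff e by auto
  next
    case False
    have "\<not> (t \<in> e \<and> card {s \<in> e. s \<le> t} = j)" for t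
    proof
      assume t: "t \<in> e \<and> card {s \<in> e. s \<le> t} = j"
      then have "npoints e t \<in> {1..npoints e t}" using npoints_image[of e t] e by auto
      moreover obtain m :: nat where "t \<le> real m" using real_arch_simple by blast
      ultimately show False using False t npoints_mono[of e t m] e by (auto simp: npoints_def)
    qed
    then have "(\<lambda>t. t \<in> e \<and> card {s \<in> e. s \<le> t} = j) = (\<lambda>_. False)" by blast
    then have "nth_point e j = (THE t. False)" unfolding nth_point_def by (rule arg_cong)
    then show ?thesis by (simp only: if_not_P[OF False])
  qed
  have "{e \<in> space config_space. if 1 \<le> j \<and> (\<exists>m::nat. j \<le> npoints e m) then j \<le> npoints e a else (THE t::real. False) \<le> a} \<in> sets config_space"
    by measurable
  also have "?this \<longleftrightarrow> {e \<in> space config_space. nth_point e j \<le> a} \<in> sets config_space"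
    by (intro arg_cong[where f = "\<lambda>A. A \<in> sets config_space"] Collect_cong conj_cong refl eq[symmetric])
  finally show "{e \<in> space config_space. nth_point e j \<le> a} \<in> sets config_space" .
qed

lemma measurable_countable2:
  fixes a :: "'a \<Rightarrow> 'b::countable" and b :: "'a \<Rightarrow> 'c::countable"
  assumes "a \<in> M \<rightarrow>\<^sub>M count_space UNIV" "b \<in> M \<rightarrow>\<^sub>M count_space UNIV"
  shows "(\<lambda>x. h (a x) (b x)) \<in> M \<rightarrow>\<^sub>M count_space UNIV"
proof -
  have "(\<lambda>x. h i (b x)) \<in> M \<rightarrow>\<^sub>M count_space UNIV" for i
    by (rule measurable_compose[OF assms(2)]) simp
  from measurable_compose_countable[of "\<lambda>i x. h i (b x)", OF this assms(1)] show ?thesis .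
qed

lemma measurable_sorted_list_of_set:
  fixes A :: "'a \<Rightarrow> nat set"
  assumes [measurable]: "\<And>j. Measurable.pred M (\<lambda>x. j \<in> A x)"
  shows "(\<lambda>x. sorted_list_of_set (A x)) \<in> M \<rightarrow>\<^sub>M count_space UNIV"
proof (subst measurable_count_space_eq2_countable, intro conjI ballI)
  fix l :: "nat list"
  \<comment> \<open>The event is written with countable quantifiers only; the second disjunct
    reflects that an infinite set is sorted to \<open>[]\<close> by default.\<close>
  have "sorted_list_of_set (A x) = l \<longleftrightarrow>
     ((\<exists>b. \<forall>j. j \<in> A x \<longrightarrow> j \<le> b) \<and> sorted_wrt (<) l \<and> (\<forall>j. j \<in> A x \<longleftrightarrow> j \<in> set l)) \<or>
     ((\<forall>b. \<exists>j. j \<in> A x \<and> \<not> j \<le> b) \<and> l = [])" for x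
  proof (cases "finite (A x)")
    case True
    then have b: "\<exists>b. \<forall>j. j \<in> A x \<longrightarrow> j \<le> b" unfolding finite_nat_set_iff_bounded_le Ball_def .
    have fin_False: "(\<forall>b. \<exists>j. j \<in> A x \<and> \<not> j \<le> b) = False" and fin_True: "(\<exists>b. \<forall>j. j \<in> A x \<longrightarrow> j \<le> b) = True"
      using b by blast+
    have 1: "(sorted_list_of_set (A x) = l) = (sorted_wrt (<) l \<and> set l = A x)"
    proof -
      have "set l = A x \<Longrightarrow> sorted_wrt (<) l \<Longrightarrow> length l = card (A x)"
        using distinct_card[of l] by (simp add: strict_sorted_iff)
      then show ?thesis using sorted_list_of_set_unique[OF True, of l] by argo
    qed
    have 2: "(set l = A x) = (\<forall>j. j \<in> A x \<longleftrightarrow> j \<in> set l)" by blast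
    show ?thesis unfolding fin_False fin_True 1 2 by blast
  next
    case False
    then have "\<not> (\<exists>b. \<forall>j. j \<in> A x \<longrightarrow> j \<le> b)" unfolding finite_nat_set_iff_bounded_le Ball_def .
    then have inf_True: "(\<forall>b. \<exists>j. j \<in> A x \<and> \<not> j \<le> b) = True" and inf_False: "(\<exists>b. \<forall>j. j \<in> A x \<longrightarrow> j \<le> b) = False"
      by blast+
    have "sorted_list_of_set (A x) = []" using False by simp
    then have "(sorted_list_of_set (A x) = l) = (l = [])" by blast
    then show ?thesis unfolding inf_True inf_False simp_thms .
  qed
  moreover have "{x \<in> space M. ((\<exists>b. \<forall>j. j \<in> A x \<longrightarrow> j \<le> b) \<and> sorted_wrt (<) l \<and> (\<forall>j. j \<in> A x \<longleftrightarrow> j \<in> set l)) \<or>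
     ((\<forall>b. \<exists>j. j \<in> A x \<and> \<not> j \<le> b) \<and> l = [])} \<in> sets M"
    by measurable
  ultimately show "(\<lambda>x. sorted_list_of_set (A x)) -` {l} \<inter> space M \<in> sets M"
    by (simp add: vimage_def Collect_conj_eq[symmetric] Int_def conj_commute)
qed auto

lemma measurable_sort_key:
  fixes f :: "'a \<Rightarrow> 'b::countable \<Rightarrow> real"
  assumes [measurable]: "\<And>y. (\<lambda>x. f x y) \<in> borel_measurable M"
  shows "(\<lambda>x. sort_key (f x) ys) \<in> M \<rightarrow>\<^sub>M count_space UNIV"
proof (induction ys)
  case (Cons y ys)
  have "(\<lambda>x. insort_key (f x) y zs) \<in> M \<rightarrow>\<^sub>M count_space UNIV" for zs
  proof (induction zs)
    case (Cons z zs)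
    have "(\<lambda>x. if f x y \<le> f x z then y # z # zs else z # insort_key (f x) y zs) \<in> M \<rightarrow>\<^sub>M count_space UNIV"
      by (intro measurable_If measurable_compose[OF Cons]) auto
    then show ?case by simp
  qed simp
  from measurable_compose_countable[OF this Cons] show ?case by simp
qed simp

lemma measurable_schedule:
  assumes [measurable]: "\<And>i. N i \<in> M \<rightarrow>\<^sub>M config_space"
  shows "(\<lambda>x. schedule (\<lambda>i. N i x) n is) \<in> M \<rightarrow>\<^sub>M count_space UNIV"
proof -
  have L: "(\<lambda>x. sorted_list_of_set {j. 1 \<le> j \<and> nth_point (N i x) j \<le> real n}) \<in> M \<rightarrow>\<^sub>M count_space UNIV" for i
    by (rule measurable_sorted_list_of_set) simp
  have C: "(\<lambda>x. concat (map (\<lambda>i. map (Pair i) (sorted_list_of_set {j. 1 \<le> j \<and> nth_point (N i x) j \<le> real n})) is))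
      \<in> M \<rightarrow>\<^sub>M count_space UNIV"
  proof (induction "is")
    case (Cons i "is")
    from measurable_countable2[OF L[of i] Cons, of "\<lambda>l l'. map (Pair i) l @ l'"] show ?case by simp
  qed simp
  have [measurable]: "(\<lambda>x. case p of (i, j) \<Rightarrow> nth_point (N i x) j) \<in> borel_measurable M" for p
    by (cases p) simp
  show ?thesis unfolding schedule_def
    by (rule measurable_compose_countable[OF measurable_sort_key C]) simp
qed

section \<open>Measurability of launches, windows and limits\<close>

lemma measurable_forest_iff:
  "F \<in> M \<rightarrow>\<^sub>M forest_space \<longleftrightarrow>
     (\<forall>v. Measurable.pred M (\<lambda>x. v \<in> pverts (F x))) \<and> (\<forall>e. Measurable.pred M (\<lambda>x. e \<in> parcs (F x)))"
proof
  assume F: "F \<in> M \<rightarrow>\<^sub>M forest_space"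
  have "{G. v \<in> pverts G} \<in> sets forest_space" "{G. e \<in> parcs G} \<in> sets forest_space" for v e
    by (auto simp: forest_space_def)
  from measurable_sets[OF F this(1)] measurable_sets[OF F this(2)]
  show "(\<forall>v. Measurable.pred M (\<lambda>x. v \<in> pverts (F x))) \<and> (\<forall>e. Measurable.pred M (\<lambda>x. e \<in> parcs (F x)))"
    by (auto simp: pred_def vimage_def Int_def conj_commute)
next
  assume *: "(\<forall>v. Measurable.pred M (\<lambda>x. v \<in> pverts (F x))) \<and> (\<forall>e. Measurable.pred M (\<lambda>x. e \<in> parcs (F x)))"
  show "F \<in> M \<rightarrow>\<^sub>M forest_space"
    unfolding forest_space_def
    by (rule measurable_measure_of) (use * in \<open>auto simp: pred_def vimage_def Int_def conj_commute\<close>)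
qed

lemma measurable_pverts [measurable (raw)]: "F \<in> M \<rightarrow>\<^sub>M forest_space \<Longrightarrow> Measurable.pred M (\<lambda>x. v \<in> pverts (F x))"
  and measurable_parcs [measurable (raw)]: "F \<in> M \<rightarrow>\<^sub>M forest_space \<Longrightarrow> Measurable.pred M (\<lambda>x. e \<in> parcs (F x))"
  using measurable_forest_iff[of F M] by blast+

lemma measurable_walk: "s \<in> M \<rightarrow>\<^sub>M walk_space \<Longrightarrow> (\<lambda>x. s x k) \<in> M \<rightarrow>\<^sub>M count_space UNIV"
  unfolding walk_space_def
  by (rule measurable_compose[OF _ measurable_component_singleton[of k UNIV "\<lambda>_. count_space UNIV"]]) auto

lemma measurable_site_in_pverts:
  assumes [measurable]: "F \<in> M \<rightarrow>\<^sub>M forest_space" "s \<in> M \<rightarrow>\<^sub>M count_space UNIV"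
  shows "Measurable.pred M (\<lambda>x. s x \<in> pverts (F x))"
proof -
  have "Measurable.pred M (\<lambda>x. \<exists>v::site. s x = v \<and> v \<in> pverts (F x))" by measurable
  then show ?thesis by simp
qed

lemma measurable_first_exit:
  assumes "F \<in> M \<rightarrow>\<^sub>M forest_space" "s \<in> M \<rightarrow>\<^sub>M walk_space"
  shows "Measurable.pred M (\<lambda>x. first_exit (s x) (pverts (F x)) k)"
proof -
  note [measurable] = measurable_site_in_pverts[OF assms(1) measurable_walk[OF assms(2)]]
  have "Measurable.pred M (\<lambda>x. s x k \<notin> pverts (F x) \<and> (\<forall>k'. k' < k \<longrightarrow> s x k' \<in> pverts (F x)))"
    by measurable
  then show ?thesis by (simp add: first_exit_def)
qed

lemma measurable_launch:
  assumes F: "F \<in> M \<rightarrow>\<^sub>M forest_space" and s: "s \<in> M \<rightarrow>\<^sub>M walk_space"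
  shows "(\<lambda>x. launch (s x) (F x)) \<in> M \<rightarrow>\<^sub>M forest_space"
proof -
  note [measurable] = F measurable_first_exit[OF F s] measurable_walk[OF s]
  have "Measurable.pred M (\<lambda>x. v \<in> pverts (launch (s x) (F x)))" for v
    unfolding pverts_launch_iff by measurable
  moreover have "Measurable.pred M (\<lambda>x. e \<in> parcs (launch (s x) (F x)))" for e
  proof -
    have "Measurable.pred M (\<lambda>x. e \<in> parcs (F x) \<or>
       (\<exists>k. s x k = fst e \<and> s x (Suc k) = snd e \<and> first_exit (s x) (pverts (F x)) (Suc k)))"
      by measurable
    moreover have "e = (s x k, s x (Suc k)) \<longleftrightarrow> s x k = fst e \<and> s x (Suc k) = snd e" for x k
      by (cases e) auto
    ultimately show ?thesis unfolding parcs_launch_iff by simp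
  qed
  ultimately show ?thesis by (simp add: measurable_forest_iff)
qed

lemma measurable_grow:
  assumes "\<And>p. p \<in> set l \<Longrightarrow> S (fst p) (snd p) \<in> M \<rightarrow>\<^sub>M walk_space"
  shows "(\<lambda>x. grow (\<lambda>i j. S i j x) l) \<in> M \<rightarrow>\<^sub>M forest_space"
  using assms
proof (induction l rule: rev_induct)
  case Nil
  then show ?case by (simp add: measurable_forest_iff)
next
  case (snoc p l)
  from measurable_launch[OF snoc.IH snoc.prems(1)[of p]] snoc.prems show ?case by simp
qed

lemma measurable_grow_random:
  assumes S: "\<And>i j. 1 \<le> j \<Longrightarrow> S i j \<in> M \<rightarrow>\<^sub>M walk_space"
    and l: "l \<in> M \<rightarrow>\<^sub>M count_space UNIV" "\<And>x p. x \<in> space M \<Longrightarrow> p \<in> set (l x) \<Longrightarrow> 1 \<le> snd p"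
  shows "(\<lambda>x. grow (\<lambda>i j. S i j x) (l x)) \<in> M \<rightarrow>\<^sub>M forest_space"
proof -
  \<comment> \<open>Measurability of the walk labelled 0 is not given; it is replaced by a constant,
    which changes nothing because all labels in \<open>l x\<close> are at least 1.\<close>
  let ?S = "\<lambda>i j x. if 1 \<le> j then S i j x else (\<lambda>_. 0)"
  have "?S i j \<in> M \<rightarrow>\<^sub>M walk_space" for i j
    using S by (cases "1 \<le> j") (auto simp: walk_space_def space_PiM intro!: measurable_const)
  then have "(\<lambda>x. grow (\<lambda>i j. ?S i j x) l') \<in> M \<rightarrow>\<^sub>M forest_space" for l'
    by (rule measurable_grow)
  from measurable_compose_countable[where f = "\<lambda>l x. grow (\<lambda>i j. ?S i j x) l", OF this l(1)]
  have "(\<lambda>x. grow (\<lambda>i j. ?S i j x) (l x)) \<in> M \<rightarrow>\<^sub>M forest_space" .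
  moreover have "grow (\<lambda>i j. ?S i j x) (l x) = grow (\<lambda>i j. S i j x) (l x)" if "x \<in> space M" for x
    using l(2)[OF that] by (intro grow_cong) auto
  ultimately show ?thesis by (simp cong: measurable_cong)
qed

lemma measurable_card_verts:
  fixes A :: "'a \<Rightarrow> 'b::countable set"
  assumes [measurable]: "\<And>v. Measurable.pred M (\<lambda>x. v \<in> A x)" and fin: "\<And>x. finite (A x)"
  shows "(\<lambda>x. card (A x)) \<in> M \<rightarrow>\<^sub>M count_space UNIV"
proof (subst measurable_count_space_eq2_countable, intro conjI ballI)
  fix k
  \<comment> \<open>Finite sets are represented by lists, of which there are only countably
    many.\<close>
  have "card (A x) = k \<longleftrightarrow> (\<exists>l. card (set l) = k \<and> (\<forall>v. v \<in> A x \<longleftrightarrow> v \<in> set l))" for x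
  proof
    assume k: "card (A x) = k"
    obtain l where "set l = A x" using finite_list[OF fin[of x]] by blast
    with k have "card (set l) = k \<and> (\<forall>v. v \<in> A x \<longleftrightarrow> v \<in> set l)" by simp
    then show "\<exists>l. card (set l) = k \<and> (\<forall>v. v \<in> A x \<longleftrightarrow> v \<in> set l)" by blast
  next
    assume "\<exists>l. card (set l) = k \<and> (\<forall>v. v \<in> A x \<longleftrightarrow> v \<in> set l)"
    then obtain l where l: "card (set l) = k" "\<forall>v. v \<in> A x \<longleftrightarrow> v \<in> set l" by blast
    from l(2) have "A x = set l" by blast
    with l(1) show "card (A x) = k" by simp
  qed
  moreover have "{x \<in> space M. \<exists>l::'b list. card (set l) = k \<and> (\<forall>v. v \<in> A x \<longleftrightarrow> v \<in> set l)} \<in> sets M"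
    by measurable
  ultimately show "(\<lambda>x. card (A x)) -` {k} \<inter> space M \<in> sets M"
    by (simp add: vimage_def Int_def conj_commute)
qed auto

context
  fixes M :: "'a measure" and N :: "int \<Rightarrow> 'a \<Rightarrow> real set" and S :: "int \<Rightarrow> nat \<Rightarrow> 'a \<Rightarrow> nat \<Rightarrow> site"
  assumes N: "\<And>i. N i \<in> M \<rightarrow>\<^sub>M config_space" and S: "\<And>i j. 1 \<le> j \<Longrightarrow> S i j \<in> M \<rightarrow>\<^sub>M walk_space"
begin

lemma measurable_window: "(\<lambda>x. grow (\<lambda>i j. S i j x) (schedule (\<lambda>i. N i x) n is)) \<in> M \<rightarrow>\<^sub>M forest_space"
  by (rule measurable_grow_random) (use S measurable_schedule[OF N] schedule_labels(2) in auto)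

lemma measurable_stable_level:
  "(\<lambda>x. stable_level (\<lambda>i. N i x) (\<lambda>i j. S i j x) n K) \<in> M \<rightarrow>\<^sub>M count_space UNIV"
proof -
  define H where "H m x = grow (\<lambda>i j. S i j x) (schedule (\<lambda>i. N i x) n [- int m..int m])" for m x
  have [measurable]: "H m \<in> M \<rightarrow>\<^sub>M forest_space" for m using measurable_window unfolding H_def by blast
  have eq: "graph_restrict (H m x) R = graph_restrict (H m0 x) R \<longleftrightarrow>
    (\<forall>v. v \<in> R \<longrightarrow> (v \<in> pverts (H m x) \<longleftrightarrow> v \<in> pverts (H m0 x))) \<and>
    (\<forall>e. e \<in> R \<times> R \<longrightarrow> (e \<in> parcs (H m x) \<longleftrightarrow> e \<in> parcs (H m0 x)))" for m m0 x R
  proof -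
    have "graph_restrict (H m x) R = graph_restrict (H m0 x) R \<longleftrightarrow>
      pverts (H m x) \<inter> R = pverts (H m0 x) \<inter> R \<and> parcs (H m x) \<inter> R \<times> R = parcs (H m0 x) \<inter> R \<times> R"
      by (simp add: graph_restrict_def)
    then show ?thesis by blast
  qed
  have "Measurable.pred M (\<lambda>x. \<forall>m. m \<ge> m0 \<longrightarrow> graph_restrict (H m x) (strip K) = graph_restrict (H m0 x) (strip K))" for m0
    unfolding eq by measurable
  then show ?thesis unfolding stable_level_def finite_forest_eq H_def[symmetric] by (rule measurable_Least)
qed

lemma measurable_forest_at: "(\<lambda>x. forest_at (\<lambda>i. N i x) (\<lambda>i j. S i j x) n) \<in> M \<rightarrow>\<^sub>M forest_space"
proof -
  let ?R = "\<lambda>K x. grow (\<lambda>i j. S i j x) (schedule (\<lambda>i. N i x) n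
     [- int (stable_level (\<lambda>i. N i x) (\<lambda>i j. S i j x) n K)..int (stable_level (\<lambda>i. N i x) (\<lambda>i j. S i j x) n K)])"
  have [measurable]: "?R K \<in> M \<rightarrow>\<^sub>M forest_space" for K
    by (rule measurable_compose_countable[OF measurable_window measurable_stable_level])
  have "Measurable.pred M (\<lambda>x. \<exists>K. v \<in> pverts (?R K x) \<and> v \<in> strip K)" for v by measurable
  moreover have "Measurable.pred M (\<lambda>x. \<exists>K. e \<in> parcs (?R K x) \<and> e \<in> strip K \<times> strip K)" for e by measurable
  ultimately show ?thesis
    by (simp add: measurable_forest_iff forest_at_def finite_forest_eq graph_Union_def graph_restrict_def)
qed

lemma measurable_forest_limit: "(\<lambda>x. forest_limit (\<lambda>i. N i x) (\<lambda>i j. S i j x)) \<in> M \<rightarrow>\<^sub>M forest_space"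
proof -
  note [measurable] = measurable_forest_at
  have "Measurable.pred M (\<lambda>x. \<exists>n. n \<ge> 1 \<and> v \<in> pverts (forest_at (\<lambda>i. N i x) (\<lambda>i j. S i j x) n))" for v by measurable
  moreover have "Measurable.pred M (\<lambda>x. \<exists>n. n \<ge> 1 \<and> e \<in> parcs (forest_at (\<lambda>i. N i x) (\<lambda>i j. S i j x) n))" for e by measurable
  ultimately show ?thesis
    by (simp add: measurable_forest_iff forest_limit_def graph_Union_def Bex_def)
qed

end

section \<open>Infinite product measures\<close>

text \<open>Makes limits for \<bar>k\<bar> tending to infinity unique.\<close>

lemma filtercomap_abs_neq_bot: "filtercomap abs (at_top :: int filter) \<noteq> bot"
proof
  assume "filtercomap abs (at_top :: int filter) = bot"
  then have "eventually (\<lambda>_. False) (filtercomap abs (at_top :: int filter))" by simp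
  then obtain K :: int where "\<And>x::int. \<bar>x\<bar> \<ge> K \<Longrightarrow> False"
    unfolding eventually_filtercomap_at_top_linorder by blast
  from this[OF abs_ge_self] show False .
qed

locale full_product =
  fixes K :: "'i \<Rightarrow> 'v measure"
  assumes prob_K: "\<And>i. prob_space (K i)"
begin

abbreviation P where "P \<equiv> PiM UNIV K"

sublocale product_prob_space K UNIV
proof -
  interpret prob_space "K i" for i by (rule prob_K)
  show "product_prob_space K" ..
qed

lemma cylinder_eq: "prod_emb UNIV K J (Pi\<^sub>E J A) = {x \<in> space P. \<forall>i\<in>J. x i \<in> A i}"
  by (auto simp: prod_emb_def space_PiM)

lemma cylinder_sets: "finite J \<Longrightarrow> (\<And>i. i \<in> J \<Longrightarrow> A i \<in> sets (K i)) \<Longrightarrow> {x \<in> space P. \<forall>i\<in>J. x i \<in> A i} \<in> sets P"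
  by (subst cylinder_eq[symmetric]) (auto intro!: sets_PiM_I)

lemma measure_eq_P:
  assumes "sets Q = sets P"
    and "\<And>J A. finite J \<Longrightarrow> (\<And>i. i \<in> J \<Longrightarrow> A i \<in> sets (K i)) \<Longrightarrow>
      emeasure Q {x \<in> space P. \<forall>i\<in>J. x i \<in> A i} = (\<Prod>i\<in>J. emeasure (K i) (A i))"
  shows "Q = P"
  using assms by (intro PiM_eq) (auto simp: cylinder_eq)

text \<open>Injectivity of \<sigma> keeps distinct output coordinates reading distinct, hence
  independent, inputs; each \<open>h i\<close> carries the law of the coordinate it reads to the law
  it must produce.\<close>

lemma coordinate_map:
  assumes "inj \<sigma>" and h: "\<And>i. h i \<in> K (\<sigma> i) \<rightarrow>\<^sub>M K i" and dh: "\<And>i. distr (K (\<sigma> i)) (K i) (h i) = K i"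
  shows "(\<lambda>x i. h i (x (\<sigma> i))) \<in> P \<rightarrow>\<^sub>M P" "distr P P (\<lambda>x i. h i (x (\<sigma> i))) = P"
proof -
  let ?T = "\<lambda>x i. h i (x (\<sigma> i))"
  show T: "?T \<in> P \<rightarrow>\<^sub>M P"
  proof (rule measurable_PiM_single')
    show "(\<lambda>x. h i (x (\<sigma> i))) \<in> P \<rightarrow>\<^sub>M K i" for i
      by (rule measurable_compose[OF _ h]) simp
    then show "?T \<in> space P \<rightarrow> (\<Pi>\<^sub>E i\<in>UNIV. space (K i))" by (auto dest: measurable_space)
  qed
  show "distr P P ?T = P"
  proof (rule measure_eq_P)
    fix J A assume J: "finite J" "\<And>i. i \<in> J \<Longrightarrow> A i \<in> sets (K i)"
    \<comment> \<open>Indexed by the coordinate that is read: on the range of \<sigma>,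
      \<open>B (\<sigma> i)\<close> is the preimage of \<open>A i\<close>, so the preimage of a
      cylinder is again a cylinder.\<close>
    define B where "B q = h (inv \<sigma> q) -` A (inv \<sigma> q) \<inter> space (K q)" for q
    have B: "B (\<sigma> i) = h i -` A i \<inter> space (K (\<sigma> i))" for i using \<open>inj \<sigma>\<close> by (simp add: B_def)
    then have BK: "i \<in> J \<Longrightarrow> B (\<sigma> i) \<in> sets (K (\<sigma> i))" for i using h J by auto
    have "emeasure (distr P P ?T) {x \<in> space P. \<forall>i\<in>J. x i \<in> A i} =
        emeasure P {x \<in> space P. \<forall>q\<in>\<sigma> ` J. x q \<in> B q}"
    proof (subst emeasure_distr[OF T])
      show "{x \<in> space P. \<forall>i\<in>J. x i \<in> A i} \<in> sets P" using J by (rule cylinder_sets)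
    qed (rule arg_cong[where f = "emeasure P"],
        use measurable_space[OF T] in \<open>auto simp: B space_PiM PiE_iff\<close>)
    also have "\<dots> = (\<Prod>q\<in>\<sigma> ` J. emeasure (K q) (B q))"
      using J BK by (intro emeasure_PiM_Collect) auto
    also have "\<dots> = (\<Prod>i\<in>J. emeasure (K (\<sigma> i)) (B (\<sigma> i)))"
      using \<open>inj \<sigma>\<close> by (subst prod.reindex) (auto intro: inj_on_subset)
    also have "\<dots> = (\<Prod>i\<in>J. emeasure (K i) (A i))"
      using J h dh by (intro prod.cong refl) (metis B emeasure_distr)
    finally show "emeasure (distr P P ?T) {x \<in> space P. \<forall>i\<in>J. x i \<in> A i} = (\<Prod>i\<in>J. emeasure (K i) (A i))" .
  qed simp
qed

text \<open>Splicing two independent copies along \<open>J\<close> reproduces the product measure, so events that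
  depend on disjoint sets of coordinates are independent.\<close>

lemma splice_distr:
  "(\<lambda>(x, y) i. if i \<in> J then x i else y i) \<in> P \<Otimes>\<^sub>M P \<rightarrow>\<^sub>M P"
  "distr (P \<Otimes>\<^sub>M P) P (\<lambda>(x, y) i. if i \<in> J then x i else y i) = P"
proof -
  let ?T = "\<lambda>(x, y) i. if i \<in> J then x i else y i"
  interpret PP: pair_prob_space P P ..
  show T: "?T \<in> P \<Otimes>\<^sub>M P \<rightarrow>\<^sub>M P"
    unfolding case_prod_beta
  proof (rule measurable_PiM_single')
    show "(\<lambda>z. if i \<in> J then fst z i else snd z i) \<in> P \<Otimes>\<^sub>M P \<rightarrow>\<^sub>M K i" for i
      by (cases "i \<in> J") (auto intro: measurable_compose[OF measurable_fst] measurable_compose[OF measurable_snd])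
    then show "(\<lambda>z i. if i \<in> J then fst z i else snd z i) \<in> space (P \<Otimes>\<^sub>M P) \<rightarrow> (\<Pi>\<^sub>E i\<in>UNIV. space (K i))"
      by (auto simp: space_pair_measure space_PiM PiE_iff)
  qed
  show "distr (P \<Otimes>\<^sub>M P) P ?T = P"
  proof (rule measure_eq_P)
    fix F A assume F: "finite F" "\<And>i. i \<in> F \<Longrightarrow> A i \<in> sets (K i)"
    have "emeasure (distr (P \<Otimes>\<^sub>M P) P ?T) {x \<in> space P. \<forall>i\<in>F. x i \<in> A i} =
      emeasure (P \<Otimes>\<^sub>M P) ({x \<in> space P. \<forall>i\<in>F \<inter> J. x i \<in> A i} \<times> {x \<in> space P. \<forall>i\<in>F - J. x i \<in> A i})"
    proof (subst emeasure_distr[OF T])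
      show "{x \<in> space P. \<forall>i\<in>F. x i \<in> A i} \<in> sets P" using F by (rule cylinder_sets)
    qed (rule arg_cong[where f = "emeasure _"],
        use measurable_space[OF T] in \<open>force simp: space_pair_measure\<close>)
    also have "\<dots> = (\<Prod>i\<in>F \<inter> J. emeasure (K i) (A i)) * (\<Prod>i\<in>F - J. emeasure (K i) (A i))"
      using F by (subst P.emeasure_pair_measure_Times) (auto intro!: cylinder_sets arg_cong2[where f = "(*)"] emeasure_PiM_Collect)
    also have "\<dots> = (\<Prod>i\<in>F. emeasure (K i) (A i))"
      using F by (subst prod.Int_Diff[of F _ J]) auto
    finally show "emeasure (distr (P \<Otimes>\<^sub>M P) P ?T) {x \<in> space P. \<forall>i\<in>F. x i \<in> A i} = (\<Prod>i\<in>F. emeasure (K i) (A i))" .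
  qed simp
qed

lemma disjoint_coordinates_indep:
  assumes A: "A \<in> sets P" and B: "B \<in> sets P"
    and depA: "\<And>x y. x \<in> space P \<Longrightarrow> y \<in> space P \<Longrightarrow> (\<And>i. i \<in> J \<Longrightarrow> x i = y i) \<Longrightarrow> x \<in> A \<longleftrightarrow> y \<in> A"
    and depB: "\<And>x y. x \<in> space P \<Longrightarrow> y \<in> space P \<Longrightarrow> (\<And>i. i \<notin> J \<Longrightarrow> x i = y i) \<Longrightarrow> x \<in> B \<longleftrightarrow> y \<in> B"
  shows "emeasure P (A \<inter> B) = emeasure P A * emeasure P B"
proof -
  let ?T = "\<lambda>(x, y) i. if i \<in> J then x i else y i"
  interpret PP: pair_prob_space P P ..
  have "emeasure P (A \<inter> B) = emeasure (distr (P \<Otimes>\<^sub>M P) P ?T) (A \<inter> B)" by (simp only: splice_distr)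
  also have "\<dots> = emeasure (P \<Otimes>\<^sub>M P) (?T -` (A \<inter> B) \<inter> space (P \<Otimes>\<^sub>M P))"
    using A B by (intro emeasure_distr splice_distr) auto
  \<comment> \<open>The spliced point agrees with \<open>x\<close> on \<open>J\<close> and with
    \<open>y\<close> elsewhere, so \<open>A\<close> looks only at the first copy and
    \<open>B\<close> only at the second.\<close>
  also have "?T -` (A \<inter> B) \<inter> space (P \<Otimes>\<^sub>M P) = A \<times> B"
  proof -
    have "?T (x, y) \<in> A \<longleftrightarrow> x \<in> A" "?T (x, y) \<in> B \<longleftrightarrow> y \<in> B" if "x \<in> space P" "y \<in> space P" for x y
    proof -
      have "?T (x, y) \<in> space P" using measurable_space[OF splice_distr(1)] that by (auto simp: space_pair_measure)
      then show "?T (x, y) \<in> A \<longleftrightarrow> x \<in> A" "?T (x, y) \<in> B \<longleftrightarrow> y \<in> B"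
        using that by (intro depA depB; simp)+
    qed
    moreover have "A \<subseteq> space P" "B \<subseteq> space P" using A B sets.sets_into_space by auto
    ultimately show ?thesis by (auto simp: space_pair_measure subset_iff)
  qed
  also have "emeasure (P \<Otimes>\<^sub>M P) (A \<times> B) = emeasure P A * emeasure P B"
    using A B by (rule P.emeasure_pair_measure_Times)
  finally show ?thesis .
qed

end

section \<open>Mixing and recurrence\<close>

text \<open>Extends convergence of the finite measures \<mu> from an intersection-stable generator
  to all events. Convergence on sets does not pass to countable disjoint unions by itself; the
  common bound by \<open>P\<close> supplies the domination.\<close>

lemma dominated_setwise_convergence:
  fixes P :: "'a measure" and \<mu> :: "'k \<Rightarrow> 'a set \<Rightarrow> real"
  assumes "prob_space P" "Fl \<noteq> bot" and gen: "sets P = sigma_sets (space P) G" "Int_stable G" "G \<subseteq> Pow (space P)"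
    and bound: "\<And>k W. W \<in> sets P \<Longrightarrow> 0 \<le> \<mu> k W \<and> \<mu> k W \<le> measure P W"
    and compl: "\<And>k W. W \<in> sets P \<Longrightarrow> \<mu> k (space P - W) = \<mu> k (space P) - \<mu> k W"
    and sums: "\<And>k W. range W \<subseteq> sets P \<Longrightarrow> disjoint_family W \<Longrightarrow> (\<lambda>i. \<mu> k (W i)) sums \<mu> k (\<Union>i::nat. W i)"
    and whole: "((\<lambda>k. \<mu> k (space P)) \<longlongrightarrow> c) Fl"
    and conv: "\<And>W. W \<in> G \<Longrightarrow> ((\<lambda>k. \<mu> k W) \<longlongrightarrow> c * measure P W) Fl"
    and "W \<in> sets P"
  shows "((\<lambda>k. \<mu> k W) \<longlongrightarrow> c * measure P W) Fl"
proof -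
  interpret prob_space P by fact
  have "W \<in> sigma_sets (space P) G" using \<open>W \<in> sets P\<close> gen by simp
  from gen(2,3) this show ?thesis
  proof (induction W rule: sigma_sets_induct_disjoint)
    case empty
    have "\<mu> k {} = 0" for k using bound[of "{}" k] by simp
    then show ?case by simp
  next
    case (compl W)
    then have W: "W \<in> sets P" using gen by simp
    have "((\<lambda>k. \<mu> k (space P) - \<mu> k W) \<longlongrightarrow> c - c * measure P W) Fl"
      by (intro tendsto_diff whole compl)
    then show ?case using W by (simp add: assms(7) prob_compl algebra_simps)
  next
    case (union W)
    then have W: "range W \<subseteq> sets P" using gen by simp
    then have WS: "(\<lambda>i. measure P (W i)) sums measure P (\<Union>i. W i)"
      using union(1) by (intro finite_measure_UNION)
    \<comment> \<open>Tannery's theorem is dominated convergence for series, with the summable bound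
      \<open>measure P (W i)\<close>.\<close>
    have "((\<lambda>k. \<Sum>i. \<mu> k (W i)) \<longlongrightarrow> (\<Sum>i. c * measure P (W i))) Fl"
    proof (rule tannerys_theorem[THEN conjunct2, THEN conjunct2])
      show "\<forall>\<^sub>F (i, k) in sequentially \<times>\<^sub>F Fl. norm (\<mu> k (W i)) \<le> measure P (W i)"
        using bound W by (intro always_eventually) (auto simp: image_subset_iff)
      show "summable (\<lambda>i. measure P (W i))" using WS by (rule sums_summable)
    qed (use union(3) \<open>Fl \<noteq> bot\<close> in auto)
    moreover have "(\<Sum>i. \<mu> k (W i)) = \<mu> k (\<Union>i. W i)" for k
      using sums[OF W union(1)] by (simp add: sums_iff)
    moreover have "(\<Sum>i. c * measure P (W i)) = c * measure P (\<Union>i. W i)"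
      using WS by (simp add: sums_iff suminf_mult)
    ultimately show ?case by simp
  qed (use conv in auto)
qed

locale shift_action = prob_space P for P :: "'a measure" +
  fixes T :: "int \<Rightarrow> 'a \<Rightarrow> 'a"
  assumes T_measurable: "\<And>k. T k \<in> P \<rightarrow>\<^sub>M P" and T_preserving: "\<And>k. distr P P (T k) = P"
    and T_add: "\<And>k l x. x \<in> space P \<Longrightarrow> T k (T l x) = T (k + l) x"
    and T_mixing: "\<And>U V. U \<in> sets P \<Longrightarrow> V \<in> sets P \<Longrightarrow>
      ((\<lambda>k. measure P (U \<inter> (T k -` V \<inter> space P))) \<longlongrightarrow> measure P U * measure P V) (filtercomap abs at_top)"
begin

lemma measure_T: "V \<in> sets P \<Longrightarrow> measure P (T k -` V \<inter> space P) = measure P V"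
  using measure_distr[OF T_measurable] T_preserving by metis

text \<open>The event \<open>E\<close> of visiting \<open>Q\<close> at arbitrarily large times is
  invariant, so mixing of \<open>E\<close> with itself gives P(E) = P(E)^2. It is the decreasing
  limit of the events \<open>B n\<close>, each at least as likely as \<open>Q\<close>, which
  excludes the value 0.\<close>

lemma recurrent_above:
  assumes Q: "Q \<in> sets P" "measure P Q > 0"
  shows "AE x in P. \<forall>Y. \<exists>k>Y. T k x \<in> Q"
proof -
  define B where "B n = (\<Union>k\<in>{k. k > int n}. T k -` Q \<inter> space P)" for n :: nat
  define E where "E = (\<Inter>n. B n)"
  have TQ: "T k -` Q \<inter> space P \<in> sets P" for k using T_measurable Q(1) by (rule measurable_sets)
  then have B: "B n \<in> sets P" for n unfolding B_def by (intro sets.countable_UN'') auto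
  then have E: "E \<in> sets P" unfolding E_def by auto
  have E_iff: "x \<in> E \<longleftrightarrow> x \<in> space P \<and> (\<forall>Y. \<exists>k>Y. T k x \<in> Q)" for x
  proof
    assume x: "x \<in> E"
    have "\<exists>k>Y. T k x \<in> Q" for Y
    proof -
      have "x \<in> B (nat Y)" using x by (auto simp: E_def)
      then obtain k where "k > int (nat Y)" "T k x \<in> Q" unfolding B_def by blast
      then have "k > Y" by linarith
      then show ?thesis using \<open>T k x \<in> Q\<close> by blast
    qed
    moreover have "x \<in> space P" using x E sets.sets_into_space by blast
    ultimately show "x \<in> space P \<and> (\<forall>Y. \<exists>k>Y. T k x \<in> Q)" by blast
  qed (auto simp: E_def B_def)
  have inv: "T l -` E \<inter> space P = E" for l
  proof -
    have "(\<forall>Y. \<exists>k>Y. T k (T l x) \<in> Q) \<longleftrightarrow> (\<forall>Y. \<exists>k>Y. T k x \<in> Q)" if "x \<in> space P" for x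
    proof
      assume *: "\<forall>Y. \<exists>k>Y. T k (T l x) \<in> Q"
      show "\<forall>Y. \<exists>k>Y. T k x \<in> Q"
      proof
        fix Y obtain k where "k > Y - l" "T k (T l x) \<in> Q" using * by blast
        then show "\<exists>k>Y. T k x \<in> Q" using that by (intro exI[of _ "k + l"]) (auto simp: T_add)
      qed
    next
      assume *: "\<forall>Y. \<exists>k>Y. T k x \<in> Q"
      show "\<forall>Y. \<exists>k>Y. T k (T l x) \<in> Q"
      proof
        fix Y obtain k where "k > Y + l" "T k x \<in> Q" using * by blast
        then show "\<exists>k>Y. T k (T l x) \<in> Q" using that by (intro exI[of _ "k - l"]) (auto simp: T_add)
      qed
    qed
    then show ?thesis using measurable_space[OF T_measurable] by (auto simp: E_iff)
  qed
  have "((\<lambda>k. measure P (E \<inter> (T k -` E \<inter> space P))) \<longlongrightarrow> measure P E * measure P E) (filtercomap abs at_top)"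
    by (rule T_mixing[OF E E])
  then have "measure P E = measure P E * measure P E"
    unfolding inv by (simp add: tendsto_const_iff filtercomap_abs_neq_bot)
  moreover have "measure P Q \<le> measure P E"
  proof (rule LIMSEQ_le_const)
    have "decseq B" unfolding B_def by (intro antimonoI UN_mono) auto
    then show "(\<lambda>n. measure P (B n)) \<longlonglongrightarrow> measure P E"
      unfolding E_def using B by (intro finite_Lim_measure_decseq) auto
    have "measure P Q \<le> measure P (B n)" for n
      unfolding measure_T[OF Q(1), of "int n + 1", symmetric]
    proof (rule finite_measure_mono[OF _ B])
      show "T (int n + 1) -` Q \<inter> space P \<subseteq> B n"
        unfolding B_def by (intro UN_upper) simp
    qed
    then show "\<exists>N. \<forall>n\<ge>N. measure P Q \<le> measure P (B n)" by blast
  qed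
  ultimately have "measure P E = 1" using Q(2) by auto
  then show ?thesis using prob_eq_1[OF E] E_iff by auto
qed

lemma reversed: "shift_action P (\<lambda>k. T (- k))"
proof
  fix U V assume "U \<in> sets P" "V \<in> sets P"
  from T_mixing[OF this] have "filterlim (\<lambda>k. measure P (U \<inter> (T k -` V \<inter> space P))) (nhds (measure P U * measure P V)) (filtercomap abs at_top)" .
  moreover have "filterlim uminus (filtercomap abs at_top) (filtercomap abs (at_top :: int filter))"
    by (simp add: filterlim_filtercomap_iff comp_def filterlim_filtercomap)
  ultimately show "((\<lambda>k. measure P (U \<inter> (T (- k) -` V \<inter> space P))) \<longlongrightarrow> measure P U * measure P V) (filtercomap abs at_top)"
    by (rule filterlim_compose)
qed (auto simp: T_measurable T_preserving T_add algebra_simps)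

lemma recurrent_below:
  assumes Q: "Q \<in> sets P" "measure P Q > 0"
  shows "AE x in P. \<forall>Y. \<exists>k<Y. T k x \<in> Q"
proof -
  interpret r: shift_action P "\<lambda>k. T (- k)" by (rule reversed)
  from r.recurrent_above[OF Q] show ?thesis
  proof eventually_elim
    case (elim x)
    show ?case
    proof
      fix Y obtain k where "k > - Y" "T (- k) x \<in> Q" using elim by blast
      then show "\<exists>k<Y. T k x \<in> Q" by (intro exI[of _ "- k"]) auto
    qed
  qed
qed

end

text \<open>For two cylinders the shifted coordinates eventually avoid those of the first, and the
  events become independent. Mixing then extends to arbitrary events one argument at a time.\<close>

lemma (in full_product) shift_action_coordinates:
  fixes \<sigma> :: "int \<Rightarrow> 'i \<Rightarrow> 'i" and h :: "int \<Rightarrow> 'i \<Rightarrow> 'v \<Rightarrow> 'v"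
  defines "T \<equiv> \<lambda>k x i. h k i (x (\<sigma> k i))"
  assumes inj: "\<And>k. inj (\<sigma> k)" and h: "\<And>k i. h k i \<in> K (\<sigma> k i) \<rightarrow>\<^sub>M K i"
    and dh: "\<And>k i. distr (K (\<sigma> k i)) (K i) (h k i) = K i"
    and add: "\<And>k l x. x \<in> space P \<Longrightarrow> T k (T l x) = T (k + l) x"
    and escape: "\<And>i j. eventually (\<lambda>k. \<sigma> k i \<noteq> j) (filtercomap abs at_top)"
  shows "shift_action P T"
proof -
  have T: "T k \<in> P \<rightarrow>\<^sub>M P" "distr P P (T k) = P" for k
    unfolding T_def by (rule coordinate_map[OF inj h dh])+
  have mT: "V \<in> sets P \<Longrightarrow> measure P (T k -` V \<inter> space P) = measure P V" for V k
    using measure_distr[OF T(1), of V k] T(2)[of k] by simp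
  have TV: "V \<in> sets P \<Longrightarrow> T k -` V \<inter> space P \<in> sets P" for V k
    using T(1) by (rule measurable_sets)
  let ?Fl = "filtercomap abs (at_top :: int filter)"
  let ?c = "\<lambda>U V k. measure P (U \<inter> (T k -` V \<inter> space P))"
  note gen = sets_PiM[of UNIV K, folded space_PiM] Int_stable_prod_algebra[of UNIV K]
    prod_algebra_sets_into_space[of UNIV K, folded space_PiM]
  have 1: "(?c U V \<longlongrightarrow> measure P U * measure P V) ?Fl"
    if UV: "U \<in> prod_algebra UNIV K" "V \<in> prod_algebra UNIV K" for U V
  proof -
    obtain J A where J: "finite J" "\<And>i. i \<in> J \<Longrightarrow> A i \<in> sets (K i)" "U = {x \<in> space P. \<forall>i\<in>J. x i \<in> A i}"
    proof (rule prod_algebraE[OF UV(1)])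
      fix J E assume "U = prod_emb UNIV K J (Pi\<^sub>E J E)" "finite J" "\<And>i. i \<in> J \<Longrightarrow> E i \<in> sets (K i)"
      then show thesis using that[of J E] by (simp only: cylinder_eq)
    qed
    obtain J' A' where J': "finite J'" "\<And>i. i \<in> J' \<Longrightarrow> A' i \<in> sets (K i)" "V = {x \<in> space P. \<forall>i\<in>J'. x i \<in> A' i}"
    proof (rule prod_algebraE[OF UV(2)])
      fix J E assume "V = prod_emb UNIV K J (Pi\<^sub>E J E)" "finite J" "\<And>i. i \<in> J \<Longrightarrow> E i \<in> sets (K i)"
      then show thesis using that[of J E] by (simp only: cylinder_eq)
    qed
    have U: "U \<in> sets P" and V: "V \<in> sets P" unfolding J(3) J'(3) using J J' by (auto intro: cylinder_sets)
    \<comment> \<open>Finitely many pairs of coordinates must be kept apart, so the limit is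
      attained exactly once \<bar>k\<bar> is large.\<close>
    have "eventually (\<lambda>k. \<forall>i\<in>J'. \<forall>j\<in>J. \<sigma> k i \<noteq> j) ?Fl"
      using J(1) J'(1) escape by (simp add: eventually_ball_finite_distrib)
    then have "eventually (\<lambda>k. ?c U V k = measure P U * measure P V) ?Fl"
    proof eventually_elim
      case (elim k)
      have "emeasure P (U \<inter> (T k -` V \<inter> space P)) = emeasure P U * emeasure P (T k -` V \<inter> space P)"
      proof (rule disjoint_coordinates_indep[where J = J])
        show "x \<in> U \<longleftrightarrow> y \<in> U" if "x \<in> space P" "y \<in> space P" "\<And>i. i \<in> J \<Longrightarrow> x i = y i" for x y
          using that unfolding J(3) by auto
        show "x \<in> T k -` V \<inter> space P \<longleftrightarrow> y \<in> T k -` V \<inter> space P"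
          if "x \<in> space P" "y \<in> space P" and eq: "\<And>i. i \<notin> J \<Longrightarrow> x i = y i" for x y
        proof -
          have "T k x i = T k y i" if "i \<in> J'" for i
          proof -
            have "\<sigma> k i \<notin> J" using elim that by blast
            then show ?thesis unfolding T_def by (intro arg_cong[where f = "h k i"] eq)
          qed
          then show ?thesis using that measurable_space[OF T(1)] unfolding J'(3) by auto
        qed
      qed (use U V TV in auto)
      then have "ennreal (?c U V k) = ennreal (measure P U * measure P V)"
        by (simp add: emeasure_eq_measure mT[OF V] ennreal_mult'')
      then show ?case by (simp add: zero_le_mult_iff)
    qed
    then show ?thesis by (rule tendsto_eventually)
  qed
  have 2: "(?c U V \<longlongrightarrow> measure P U * measure P V) ?Fl"
    if U: "U \<in> prod_algebra UNIV K" and V: "V \<in> sets P" for U V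
  proof (rule dominated_setwise_convergence[where \<mu> = "\<lambda>k V. ?c U V k", OF prob_space_axioms filtercomap_abs_neq_bot gen])
    have U': "U \<in> sets P" using U by (auto simp: sets_PiM)
    \<comment> \<open>Here the domination comes from the invariance of \<open>P\<close> under
      \<open>T k\<close>; in the first argument it is mere inclusion.\<close>
    show "0 \<le> ?c U W k \<and> ?c U W k \<le> measure P W" if "W \<in> sets P" for k W
      using that TV[OF that] by (auto simp: mT[OF that, of k, symmetric] intro!: finite_measure_mono)
    show "?c U (space P - W) k = ?c U (space P) k - ?c U W k" if "W \<in> sets P" for k W
      using that U' TV[OF that] measurable_space[OF T(1)[of k]]
      by (subst finite_measure_Diff[symmetric]) (auto intro!: arg_cong[where f = "measure P"] TV)
    show "(\<lambda>i. ?c U (W i) k) sums ?c U (\<Union>i. W i) k" if "range W \<subseteq> sets P" "disjoint_family W" for k and W :: "nat \<Rightarrow> _"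
    proof -
      have "(\<lambda>i. ?c U (W i) k) sums measure P (\<Union>i. U \<inter> (T k -` W i \<inter> space P))"
        using that U' TV by (intro finite_measure_UNION) (auto simp: disjoint_family_on_def image_subset_iff)
      also have "(\<Union>i. U \<inter> (T k -` W i \<inter> space P)) = U \<inter> (T k -` (\<Union>i. W i) \<inter> space P)" by auto
      finally show ?thesis .
    qed
    have "U \<inter> (T k -` space P \<inter> space P) = U" for k
      using measurable_space[OF T(1)[of k]] sets.sets_into_space[OF U'] by auto
    then show "(?c U (space P) \<longlongrightarrow> measure P U) ?Fl" by simp
  qed (use 1 U V in auto)
  have 3: "(?c U V \<longlongrightarrow> measure P U * measure P V) ?Fl" if U: "U \<in> sets P" and V: "V \<in> sets P" for U V
  proof -
    have "(?c U V \<longlongrightarrow> measure P V * measure P U) ?Fl"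
    proof (rule dominated_setwise_convergence[where \<mu> = "\<lambda>k U. ?c U V k", OF prob_space_axioms filtercomap_abs_neq_bot gen])
      show "0 \<le> ?c W V k \<and> ?c W V k \<le> measure P W" if "W \<in> sets P" for k W
        using that TV[OF V] by (auto intro!: finite_measure_mono)
      show "?c (space P - W) V k = ?c (space P) V k - ?c W V k" if "W \<in> sets P" for k W
        using that TV[OF V] by (subst finite_measure_Diff[symmetric]) (auto intro!: arg_cong[where f = "measure P"])
      show "(\<lambda>i. ?c (W i) V k) sums ?c (\<Union>i. W i) V k" if "range W \<subseteq> sets P" "disjoint_family W" for k and W :: "nat \<Rightarrow> _"
      proof -
        have "(\<lambda>i. ?c (W i) V k) sums measure P (\<Union>i. W i \<inter> (T k -` V \<inter> space P))"
          using that TV[OF V] by (intro finite_measure_UNION) (auto simp: disjoint_family_on_def image_subset_iff)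
        also have "(\<Union>i. W i \<inter> (T k -` V \<inter> space P)) = (\<Union>i. W i) \<inter> (T k -` V \<inter> space P)" by auto
        finally show ?thesis .
      qed
      have "space P \<inter> (T k -` V \<inter> space P) = T k -` V \<inter> space P" for k by auto
      then show "(?c (space P) V \<longlongrightarrow> measure P V) ?Fl" by (simp add: mT[OF V])
      show "(?c W V \<longlongrightarrow> measure P V * measure P W) ?Fl" if "W \<in> prod_algebra UNIV K" for W
        using 2[OF that V] by (simp add: mult.commute)
    qed (use U in auto)
    then show ?thesis by (simp add: mult.commute)
  qed
  show ?thesis by unfold_locales (use T add 3 in auto)
qed

section \<open>Uniqueness of the Poisson law\<close>

text \<open>Joint counts of possibly overlapping sets: concatenating two families shows closure
  under intersection, which the single-count generators of \<open>config_space\<close> do not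
  have.\<close>

definition count_event :: "nat \<Rightarrow> (nat \<Rightarrow> real set) \<Rightarrow> (nat \<Rightarrow> nat) \<Rightarrow> real set set" where
  "count_event m B k = {\<eta> \<in> locally_finite_configs. \<forall>l<m. card (\<eta> \<inter> B l) = k l}"

lemma set_decode_bounded:
  assumes "c < 2 ^ m" "l \<in> set_decode c"
  shows "l < m"
proof (rule ccontr)
  assume "\<not> l < m"
  then have "(2::nat) ^ m \<le> 2 ^ l" by (intro power_increasing) auto
  then have "c div 2 ^ l = 0" using assms(1) by (intro div_less) linarith
  then show False using assms(2) by (simp add: set_decode_def)
qed

lemma set_encode_bounded: "set_encode {l. l < m \<and> Q l} < 2 ^ m"
proof -
  have "set_encode {l. l < m \<and> Q l} \<le> (\<Sum>l<m. 2 ^ l)"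
    unfolding set_encode_def by (intro sum_mono2) auto
  also have "\<dots> < 2 ^ m" by (induction m) auto
  finally show ?thesis .
qed

text \<open>The points of the half-line with one prescribed pattern of membership in the sets
  \<open>B l\<close>, the pattern being the set of binary digits of \<open>c\<close>. Requiring
  membership in some \<open>B l\<close> keeps the atom bounded when the \<open>B l\<close>
  are.\<close>

definition atom :: "nat \<Rightarrow> (nat \<Rightarrow> real set) \<Rightarrow> nat \<Rightarrow> real set" where
  "atom m B c = {t. 0 \<le> t \<and> (\<exists>l<m. t \<in> B l) \<and> (\<forall>l<m. t \<in> B l \<longleftrightarrow> l \<in> set_decode c)}"

lemma atom_member: "t \<in> atom m B c \<Longrightarrow> l < m \<Longrightarrow> t \<in> B l \<longleftrightarrow> l \<in> set_decode c"
  by (simp add: atom_def)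

lemma atom_disjoint:
  assumes "c < 2 ^ m" "c' < 2 ^ m" "c \<noteq> c'"
  shows "atom m B c \<inter> atom m B c' = {}"
proof -
  have "set_decode c \<noteq> set_decode c'" using assms(3) by (metis set_decode_inverse)
  then obtain l where "l \<in> set_decode c \<longleftrightarrow> l \<notin> set_decode c'" by blast
  moreover from this have "l < m" using set_decode_bounded assms by blast
  ultimately show ?thesis using atom_member by blast
qed

text \<open>Atoms are disjoint, so overlapping counts become sums of counts to which the
  independence of a Poisson process applies.\<close>

lemma card_eq_sum_atoms:
  assumes "\<eta> \<in> locally_finite_configs" "l < m" "\<And>l. l < m \<Longrightarrow> bounded (B l)"
  shows "card (\<eta> \<inter> B l) = (\<Sum>c\<in>{c. c < 2 ^ m \<and> l \<in> set_decode c}. card (\<eta> \<inter> atom m B c))"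
proof -
  have fin: "finite (\<eta> \<inter> atom m B c)" for c
  proof -
    have "bounded (\<Union>l<m. B l)" using assms(3) by (intro bounded_UN) auto
    then obtain a where a: "\<And>x. x \<in> (\<Union>l<m. B l) \<Longrightarrow> \<bar>x\<bar> \<le> a" by (auto simp: bounded_iff)
    have "\<eta> \<inter> atom m B c \<subseteq> {s \<in> \<eta>. s \<le> a}" using a by (fastforce simp: atom_def)
    then show ?thesis using assms(1) unfolding locally_finite_configs_def by (blast intro: finite_subset)
  qed
  have "\<eta> \<inter> B l = (\<Union>c\<in>{c. c < 2 ^ m \<and> l \<in> set_decode c}. \<eta> \<inter> atom m B c)"
  proof
    show "\<eta> \<inter> B l \<subseteq> (\<Union>c\<in>{c. c < 2 ^ m \<and> l \<in> set_decode c}. \<eta> \<inter> atom m B c)"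
    proof
      fix t assume t: "t \<in> \<eta> \<inter> B l"
      define c where "c = set_encode {l. l < m \<and> t \<in> B l}"
      have d: "set_decode c = {l. l < m \<and> t \<in> B l}" unfolding c_def by (rule set_encode_inverse) simp
      have "t \<ge> 0" using t assms(1) by (auto simp: locally_finite_configs_def)
      then have "t \<in> atom m B c" using t assms(2) by (auto simp: atom_def d)
      moreover have "c < 2 ^ m" unfolding c_def by (rule set_encode_bounded)
      ultimately show "t \<in> (\<Union>c\<in>{c. c < 2 ^ m \<and> l \<in> set_decode c}. \<eta> \<inter> atom m B c)"
        using t assms(2) d by auto
    qed
    show "(\<Union>c\<in>{c. c < 2 ^ m \<and> l \<in> set_decode c}. \<eta> \<inter> atom m B c) \<subseteq> \<eta> \<inter> B l"
      using assms(2) atom_member by blast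
  qed
  also have "card \<dots> = (\<Sum>c\<in>{c. c < 2 ^ m \<and> l \<in> set_decode c}. card (\<eta> \<inter> atom m B c))"
  proof (rule card_UN_disjoint)
    show "\<forall>c\<in>{c. c < 2 ^ m \<and> l \<in> set_decode c}. \<forall>c'\<in>{c. c < 2 ^ m \<and> l \<in> set_decode c}.
        c \<noteq> c' \<longrightarrow> (\<eta> \<inter> atom m B c) \<inter> (\<eta> \<inter> atom m B c') = {}"
      using atom_disjoint[of _ m _ B] by blast
  qed (use fin in auto)
  finally show ?thesis .
qed

lemma atom_borel:
  assumes "\<And>l. l < m \<Longrightarrow> B l \<in> sets borel"
  shows "atom m B c \<in> sets borel"
proof -
  have "{t \<in> space borel. \<forall>l\<in>{..<m}. t \<in> B l \<longleftrightarrow> l \<in> set_decode c} \<in> sets borel"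
  proof (rule sets.sets_Collect_finite_All)
    fix l assume "l \<in> {..<m}"
    then have "B l \<in> sets borel" "- B l \<in> sets borel" using assms[of l] by auto
    then show "{t \<in> space borel. t \<in> B l \<longleftrightarrow> l \<in> set_decode c} \<in> sets borel"
      by (cases "l \<in> set_decode c") (simp_all add: Compl_eq)
  qed simp
  moreover have "(\<Union>l\<in>{..<m}. B l) \<in> sets borel" using assms by (intro sets.finite_UN) auto
  ultimately have "{0..} \<inter> (\<Union>l\<in>{..<m}. B l) \<inter> {t \<in> space borel. \<forall>l\<in>{..<m}. t \<in> B l \<longleftrightarrow> l \<in> set_decode c} \<in> sets borel"
    by (intro sets.Int) auto
  also have "{0..} \<inter> (\<Union>l\<in>{..<m}. B l) \<inter> {t \<in> space borel. \<forall>l\<in>{..<m}. t \<in> B l \<longleftrightarrow> l \<in> set_decode c} = atom m B c"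
    by (auto simp: atom_def)
  finally show ?thesis .
qed

lemma atom_bounded:
  assumes "\<And>l. l < m \<Longrightarrow> bounded (B l)"
  shows "bounded (atom m B c)"
proof (rule bounded_subset)
  show "bounded (\<Union>l\<in>{..<m}. B l)" using assms by (intro bounded_UN) auto
  show "atom m B c \<subseteq> (\<Union>l\<in>{..<m}. B l)" by (auto simp: atom_def)
qed

lemma count_event_sets:
  assumes "\<And>l. l < m \<Longrightarrow> B l \<in> sets borel \<and> bounded (B l)"
  shows "count_event m B k \<in> sets config_space"
proof -
  have "{\<eta> \<in> space config_space. \<forall>l\<in>{..<m}. card (\<eta> \<inter> B l) = k l} \<in> sets config_space"
  proof (rule sets.sets_Collect_finite_All)
    fix l assume "l \<in> {..<m}"
    then show "{\<eta> \<in> space config_space. card (\<eta> \<inter> B l) = k l} \<in> sets config_space"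
      using assms[of l] unfolding sets_config_space by (auto intro!: sigma_sets.Basic)
  qed simp
  moreover have "{\<eta> \<in> space config_space. \<forall>l\<in>{..<m}. card (\<eta> \<inter> B l) = k l} = count_event m B k"
    unfolding count_event_def space_config_space by blast
  ultimately show ?thesis by simp
qed

text \<open>Depends on the sets \<open>B l\<close> alone and not on the process. The explicit
  density also makes sense for an atom of measure zero, where \<open>0 ^ 0 = 1\<close> puts all mass
  at the count 0.\<close>

definition poisson_counts_law :: "nat \<Rightarrow> (nat \<Rightarrow> real set) \<Rightarrow> (nat \<Rightarrow> nat) measure" where
  "poisson_counts_law m B = (\<Pi>\<^sub>M c\<in>{..<2 ^ m}. density (count_space UNIV)
     (\<lambda>k. ennreal (exp (- measure lborel (atom m B c)) * measure lborel (atom m B c) ^ k / fact k)))"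

lemma (in prob_space) poisson_atom_counts:
  assumes X: "poisson_point_process M X" and B: "\<And>l. l < m \<Longrightarrow> B l \<in> sets borel \<and> bounded (B l)"
  shows "distr M (\<Pi>\<^sub>M c\<in>{..<2 ^ m}. count_space UNIV) (\<lambda>\<omega>. \<lambda>c\<in>{..<2 ^ m}. card (X \<omega> \<inter> atom m B c)) =
    poisson_counts_law m B"
proof -
  have XM: "X \<in> M \<rightarrow>\<^sub>M config_space" using X by (simp add: poisson_point_process_def)
  have at: "atom m B c \<in> sets borel" "bounded (atom m B c)" "atom m B c \<subseteq> {0..}" for c
    by (rule atom_borel, simp add: B) (rule atom_bounded, simp add: B, auto simp: atom_def)
  have meas: "(\<lambda>\<omega>. card (X \<omega> \<inter> atom m B c)) \<in> M \<rightarrow>\<^sub>M count_space UNIV" for c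
    by (rule measurable_compose[OF XM measurable_card_config]) (use at in auto)
  have "indep_vars (\<lambda>_. count_space UNIV) (\<lambda>c \<omega>. card (X \<omega> \<inter> atom m B c)) {..<2 ^ m}"
  proof -
    have dis: "disjoint_family_on (atom m B) {..<2 ^ m}"
      using atom_disjoint by (auto simp: disjoint_family_on_def)
    have at': "\<forall>l<2 ^ m. atom m B l \<in> sets borel \<and> bounded (atom m B l) \<and> atom m B l \<subseteq> {0..}"
      using at by auto
    from X have "\<forall>(B :: nat \<Rightarrow> real set) m.
        (\<forall>l<m. B l \<in> sets borel \<and> bounded (B l) \<and> B l \<subseteq> {0..}) \<and> disjoint_family_on B {..<m} \<longrightarrow>
        indep_vars (\<lambda>_. count_space UNIV) (\<lambda>l \<omega>. card (X \<omega> \<inter> B l)) {..<m}"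
      unfolding poisson_point_process_def by (elim conjE)
    from this[THEN spec, THEN spec, THEN mp, OF conjI, OF at' dis] show ?thesis .
  qed
  then have "distr M (\<Pi>\<^sub>M c\<in>{..<2 ^ m}. count_space UNIV) (\<lambda>\<omega>. \<lambda>c\<in>{..<2 ^ m}. card (X \<omega> \<inter> atom m B c)) =
      (\<Pi>\<^sub>M c\<in>{..<2 ^ m}. distr M (count_space UNIV) (\<lambda>\<omega>. card (X \<omega> \<inter> atom m B c)))"
    using meas by (subst (asm) indep_vars_iff_distr_eq_PiM) (auto simp: lessThan_empty_iff)
  also have "\<dots> = poisson_counts_law m B"
    unfolding poisson_counts_law_def
  proof (rule PiM_cong[OF refl])
    fix c
    let ?f = "\<lambda>k. ennreal (exp (- measure lborel (atom m B c)) * measure lborel (atom m B c) ^ k / fact k)"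
    show "distr M (count_space UNIV) (\<lambda>\<omega>. card (X \<omega> \<inter> atom m B c)) = density (count_space UNIV) ?f"
    proof (rule measure_eqI_countable)
      fix k :: nat
      have "emeasure (distr M (count_space UNIV) (\<lambda>\<omega>. card (X \<omega> \<inter> atom m B c))) {k} =
          emeasure M {\<omega> \<in> space M. card (X \<omega> \<inter> atom m B c) = k}"
        using meas by (subst emeasure_distr) (auto intro!: arg_cong[where f = "emeasure M"])
      also have "\<dots> = ?f k"
        using X at unfolding poisson_point_process_def by (simp add: emeasure_eq_measure)
      also have "\<dots> = emeasure (density (count_space UNIV) ?f) {k}"
        by (simp add: emeasure_density nn_integral_indicator_singleton)
      finally show "emeasure (distr M (count_space UNIV) (\<lambda>\<omega>. card (X \<omega> \<inter> atom m B c))) {k} =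
          emeasure (density (count_space UNIV) ?f) {k}" .
    qed auto
  qed
  finally show ?thesis .
qed

lemma (in prob_space) poisson_count_event:
  assumes X: "poisson_point_process M X" and B: "\<And>l. l < m \<Longrightarrow> B l \<in> sets borel \<and> bounded (B l)"
  shows "emeasure (distr M config_space X) (count_event m B k) = emeasure (poisson_counts_law m B)
     {y \<in> space (\<Pi>\<^sub>M c\<in>{..<2 ^ m}. count_space UNIV). \<forall>l<m. (\<Sum>c\<in>{c. c < 2 ^ m \<and> l \<in> set_decode c}. y c) = k l}"
    (is "_ = emeasure _ ?E")
proof -
  let ?C = "\<Pi>\<^sub>M c\<in>{..<(2::nat) ^ m}. count_space (UNIV :: nat set)"
  let ?Y = "\<lambda>\<omega>. \<lambda>c\<in>{..<2 ^ m}. card (X \<omega> \<inter> atom m B c)"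
  have XM: "X \<in> M \<rightarrow>\<^sub>M config_space" using X by (simp add: poisson_point_process_def)
  have meas: "(\<lambda>\<omega>. card (X \<omega> \<inter> atom m B c)) \<in> M \<rightarrow>\<^sub>M count_space UNIV" for c
    by (rule measurable_compose[OF XM measurable_card_config]) (rule atom_borel, simp add: B, rule atom_bounded, simp add: B)
  have Y: "?Y \<in> M \<rightarrow>\<^sub>M ?C" by (intro measurable_restrict meas)
  have E: "?E \<in> sets ?C"
  proof -
    have [measurable]: "(\<lambda>y. \<Sum>c\<in>{c. c < 2 ^ m \<and> l \<in> set_decode c}. y c) \<in> ?C \<rightarrow>\<^sub>M count_space UNIV" for l
      by (rule measurable_sum_nat) (auto intro!: measurable_component_singleton)
    show ?thesis by measurable
  qed
  have ce: "count_event m B k \<in> sets config_space" using B by (rule count_event_sets)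
  have "emeasure (distr M config_space X) (count_event m B k) = emeasure M (X -` count_event m B k \<inter> space M)"
    by (rule emeasure_distr[OF XM ce])
  also have "X -` count_event m B k \<inter> space M = ?Y -` ?E \<inter> space M"
  proof -
    have "X \<omega> \<in> count_event m B k \<longleftrightarrow> ?Y \<omega> \<in> ?E" if "\<omega> \<in> space M" for \<omega>
    proof -
      have lf: "X \<omega> \<in> locally_finite_configs" using measurable_space[OF XM that] by simp
      have "(\<Sum>c\<in>{c. c < 2 ^ m \<and> l \<in> set_decode c}. ?Y \<omega> c) = card (X \<omega> \<inter> B l)" if "l < m" for l
        using card_eq_sum_atoms[OF lf that, of B] B by simp
      then show ?thesis using lf measurable_space[OF Y that] by (simp add: count_event_def)
    qed
    then show ?thesis by blast
  qed
  also have "emeasure M (?Y -` ?E \<inter> space M) = emeasure (distr M ?C ?Y) ?E"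
    using Y E by (simp add: emeasure_distr)
  finally show ?thesis by (simp only: poisson_atom_counts[OF assms])
qed

lemma count_events_generate:
  defines "G \<equiv> {count_event m B k | m B k. \<forall>l<m. B l \<in> sets borel \<and> bounded (B l)}"
  shows "Int_stable G" "G \<subseteq> Pow locally_finite_configs" "sets config_space = sigma_sets locally_finite_configs G"
proof -
  show "Int_stable G"
  proof (rule Int_stableI)
    fix a b assume "a \<in> G" "b \<in> G"
    then obtain m B k m' B' k' where a: "a = count_event m B k" "\<forall>l<m. B l \<in> sets borel \<and> bounded (B l)"
      and b: "b = count_event m' B' k'" "\<forall>l<m'. B' l \<in> sets borel \<and> bounded (B' l)"
      unfolding G_def by blast
    define C where "C l = (if l < m then B l else B' (l - m))" for l
    define j where "j l = (if l < m then k l else k' (l - m))" for l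
    have "(\<forall>l<m + m'. card (\<eta> \<inter> C l) = j l) \<longleftrightarrow> (\<forall>l<m. card (\<eta> \<inter> B l) = k l) \<and> (\<forall>l<m'. card (\<eta> \<inter> B' l) = k' l)" for \<eta>
    proof
      assume *: "\<forall>l<m + m'. card (\<eta> \<inter> C l) = j l"
      have "card (\<eta> \<inter> B l) = k l" if "l < m" for l using *[rule_format, of l] that by (simp add: C_def j_def)
      moreover have "card (\<eta> \<inter> B' l) = k' l" if "l < m'" for l
        using *[rule_format, of "m + l"] that by (simp add: C_def j_def)
      ultimately show "(\<forall>l<m. card (\<eta> \<inter> B l) = k l) \<and> (\<forall>l<m'. card (\<eta> \<inter> B' l) = k' l)" by blast
    qed (auto simp: C_def j_def)
    then have "a \<inter> b = count_event (m + m') C j" unfolding a b count_event_def by blast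
    moreover have "\<forall>l<m + m'. C l \<in> sets borel \<and> bounded (C l)" using a b by (auto simp: C_def)
    ultimately show "a \<inter> b \<in> G" unfolding G_def by blast
  qed
  show sub: "G \<subseteq> Pow locally_finite_configs" by (auto simp: G_def count_event_def)
  show "sets config_space = sigma_sets locally_finite_configs G"
    unfolding sets_config_space
  proof (rule sigma_sets_eqI)
    fix a assume "a \<in> {{\<eta> \<in> locally_finite_configs. card (\<eta> \<inter> B) = k} | B k. B \<in> sets borel \<and> bounded B}"
    then obtain B k where a: "a = {\<eta> \<in> locally_finite_configs. card (\<eta> \<inter> B) = k}" "B \<in> sets borel" "bounded B" by blast
    then have "a = count_event 1 (\<lambda>_. B) (\<lambda>_. k)" by (auto simp: count_event_def)
    then show "a \<in> sigma_sets locally_finite_configs G" using a by (auto simp: G_def intro!: sigma_sets.Basic)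
  next
    fix a assume "a \<in> G"
    then obtain m B k where a: "a = count_event m B k" "\<forall>l<m. B l \<in> sets borel \<and> bounded (B l)"
      unfolding G_def by blast
    then show "a \<in> sigma_sets locally_finite_configs {{\<eta> \<in> locally_finite_configs. card (\<eta> \<inter> B) = k} | B k. B \<in> sets borel \<and> bounded B}"
      unfolding sets_config_space[symmetric] by (auto intro: count_event_sets)
  qed
qed

text \<open>Joint counts generate the configurations and are intersection-stable, and their
  probabilities are computed from atoms alone. Hence all levels of the model carry the same law,
  which invariance under translation relies on.\<close>

lemma poisson_law_unique:
  assumes "prob_space M" "poisson_point_process M X" "prob_space M'" "poisson_point_process M' X'"
  shows "distr M config_space X = distr M' config_space X'"
proof -
  have X: "X \<in> M \<rightarrow>\<^sub>M config_space" and X': "X' \<in> M' \<rightarrow>\<^sub>M config_space"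
    using assms by (auto simp: poisson_point_process_def)
  interpret D: prob_space "distr M config_space X" using assms X by (intro prob_space.prob_space_distr)
  let ?G = "{count_event m B k | m B k. \<forall>l<m. B l \<in> sets borel \<and> bounded (B l)}"
  show ?thesis
  proof (rule measure_eqI_generator_eq[OF count_events_generate(1,2), where A = "\<lambda>_. locally_finite_configs"])
    show "emeasure (distr M config_space X) a = emeasure (distr M' config_space X') a" if "a \<in> ?G" for a
      using that prob_space.poisson_count_event[OF assms(1,2)] prob_space.poisson_count_event[OF assms(3,4)] by auto
    have "locally_finite_configs = count_event 0 (\<lambda>_. {}) (\<lambda>_. 0)" by (auto simp: count_event_def)
    then show "range (\<lambda>_. locally_finite_configs) \<subseteq> ?G" by blast
  qed (use count_events_generate(3) in auto)
qed

section \<open>The canonical input\<close>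

text \<open>All sources of randomness form one family of independent coordinates: the point process at
  level \<open>i\<close> is the first component of coordinate \<open>Inl i\<close>, and the increment number \<open>l\<close> of particle
  \<open>(i, j + 1)\<close> is the second component of coordinate \<open>Inr (i, j, l)\<close>.\<close>

type_synonym index = "int + int \<times> nat \<times> nat"

definition value_space :: "(real set \<times> site) measure" where
  "value_space = config_space \<Otimes>\<^sub>M count_space UNIV"

text \<open>Coordinates of the two kinds share one value type so that they form a single product;
  the component foreign to the kind is frozen at 0 or at the empty configuration.\<close>

definition coord_law :: "real set measure \<Rightarrow> index \<Rightarrow> (real set \<times> site) measure" where
  "coord_law \<pi> q = (case q of Inl i \<Rightarrow> distr \<pi> value_space (\<lambda>\<eta>. (\<eta>, 0))
     | Inr p \<Rightarrow> distr (measure_pmf (pmf_of_set unit_steps)) value_space (\<lambda>s. ({}, s)))"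

definition points_of :: "(index \<Rightarrow> real set \<times> site) \<Rightarrow> int \<Rightarrow> real set" where
  "points_of x i = fst (x (Inl i))"

text \<open>Coordinates count particles from 0 and labels from 1, hence \<open>j - 1\<close>. By
  truncation the label 0 repeats the walk with label 1, so lattice steps hold for all
  labels.\<close>

definition walks_of :: "(index \<Rightarrow> real set \<times> site) \<Rightarrow> int \<Rightarrow> nat \<Rightarrow> nat \<Rightarrow> site" where
  "walks_of x i j k = (0, i) + (\<Sum>l<k. snd (x (Inr (i, j - 1, l))))"

lemma empty_config: "{} \<in> locally_finite_configs"
  by (simp add: locally_finite_configs_def)

lemma space_value_space: "space value_space = locally_finite_configs \<times> UNIV"
  by (simp add: value_space_def space_pair_measure)

lemma measurable_fst_value: "fst \<in> value_space \<rightarrow>\<^sub>M config_space"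
  and measurable_snd_value: "snd \<in> value_space \<rightarrow>\<^sub>M count_space UNIV"
  by (simp_all add: value_space_def)

lemma measurable_config_value: "(\<lambda>\<eta>. (\<eta>, 0)) \<in> config_space \<rightarrow>\<^sub>M value_space"
  unfolding value_space_def by measurable

lemma measurable_step_value: "(\<lambda>s. ({}, s)) \<in> count_space UNIV \<rightarrow>\<^sub>M value_space"
  unfolding value_space_def
  by (intro measurable_Pair measurable_const) (auto simp: empty_config)

text \<open>These one-set count probabilities carry the estimates that follow: a finite mean count,
  void probabilities and the count in a short interval.\<close>

locale canonical_input = pi: prob_space \<pi> for \<pi> :: "real set measure" +
  assumes sets_\<pi> [measurable_cong]: "sets \<pi> = sets config_space"
    and poisson_counts: "\<And>B k. B \<in> sets borel \<Longrightarrow> bounded B \<Longrightarrow> B \<subseteq> {0..} \<Longrightarrow>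
      measure \<pi> {\<eta> \<in> space \<pi>. card (\<eta> \<inter> B) = k} = exp (- measure lborel B) * measure lborel B ^ k / fact k"
begin

lemma space_\<pi>: "space \<pi> = locally_finite_configs"
  using sets_eq_imp_space_eq[OF sets_\<pi>] by simp

lemma sets_coord_law: "sets (coord_law \<pi> q) = sets value_space"
  by (cases q) (simp_all add: coord_law_def)

lemma space_coord_law: "space (coord_law \<pi> q) = locally_finite_configs \<times> UNIV"
  using sets_eq_imp_space_eq[OF sets_coord_law] space_value_space by simp

sublocale full_product "coord_law \<pi>"
proof (rule full_product.intro)
  fix q
  have 1: "(\<lambda>\<eta>. (\<eta>, 0)) \<in> \<pi> \<rightarrow>\<^sub>M value_space"
    using measurable_config_value measurable_cong_sets[OF sets_\<pi> refl] by blast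
  have 2: "(\<lambda>s. ({}, s)) \<in> measure_pmf (pmf_of_set unit_steps) \<rightarrow>\<^sub>M value_space"
    using measurable_step_value by simp
  show "prob_space (coord_law \<pi> q)"
    using pi.prob_space_distr[OF 1] measure_pmf.prob_space_distr[OF 2]
    by (cases q) (simp_all add: coord_law_def)
qed

lemma points_measurable: "(\<lambda>x. points_of x i) \<in> P \<rightarrow>\<^sub>M config_space"
  unfolding points_of_def
  by (rule measurable_compose[of _ _ "coord_law \<pi> (Inl i)"])
    (use measurable_fst_value measurable_cong_sets[OF sets_coord_law refl] in auto)

lemma step_measurable: "(\<lambda>x. snd (x q)) \<in> P \<rightarrow>\<^sub>M count_space UNIV"
  by (rule measurable_compose[of _ _ "coord_law \<pi> q"])
    (use measurable_snd_value measurable_cong_sets[OF sets_coord_law refl] in auto)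

lemma walks_measurable: "(\<lambda>x. walks_of x i j) \<in> P \<rightarrow>\<^sub>M walk_space"
proof -
  have "(\<lambda>x. walks_of x i j k) \<in> P \<rightarrow>\<^sub>M count_space UNIV" for k
  proof (induction k)
    case (Suc k)
    from measurable_countable2[OF Suc step_measurable[of "Inr (i, j - 1, k)"], of "(+)"]
    show ?case by (simp add: walks_of_def add.assoc)
  qed (simp add: walks_of_def)
  then show ?thesis unfolding walk_space_def by (intro measurable_PiM_single') auto
qed

lemma points_distr: "distr P config_space (\<lambda>x. points_of x i) = \<pi>"
proof -
  have 1: "(\<lambda>\<eta>. (\<eta>, 0)) \<in> \<pi> \<rightarrow>\<^sub>M value_space"
    using measurable_config_value measurable_cong_sets[OF sets_\<pi> refl] by blast
  have "distr P config_space (\<lambda>x. points_of x i) = distr (distr P (coord_law \<pi> (Inl i)) (\<lambda>x. x (Inl i))) config_space fst"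
    unfolding points_of_def
    by (subst distr_distr) (use measurable_fst_value measurable_cong_sets[OF sets_coord_law refl] in \<open>auto simp: comp_def\<close>)
  also have "distr P (coord_law \<pi> (Inl i)) (\<lambda>x. x (Inl i)) = coord_law \<pi> (Inl i)"
    by (rule PiM_component) simp
  also have "distr (coord_law \<pi> (Inl i)) config_space fst = distr \<pi> config_space (\<lambda>\<eta>. \<eta>)"
    unfolding coord_law_def sum.case by (subst distr_distr[OF measurable_fst_value 1]) (simp add: comp_def)
  also have "\<dots> = \<pi>" by (rule distr_id2) (simp add: sets_\<pi>)
  finally show ?thesis .
qed

lemma unit_steps_facts: "finite unit_steps" "unit_steps \<noteq> {}" "card unit_steps = 4"
  by (auto simp: unit_steps_def)

lemma step_distr: "distr P (count_space UNIV) (\<lambda>x. snd (x (Inr p))) = measure_pmf (pmf_of_set unit_steps)"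
proof -
  have 2: "(\<lambda>s. ({}, s)) \<in> measure_pmf (pmf_of_set unit_steps) \<rightarrow>\<^sub>M value_space"
    using measurable_step_value by simp
  have "distr P (count_space UNIV) (\<lambda>x. snd (x (Inr p))) = distr (distr P (coord_law \<pi> (Inr p)) (\<lambda>x. x (Inr p))) (count_space UNIV) snd"
    by (subst distr_distr) (use measurable_snd_value measurable_cong_sets[OF sets_coord_law refl] in \<open>auto simp: comp_def\<close>)
  also have "distr P (coord_law \<pi> (Inr p)) (\<lambda>x. x (Inr p)) = coord_law \<pi> (Inr p)"
    by (rule PiM_component) simp
  also have "distr (coord_law \<pi> (Inr p)) (count_space UNIV) snd =
      distr (measure_pmf (pmf_of_set unit_steps)) (count_space UNIV) (\<lambda>s. s)"
    unfolding coord_law_def sum.case by (subst distr_distr[OF measurable_snd_value 2]) (simp add: comp_def)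
  also have "\<dots> = measure_pmf (pmf_of_set unit_steps)" by (rule distr_id2) simp
  finally show ?thesis .
qed

lemma AE_points:
  assumes "AE \<eta> in \<pi>. Q \<eta>"
  shows "AE x in P. Q (points_of x i)"
  by (rule AE_distrD[OF points_measurable]) (subst points_distr, rule assms)

lemma AE_lattice_walks: "AE x in P. lattice_walks (walks_of x)"
proof -
  have "AE x in P. snd (x (Inr p)) \<in> unit_steps" for p
  proof (rule AE_distrD[OF step_measurable])
    show "AE s in distr P (count_space UNIV) (\<lambda>x. snd (x (Inr p))). s \<in> unit_steps"
      by (subst step_distr) (simp add: AE_measure_pmf_iff unit_steps_facts)
  qed
  then have "AE x in P. \<forall>p. snd (x (Inr p)) \<in> unit_steps" by (simp add: AE_all_countable)
  then show ?thesis
    by eventually_elim (auto simp: lattice_walks_def walks_of_def zero_prod_def)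
qed

lemma point_space: "x \<in> space P \<Longrightarrow> points_of x i \<in> locally_finite_configs"
  using measurable_space[OF points_measurable] by auto

end

section \<open>The law of the input\<close>

lemma finite_forest_cong:
  assumes "\<And>i j. 1 \<le> j \<Longrightarrow> w i j = w' i j"
  shows "finite_forest \<eta> w n m = finite_forest \<eta> w' n m"
  unfolding finite_forest_eq by (rule grow_cong) (use schedule_labels(2) assms in blast)

lemma forest_at_cong: "(\<And>i j. 1 \<le> j \<Longrightarrow> w i j = w' i j) \<Longrightarrow> forest_at \<eta> w n = forest_at \<eta> w' n"
  using finite_forest_cong[of w w'] by (simp add: forest_at_def stable_level_def)

lemma forest_limit_cong: "(\<And>i j. 1 \<le> j \<Longrightarrow> w i j = w' i j) \<Longrightarrow> forest_limit \<eta> w = forest_limit \<eta> w'"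
  using forest_at_cong[of w w'] by (simp add: forest_limit_def)

context idla
begin

definition \<pi> where "\<pi> = distr M config_space (N 0)"

text \<open>Increments rather than walks are recorded, because they are the independent variables.
  The starting point is restored by \<open>walks_of\<close>, in agreement with \<open>S\<close> only
  almost surely.\<close>

definition Z :: "'a \<Rightarrow> index \<Rightarrow> real set \<times> site" where
  "Z \<omega> q = (case q of Inl i \<Rightarrow> (N i \<omega>, 0) | Inr (i, j, l) \<Rightarrow> ({}, S i (Suc j) \<omega> (Suc l) - S i (Suc j) \<omega> l))"

lemma N_measurable: "N i \<in> M \<rightarrow>\<^sub>M config_space"
  using poisson[of i] by (simp add: poisson_point_process_def)

lemma S_measurable: "1 \<le> j \<Longrightarrow> S i j \<in> M \<rightarrow>\<^sub>M walk_space"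
  using walk[of j i] by (simp add: simple_random_walk_def)

lemma N_distr: "distr M config_space (N i) = \<pi>"
  unfolding \<pi>_def by (rule poisson_law_unique) (use poisson prob_space_axioms in auto)

sublocale input: canonical_input \<pi>
proof -
  interpret \<pi>: prob_space \<pi> unfolding \<pi>_def by (rule prob_space_distr[OF N_measurable])
  show "canonical_input \<pi>"
  proof
    show "sets \<pi> = sets config_space" by (simp add: \<pi>_def)
    fix B :: "real set" and k assume B: "B \<in> sets borel" "bounded B" "B \<subseteq> {0..}"
    have "{\<eta> \<in> space \<pi>. card (\<eta> \<inter> B) = k} \<in> sets config_space"
      using measurable_sets[OF measurable_card_config[OF B(1,2)], of "{k}"]
      by (simp add: \<pi>_def vimage_def Int_def conj_commute)
    then have "measure \<pi> {\<eta> \<in> space \<pi>. card (\<eta> \<inter> B) = k} = measure M {\<omega> \<in> space M. card (N 0 \<omega> \<inter> B) = k}"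
      unfolding \<pi>_def using measurable_space[OF N_measurable]
      by (subst measure_distr[OF N_measurable]) (auto intro!: arg_cong[where f = "measure M"])
    then show "measure \<pi> {\<eta> \<in> space \<pi>. card (\<eta> \<inter> B) = k} = exp (- measure lborel B) * measure lborel B ^ k / fact k"
      using poisson[of 0] B unfolding poisson_point_process_def by simp
  qed
qed

lemma increment_measurable: "(\<lambda>\<omega>. S i (Suc j) \<omega> (Suc l) - S i (Suc j) \<omega> l) \<in> M \<rightarrow>\<^sub>M count_space UNIV"
  using measurable_countable2[OF measurable_walk measurable_walk, OF S_measurable S_measurable, of "Suc j" "Suc j" "(-)"] by simp

lemma Z_coord_measurable: "(\<lambda>\<omega>. Z \<omega> q) \<in> M \<rightarrow>\<^sub>M value_space"
proof (cases q)
  case (Inl i)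
  then show ?thesis using measurable_compose[OF N_measurable measurable_config_value] by (simp add: Z_def)
next
  case (Inr p)
  obtain i j l where "p = (i, j, l)" by (cases p)
  then show ?thesis using measurable_compose[OF increment_measurable measurable_step_value] Inr by (simp add: Z_def)
qed

lemma Z_measurable: "Z \<in> M \<rightarrow>\<^sub>M input.P"
proof -
  have "(\<lambda>\<omega>. Z \<omega> q) \<in> M \<rightarrow>\<^sub>M coord_law \<pi> q" for q
    using Z_coord_measurable measurable_cong_sets[OF refl input.sets_coord_law] by blast
  then show ?thesis by (intro measurable_PiM_single') (auto dest: measurable_space)
qed

lemma prob_points:
  assumes "finite J" "\<And>i. i \<in> J \<Longrightarrow> A i \<in> sets config_space"
  shows "prob {\<omega> \<in> space M. \<forall>i\<in>J. N i \<omega> \<in> A i} = (\<Prod>i\<in>J. measure \<pi> (A i))"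
proof (cases "J = {}")
  case False
  have "prob (\<Inter>i\<in>J. N i -` A i \<inter> space M) = (\<Prod>i\<in>J. prob (N i -` A i \<inter> space M))"
    using assms False by (intro indep_varsD[OF indep_poisson]) auto
  also have "\<dots> = (\<Prod>i\<in>J. measure \<pi> (A i))"
    using assms by (intro prod.cong refl) (subst N_distr[symmetric], subst measure_distr[OF N_measurable], auto)
  also have "(\<Inter>i\<in>J. N i -` A i \<inter> space M) = {\<omega> \<in> space M. \<forall>i\<in>J. N i \<omega> \<in> A i}" using False by auto
  finally show ?thesis .
qed (simp add: prob_space)

lemma prob_walk_increments:
  assumes "finite L"
  shows "prob {\<omega> \<in> space M. \<forall>l\<in>L. S i (Suc j) \<omega> (Suc l) - S i (Suc j) \<omega> l \<in> A l} =
    (\<Prod>l\<in>L. measure (measure_pmf (pmf_of_set unit_steps)) (A l))"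
proof (cases "L = {}")
  case False
  let ?X = "\<lambda>l \<omega>. S i (Suc j) \<omega> (Suc l) - S i (Suc j) \<omega> l"
  have w: "indep_vars (\<lambda>_. count_space UNIV) ?X UNIV"
    "\<And>l. distr M (count_space UNIV) (?X l) = measure_pmf (pmf_of_set unit_steps)"
    using walk[of "Suc j" i] by (auto simp: simple_random_walk_def)
  have "prob (\<Inter>l\<in>L. ?X l -` A l \<inter> space M) = (\<Prod>l\<in>L. prob (?X l -` A l \<inter> space M))"
    using assms False by (intro indep_varsD[OF w(1)]) auto
  also have "\<dots> = (\<Prod>l\<in>L. measure (measure_pmf (pmf_of_set unit_steps)) (A l))"
    by (intro prod.cong refl) (subst w(2)[symmetric], subst measure_distr[OF increment_measurable], auto)
  also have "(\<Inter>l\<in>L. ?X l -` A l \<inter> space M) = {\<omega> \<in> space M. \<forall>l\<in>L. ?X l \<omega> \<in> A l}" using False by auto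
  finally show ?thesis .
qed (simp add: prob_space)

text \<open>Independence enters in two layers: between different walks, through events
  \<open>B p\<close> that collect the constraints on walk \<open>p\<close>, and between the
  increments of one walk. \<open>L p\<close> lists the constrained times of walk
  \<open>p\<close>.\<close>

lemma prob_increments:
  assumes "finite J"
  shows "prob {\<omega> \<in> space M. \<forall>(i, j, l)\<in>J. S i (Suc j) \<omega> (Suc l) - S i (Suc j) \<omega> l \<in> A (i, j, l)} =
    (\<Prod>p\<in>J. measure (measure_pmf (pmf_of_set unit_steps)) (A p))"
proof (cases "J = {}")
  case False
  define I where "I = (\<lambda>(i, j, l). (i, Suc j)) ` J"
  define L where "L p = {l. (fst p, snd p - 1, l) \<in> J}" for p :: "int \<times> nat"
  define B where "B p = {s::nat \<Rightarrow> site. \<forall>l\<in>L p. s (Suc l) - s l \<in> A (fst p, snd p - 1, l)}" for p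
  let ?S = "\<lambda>p. case p of (i, j) \<Rightarrow> S i j"
  have finL: "finite (L p)" for p
    using finite_vimageI[OF assms, of "\<lambda>l. (fst p, snd p - 1, l)"] by (simp add: L_def vimage_def inj_on_def)
  have B: "B p \<in> sets walk_space" for p
  proof -
    have "(\<lambda>s. s (Suc l) - s l) \<in> walk_space \<rightarrow>\<^sub>M count_space UNIV" for l
      using measurable_countable2[OF measurable_walk[OF measurable_ident] measurable_walk[OF measurable_ident], of "(-)"] by simp
    then have [measurable]: "Measurable.pred walk_space (\<lambda>s. s (Suc l) - s l \<in> D)" for l D
      by (rule measurable_compose) simp
    have "{s \<in> space walk_space. \<forall>l\<in>L p. s (Suc l) - s l \<in> A (fst p, snd p - 1, l)} \<in> sets walk_space"
      by (intro sets.sets_Collect_finite_All finL) simp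
    then show ?thesis by (simp add: B_def walk_space_def space_PiM)
  qed
  have "prob (\<Inter>p\<in>I. ?S p -` B p \<inter> space M) = (\<Prod>p\<in>I. prob (?S p -` B p \<inter> space M))"
    using assms False B by (intro indep_varsD[OF indep_walks]) (auto simp: I_def)
  also have "\<dots> = (\<Prod>p\<in>I. \<Prod>l\<in>L p. measure (measure_pmf (pmf_of_set unit_steps)) (A (fst p, snd p - 1, l)))"
  proof (rule prod.cong[OF refl])
    fix p assume "p \<in> I"
    then obtain i j where p: "p = (i, Suc j)" by (auto simp: I_def)
    have "?S p -` B p \<inter> space M = {\<omega> \<in> space M. \<forall>l\<in>L p. S i (Suc j) \<omega> (Suc l) - S i (Suc j) \<omega> l \<in> A (i, j, l)}"
      by (auto simp: B_def p)
    then show "prob (?S p -` B p \<inter> space M) = (\<Prod>l\<in>L p. measure (measure_pmf (pmf_of_set unit_steps)) (A (fst p, snd p - 1, l)))"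
      using prob_walk_increments[OF finL] by (simp add: p)
  qed
  also have "\<dots> = (\<Prod>z\<in>Sigma I L. measure (measure_pmf (pmf_of_set unit_steps)) (A (fst (fst z), snd (fst z) - 1, snd z)))"
    using assms finL by (subst prod.Sigma) (auto simp: I_def case_prod_unfold)
  also have "\<dots> = (\<Prod>p\<in>J. measure (measure_pmf (pmf_of_set unit_steps)) (A p))"
    by (rule prod.reindex_bij_witness[of _ "\<lambda>(i, j, l). ((i, Suc j), l)" "\<lambda>z. (fst (fst z), snd (fst z) - 1, snd z)"])
      (force simp: I_def L_def)+
  also have "(\<Inter>p\<in>I. ?S p -` B p \<inter> space M) =
      {\<omega> \<in> space M. \<forall>(i, j, l)\<in>J. S i (Suc j) \<omega> (Suc l) - S i (Suc j) \<omega> l \<in> A (i, j, l)}"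
  proof (intro equalityI subsetI)
    fix \<omega> assume \<omega>: "\<omega> \<in> (\<Inter>p\<in>I. ?S p -` B p \<inter> space M)"
    have "S i (Suc j) \<omega> (Suc l) - S i (Suc j) \<omega> l \<in> A (i, j, l)" if "(i, j, l) \<in> J" for i j l
    proof -
      have "(i, Suc j) \<in> I" using that by (force simp: I_def)
      from INT_D[OF \<omega> this] have "S i (Suc j) \<omega> \<in> B (i, Suc j)" by simp
      then show ?thesis using that by (simp add: B_def L_def)
    qed
    moreover have "\<omega> \<in> space M" using \<omega> False by (auto simp: I_def)
    ultimately show "\<omega> \<in> {\<omega> \<in> space M. \<forall>(i, j, l)\<in>J. S i (Suc j) \<omega> (Suc l) - S i (Suc j) \<omega> l \<in> A (i, j, l)}" by blast
  next
    fix \<omega> assume \<omega>: "\<omega> \<in> {\<omega> \<in> space M. \<forall>(i, j, l)\<in>J. S i (Suc j) \<omega> (Suc l) - S i (Suc j) \<omega> l \<in> A (i, j, l)}"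
    have "?S p \<omega> \<in> B p" if pI: "p \<in> I" for p
    proof -
      obtain i j where "p = (i, Suc j)" using pI unfolding I_def by (elim imageE) (auto split: prod.splits)
      then show ?thesis using \<omega> by (auto simp: B_def L_def)
    qed
    then show "\<omega> \<in> (\<Inter>p\<in>I. ?S p -` B p \<inter> space M)" using \<omega> by blast
  qed
  finally show ?thesis .
qed (simp add: prob_space)

lemma prob_points_increments:
  assumes "finite J" "\<And>i. i \<in> J \<Longrightarrow> A i \<in> sets config_space" "finite J'"
  shows "prob {\<omega> \<in> space M. (\<forall>i\<in>J. N i \<omega> \<in> A i) \<and>
      (\<forall>(i, j, l)\<in>J'. S i (Suc j) \<omega> (Suc l) - S i (Suc j) \<omega> l \<in> A' (i, j, l))} =
    (\<Prod>i\<in>J. measure \<pi> (A i)) * (\<Prod>p\<in>J'. measure (measure_pmf (pmf_of_set unit_steps)) (A' p))"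
proof -
  let ?a = "{\<omega> \<in> space M. \<forall>i\<in>J. N i \<omega> \<in> A i}"
  let ?b = "{\<omega> \<in> space M. \<forall>(i, j, l)\<in>J'. S i (Suc j) \<omega> (Suc l) - S i (Suc j) \<omega> l \<in> A' (i, j, l)}"
  let ?CN = "\<Pi>\<^sub>M i\<in>(UNIV :: int set). config_space"
  let ?CS = "\<Pi>\<^sub>M p\<in>(UNIV :: int set) \<times> {1::nat..}. walk_space"
  let ?\<S> = "\<lambda>\<omega>. \<lambda>(i, j)\<in>UNIV \<times> {1..}. S i j \<omega>"
  have "?a \<in> sets (vimage_algebra (space M) (\<lambda>\<omega> i. N i \<omega>) ?CN)"
  proof -
    have "{x \<in> space ?CN. \<forall>i\<in>J. x i \<in> A i} \<in> sets ?CN"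
    proof (intro sets.sets_Collect_finite_All assms(1) sets_Collect_single')
      fix i assume "i \<in> J"
      then have "A i \<in> sets config_space" by (rule assms(2))
      moreover from this have "{\<eta> \<in> space config_space. \<eta> \<in> A i} = A i" using sets.sets_into_space by blast
      ultimately show "{\<eta> \<in> space config_space. \<eta> \<in> A i} \<in> sets config_space" by simp
    qed simp
    from in_vimage_algebra[OF this, of "\<lambda>\<omega> i. N i \<omega>" "space M"]
    have "(\<lambda>\<omega> i. N i \<omega>) -` {x \<in> space ?CN. \<forall>i\<in>J. x i \<in> A i} \<inter> space M \<in> sets (vimage_algebra (space M) (\<lambda>\<omega> i. N i \<omega>) ?CN)" .
    also have "(\<lambda>\<omega> i. N i \<omega>) -` {x \<in> space ?CN. \<forall>i\<in>J. x i \<in> A i} \<inter> space M = ?a"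
      using measurable_space[OF N_measurable] by (auto simp: space_PiM)
    finally show ?thesis .
  qed
  moreover have "?b \<in> sets (vimage_algebra (space M) ?\<S> ?CS)"
  proof -
    let ?B = "{x \<in> space ?CS. \<forall>p\<in>J'. x (fst p, Suc (fst (snd p))) (Suc (snd (snd p))) - x (fst p, Suc (fst (snd p))) (snd (snd p)) \<in> A' p}"
    have c: "(\<lambda>x. x (i, Suc j) l) \<in> ?CS \<rightarrow>\<^sub>M count_space UNIV" for i j l
      by (rule measurable_walk) (auto intro!: measurable_component_singleton)
    have "(\<lambda>x. x (i, Suc j) (Suc l) - x (i, Suc j) l) \<in> ?CS \<rightarrow>\<^sub>M count_space UNIV" for i j l
      using measurable_countable2[OF c c, of "(-)"] by simp
    then have [measurable]: "Measurable.pred ?CS (\<lambda>x. x (i, Suc j) (Suc l) - x (i, Suc j) l \<in> D)" for i j l D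
      by (rule measurable_compose) simp
    have "?B \<in> sets ?CS" by (intro sets.sets_Collect_finite_All assms(3)) measurable
    from in_vimage_algebra[OF this, of ?\<S> "space M"]
    have "?\<S> -` ?B \<inter> space M \<in> sets (vimage_algebra (space M) ?\<S> ?CS)" .
    also have "?\<S> -` ?B \<inter> space M = ?b"
    proof -
      have "?\<S> \<omega> \<in> space ?CS" for \<omega> by (auto simp: space_PiM walk_space_def)
      then show ?thesis by (auto simp: case_prod_unfold)
    qed
    finally show ?thesis .
  qed
  ultimately have "prob (?a \<inter> ?b) = prob ?a * prob ?b" by (rule indep_setD[OF indep_poisson_walks])
  also have "?a \<inter> ?b = {\<omega> \<in> space M. (\<forall>i\<in>J. N i \<omega> \<in> A i) \<and>
      (\<forall>(i, j, l)\<in>J'. S i (Suc j) \<omega> (Suc l) - S i (Suc j) \<omega> l \<in> A' (i, j, l))}" by auto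
  finally show ?thesis using prob_points[OF assms(1,2)] prob_increments[OF assms(3)] by simp
qed

lemma Z_distr: "distr M input.P Z = input.P"
proof (rule input.measure_eq_P)
  fix J :: "index set" and A :: "index \<Rightarrow> _"
  assume J: "finite J" and A: "\<And>q. q \<in> J \<Longrightarrow> A q \<in> sets (coord_law \<pi> q)"
  define J1 where "J1 = Inl -` J"
  define J2 where "J2 = Inr -` J"
  define A1 where "A1 i = {\<eta> \<in> locally_finite_configs. (\<eta>, 0) \<in> A (Inl i)}" for i
  define A2 where "A2 p = {s. ({}, s) \<in> A (Inr p)}" for p
  have J12: "J = Inl ` J1 \<union> Inr ` J2" 
  proof (intro equalityI subsetI)
    fix q assume "q \<in> J"
    then show "q \<in> Inl ` J1 \<union> Inr ` J2" by (cases q) (auto simp: J1_def J2_def)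
  qed (auto simp: J1_def J2_def)
  have fin: "finite J1" "finite J2" unfolding J1_def J2_def using J by (auto intro: finite_vimageI)
  have Av: "q \<in> J \<Longrightarrow> A q \<in> sets value_space" for q using A by (simp add: input.sets_coord_law)
  have A1: "i \<in> J1 \<Longrightarrow> A1 i \<in> sets config_space" for i
    using measurable_sets[OF measurable_config_value Av[of "Inl i"]]
    by (simp add: A1_def J1_def vimage_def Int_def conj_commute)
  have e1: "emeasure (coord_law \<pi> (Inl i)) (A (Inl i)) = measure \<pi> (A1 i)" if "i \<in> J1" for i
  proof -
    have "(\<lambda>\<eta>. (\<eta>, 0)) \<in> \<pi> \<rightarrow>\<^sub>M value_space"
      using measurable_config_value measurable_cong_sets[OF input.sets_\<pi> refl] by blast
    then have "emeasure (coord_law \<pi> (Inl i)) (A (Inl i)) = emeasure \<pi> (A1 i)"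
      using Av[of "Inl i"] that input.space_\<pi> unfolding coord_law_def A1_def J1_def
      by (simp add: emeasure_distr vimage_def Int_def conj_commute)
    moreover have "prob_space \<pi>" unfolding \<pi>_def by (rule prob_space_distr[OF N_measurable])
    ultimately show ?thesis by (simp add: finite_measure.emeasure_eq_measure prob_space.finite_measure)
  qed
  have e2: "emeasure (coord_law \<pi> (Inr p)) (A (Inr p)) = measure (measure_pmf (pmf_of_set unit_steps)) (A2 p)" if "p \<in> J2" for p
  proof -
    have "(\<lambda>s. ({}, s)) \<in> measure_pmf (pmf_of_set unit_steps) \<rightarrow>\<^sub>M value_space"
      using measurable_step_value by simp
    then have "emeasure (coord_law \<pi> (Inr p)) (A (Inr p)) = emeasure (measure_pmf (pmf_of_set unit_steps)) (A2 p)"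
      using Av[of "Inr p"] that unfolding coord_law_def A2_def J2_def by (simp add: emeasure_distr vimage_def)
    then show ?thesis by (simp add: measure_pmf.emeasure_eq_measure)
  qed
  have "emeasure (distr M input.P Z) {x \<in> space input.P. \<forall>i\<in>J. x i \<in> A i} =
      emeasure M {\<omega> \<in> space M. (\<forall>i\<in>J1. N i \<omega> \<in> A1 i) \<and>
      (\<forall>(i, j, l)\<in>J2. S i (Suc j) \<omega> (Suc l) - S i (Suc j) \<omega> l \<in> A2 (i, j, l))}"
  proof (subst emeasure_distr[OF Z_measurable])
    show "{x \<in> space input.P. \<forall>i\<in>J. x i \<in> A i} \<in> sets input.P" using J A by (rule input.cylinder_sets)
    have "Z -` {x \<in> space input.P. \<forall>i\<in>J. x i \<in> A i} \<inter> space M = {\<omega> \<in> space M. (\<forall>i\<in>J1. N i \<omega> \<in> A1 i) \<and>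
      (\<forall>(i, j, l)\<in>J2. S i (Suc j) \<omega> (Suc l) - S i (Suc j) \<omega> l \<in> A2 (i, j, l))}"
      using measurable_space[OF Z_measurable] measurable_space[OF N_measurable]
      by (auto simp: J12 A1_def A2_def Z_def ball_Un)
    then show "emeasure M (Z -` {x \<in> space input.P. \<forall>i\<in>J. x i \<in> A i} \<inter> space M) =
      emeasure M {\<omega> \<in> space M. (\<forall>i\<in>J1. N i \<omega> \<in> A1 i) \<and>
      (\<forall>(i, j, l)\<in>J2. S i (Suc j) \<omega> (Suc l) - S i (Suc j) \<omega> l \<in> A2 (i, j, l))}" by simp
  qed
  also have "\<dots> = ennreal ((\<Prod>i\<in>J1. measure \<pi> (A1 i)) * (\<Prod>p\<in>J2. measure (measure_pmf (pmf_of_set unit_steps)) (A2 p)))"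
    unfolding emeasure_eq_measure by (subst prob_points_increments[OF fin(1) A1 fin(2)]) auto
  also have "\<dots> = (\<Prod>i\<in>J1. emeasure (coord_law \<pi> (Inl i)) (A (Inl i))) * (\<Prod>p\<in>J2. emeasure (coord_law \<pi> (Inr p)) (A (Inr p)))"
    by (simp add: e1 e2 ennreal_mult prod_nonneg prod_ennreal)
  also have "\<dots> = (\<Prod>q\<in>J. emeasure (coord_law \<pi> q) (A q))"
    unfolding J12 using fin by (subst prod.union_disjoint) (auto simp: prod.reindex)
  finally show "emeasure (distr M input.P Z) {x \<in> space input.P. \<forall>i\<in>J. x i \<in> A i} = (\<Prod>i\<in>J. emeasure (coord_law \<pi> i) (A i))" .
qed simp

lemma AE_input: "AE x in input.P. Q x \<Longrightarrow> AE \<omega> in M. Q (Z \<omega>)"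
  by (rule AE_distrD[OF Z_measurable]) (simp only: Z_distr)

lemma AE_walks_Z: "AE \<omega> in M. \<forall>i j. 1 \<le> j \<longrightarrow> walks_of (Z \<omega>) i j = S i j \<omega>"
proof -
  have "AE \<omega> in M. S i (Suc j) \<omega> 0 = (0, i)" for i j
    using walk[of "Suc j" i] by (simp add: simple_random_walk_def)
  then have "AE \<omega> in M. \<forall>i j. S i (Suc j) \<omega> 0 = (0, i)" by (simp add: AE_all_countable)
  then show ?thesis
  proof eventually_elim
    case (elim \<omega>)
    have "walks_of (Z \<omega>) i (Suc j) k = S i (Suc j) \<omega> k" for i j k
      using elim by (induction k) (auto simp: walks_of_def Z_def add.assoc[symmetric])
    then show ?case by (metis One_nat_def Suc_le_D ext)
  qed
qed

lemma points_Z: "points_of (Z \<omega>) = (\<lambda>i. N i \<omega>)"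
  by (simp add: points_of_def Z_def fun_eq_iff)

lemma AE_forest_Z:
  "AE \<omega> in M. idla_forest_inf N S \<omega> = forest_limit (points_of (Z \<omega>)) (walks_of (Z \<omega>)) \<and>
     (\<forall>n. idla_forest N S n \<omega> = forest_at (points_of (Z \<omega>)) (walks_of (Z \<omega>)) n)"
  using AE_walks_Z
proof eventually_elim
  case (elim \<omega>)
  then have "\<And>i j. 1 \<le> j \<Longrightarrow> S i j \<omega> = walks_of (Z \<omega>) i j" by simp
  from forest_limit_cong[OF this] forest_at_cong[OF this] show ?case
    by (auto simp: idla_forest_inf_def idla_forest_def points_Z)
qed

end

section \<open>Symmetries of the canonical input\<close>

definition source_map :: "(int \<Rightarrow> int) \<Rightarrow> index \<Rightarrow> index" where
  "source_map h q = (case q of Inl i \<Rightarrow> Inl (h i) | Inr (i, j, l) \<Rightarrow> Inr (h i, j, l))"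

definition step_map :: "(site \<Rightarrow> site) \<Rightarrow> index \<Rightarrow> real set \<times> site \<Rightarrow> real set \<times> site" where
  "step_map A q v = (fst v, case q of Inl _ \<Rightarrow> snd v | Inr _ \<Rightarrow> A (snd v))"

text \<open>Level \<open>i\<close> of the new input is read from level \<open>h i\<close> of the old
  one, so \<open>h\<close> is the inverse of the displacement of the levels.\<close>

definition act :: "(site \<Rightarrow> site) \<Rightarrow> (int \<Rightarrow> int) \<Rightarrow> (index \<Rightarrow> real set \<times> site) \<Rightarrow> index \<Rightarrow> real set \<times> site" where
  "act A h x q = step_map A q (x (source_map h q))"

definition sign_map :: "int \<Rightarrow> int \<Rightarrow> site \<Rightarrow> site" where
  "sign_map \<sigma> \<tau> = (\<lambda>(x, y). (\<sigma> * x, \<tau> * y))"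

text \<open>The affine map with linear part \<open>sign_map \<sigma> \<tau>\<close>: positions are
  moved by the former, increments by the latter.\<close>

definition site_map :: "int \<Rightarrow> int \<Rightarrow> int \<Rightarrow> site \<Rightarrow> site" where
  "site_map \<sigma> \<tau> c = (\<lambda>(x, y). (\<sigma> * x, \<tau> * y + c))"

definition regular :: "(index \<Rightarrow> real set \<times> site) \<Rightarrow> bool" where
  "regular x \<longleftrightarrow> admissible (points_of x) \<and> lattice_walks (walks_of x)"

definition window :: "nat \<Rightarrow> (index \<Rightarrow> real set \<times> site) \<Rightarrow> int list \<Rightarrow> site_graph" where
  "window n x is = grow (walks_of x) (schedule (points_of x) n is)"

lemma sign_cases:
  assumes "\<tau> * \<tau> = (1::int)"
  shows "\<tau> = 1 \<or> \<tau> = -1"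
  using assms by (metis abs_mult abs_zmult_eq_1 abs_1 abs_eq_iff)

lemma points_of_act: "points_of (act A h x) i = points_of x (h i)"
  by (simp add: points_of_def act_def step_map_def source_map_def)

lemma sign_map_sum: "sign_map \<sigma> \<tau> (\<Sum>l\<in>I. v l) = (\<Sum>l\<in>I. sign_map \<sigma> \<tau> (v l))"
proof -
  have "sign_map \<sigma> \<tau> 0 = 0" "sign_map \<sigma> \<tau> (u + u') = sign_map \<sigma> \<tau> u + sign_map \<sigma> \<tau> u'" for u u'
    by (auto simp: sign_map_def zero_prod_def plus_prod_def case_prod_unfold algebra_simps)
  then show ?thesis by (induction I rule: infinite_finite_induct) simp_all
qed

lemma walks_of_act:
  "walks_of (act (sign_map \<sigma> \<tau>) h x) i j k = (0, i) + sign_map \<sigma> \<tau> (walks_of x (h i) j k - (0, h i))"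
  by (simp add: walks_of_def act_def step_map_def source_map_def sign_map_sum)

lemma sign_map_unit_steps:
  assumes "\<sigma> * \<sigma> = 1" "\<tau> * \<tau> = 1"
  shows "sign_map \<sigma> \<tau> ` unit_steps = unit_steps" "inj_on (sign_map \<sigma> \<tau>) unit_steps"
  using sign_cases[OF assms(1)] sign_cases[OF assms(2)]
  by (auto simp: sign_map_def unit_steps_def inj_on_def insert_commute)

text \<open>Since \<tau> squares to 1, \<open>\<lambda>i. \<tau> * (i - c)\<close> inverts
  \<open>\<lambda>i. \<tau> * i + c\<close>; reading through the one displaces the levels by the
  other.\<close>

lemma site_symmetry_act:
  assumes "\<sigma> * \<sigma> = 1" "\<tau> * \<tau> = 1"
    and "regular x" "regular (act (sign_map \<sigma> \<tau>) (\<lambda>i. \<tau> * (i - c)) x)"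
  shows "site_symmetry (points_of x) (walks_of x)
     (points_of (act (sign_map \<sigma> \<tau>) (\<lambda>i. \<tau> * (i - c)) x))
     (walks_of (act (sign_map \<sigma> \<tau>) (\<lambda>i. \<tau> * (i - c)) x))
     (site_map \<sigma> \<tau> c) (\<lambda>i. \<tau> * i + c) c"
proof (intro site_symmetry.intro regular_input.intro site_symmetry_axioms.intro)
  have \<tau>\<tau>: "\<tau> * (\<tau> * i) = i" "\<sigma> * (\<sigma> * i) = i" for i
    using assms(1,2) by (simp_all add: mult.assoc[symmetric])
  show "bij (site_map \<sigma> \<tau> c)"
    using sign_cases[OF assms(1)] sign_cases[OF assms(2)]
    by (intro o_bij[of "site_map \<sigma> \<tau> (- \<tau> * c)"]) (auto simp: site_map_def fun_eq_iff)
  show "snd (site_map \<sigma> \<tau> c v) = \<tau> * snd v + c" for v by (cases v) (simp add: site_map_def)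
  show "(\<lambda>i. \<tau> * i + c) = (\<lambda>i. i + c) \<or> (\<lambda>i. \<tau> * i + c) = (\<lambda>i. c - i)"
    using sign_cases[OF assms(2)] by auto
  show "points_of (act (sign_map \<sigma> \<tau>) (\<lambda>i. \<tau> * (i - c)) x) (\<tau> * i + c) = points_of x i" for i
    by (simp add: points_of_act \<tau>\<tau>)
  show "walks_of (act (sign_map \<sigma> \<tau>) (\<lambda>i. \<tau> * (i - c)) x) (\<tau> * i + c) j l = site_map \<sigma> \<tau> c (walks_of x i j l)" for i j l
    unfolding walks_of_act
    by (cases "walks_of x i j l") (auto simp: \<tau>\<tau> sign_map_def site_map_def right_diff_distrib)
qed (use assms in \<open>auto simp: regular_def\<close>)

context canonical_input
begin

lemma act_preserving:
  assumes "\<sigma> * \<sigma> = 1" "\<tau> * \<tau> = 1" "inj h"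
  shows "act (sign_map \<sigma> \<tau>) h \<in> P \<rightarrow>\<^sub>M P" "distr P P (act (sign_map \<sigma> \<tau>) h) = P"
proof -
  let ?A = "sign_map \<sigma> \<tau>"
  have sm: "step_map ?A q \<in> value_space \<rightarrow>\<^sub>M value_space" for q
    unfolding value_space_def step_map_def
    by (cases q) (auto intro!: measurable_Pair measurable_compose[OF measurable_snd])
  have 1: "step_map ?A q \<in> coord_law \<pi> (source_map h q) \<rightarrow>\<^sub>M coord_law \<pi> q" for q
    using sm measurable_cong_sets[OF sets_coord_law sets_coord_law] by blast
  have 2: "distr (coord_law \<pi> (source_map h q)) (coord_law \<pi> q) (step_map ?A q) = coord_law \<pi> q" for q
  proof -
    have "distr (coord_law \<pi> (source_map h q)) (coord_law \<pi> q) (step_map ?A q) =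
        distr (coord_law \<pi> (source_map h q)) value_space (step_map ?A q)"
      by (rule distr_cong) (simp_all add: sets_coord_law)
    also have "\<dots> = coord_law \<pi> q"
    proof (cases q)
      case (Inl i)
      have "(\<lambda>\<eta>. (\<eta>, 0)) \<in> \<pi> \<rightarrow>\<^sub>M value_space"
        using measurable_config_value measurable_cong_sets[OF sets_\<pi> refl] by blast
      then show ?thesis using Inl sm[of q]
        by (simp add: coord_law_def source_map_def distr_distr comp_def step_map_def)
    next
      case (Inr p)
      have m: "(\<lambda>s. ({}, s)) \<in> measure_pmf (pmf_of_set unit_steps) \<rightarrow>\<^sub>M value_space"
        "(\<lambda>s. ({}, s)) \<in> count_space UNIV \<rightarrow>\<^sub>M value_space"
        using measurable_step_value by simp_all
      \<comment> \<open>A sign change of coordinates permutes the four unit steps and so preserves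
        their uniform law.\<close>
      have "map_pmf ?A (pmf_of_set unit_steps) = pmf_of_set unit_steps"
        using map_pmf_of_set_inj[of ?A unit_steps] sign_map_unit_steps[OF assms(1,2)] unit_steps_facts by simp
      then have e: "distr (measure_pmf (pmf_of_set unit_steps)) (count_space UNIV) ?A = measure_pmf (pmf_of_set unit_steps)"
        by (metis map_pmf_rep_eq)
      obtain i j l where p: "p = (i, j, l)" by (cases p)
      have "distr (coord_law \<pi> (source_map h q)) value_space (step_map ?A q) =
          distr (measure_pmf (pmf_of_set unit_steps)) value_space (\<lambda>s. ({}, ?A s))"
        using Inr p sm[of q] m by (simp add: coord_law_def source_map_def distr_distr comp_def step_map_def)
      also have "\<dots> = distr (distr (measure_pmf (pmf_of_set unit_steps)) (count_space UNIV) ?A) value_space (\<lambda>s. ({}, s))"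
        using m by (subst distr_distr) (auto simp: comp_def)
      also have "\<dots> = coord_law \<pi> q" unfolding e by (simp add: coord_law_def Inr)
      finally show ?thesis .
    qed
    finally show ?thesis .
  qed
  have inj: "inj (source_map h)"
    using assms(3) by (auto simp: inj_def source_map_def split: sum.splits prod.splits)
  have eq: "act ?A h = (\<lambda>x q. step_map ?A q (x (source_map h q)))" by (simp add: act_def fun_eq_iff)
  show "act ?A h \<in> P \<rightarrow>\<^sub>M P" "distr P P (act ?A h) = P"
    unfolding eq using coordinate_map[OF inj 1 2] by auto
qed

text \<open>The trivial factors 1 present the translation literally as an instance of the general
  symmetry, so that facts about the latter can be rewritten into facts about
  \<open>shift\<close>.\<close>

definition shift :: "int \<Rightarrow> (index \<Rightarrow> real set \<times> site) \<Rightarrow> index \<Rightarrow> real set \<times> site" where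
  "shift k = act (sign_map 1 1) (\<lambda>i. 1 * (i - k))"

lemma shift_eq: "shift k x q = x (source_map (\<lambda>i. i - k) q)"
  by (cases q) (auto simp: shift_def act_def step_map_def sign_map_def)

sublocale shift: shift_action P shift
proof -
  have eq: "shift = (\<lambda>k x q. (\<lambda>k q v. v) k q (x ((\<lambda>k. source_map (\<lambda>i. i - k)) k q)))"
    by (auto simp: shift_eq fun_eq_iff)
  show "shift_action P shift"
    unfolding eq
  proof (rule shift_action_coordinates)
    show "inj (source_map (\<lambda>i. i - k))" for k :: int
      by (auto simp: inj_def source_map_def split: sum.splits prod.splits)
    have s: "coord_law \<pi> (source_map (\<lambda>i. i - k) q) = coord_law \<pi> q" for k q
      by (auto simp: coord_law_def source_map_def split: sum.splits)
    show "(\<lambda>v. v) \<in> coord_law \<pi> (source_map (\<lambda>i. i - k) q) \<rightarrow>\<^sub>M coord_law \<pi> q" for k q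
      unfolding s by simp
    show "distr (coord_law \<pi> (source_map (\<lambda>i. i - k) q)) (coord_law \<pi> q) (\<lambda>v. v) = coord_law \<pi> q" for k q
      unfolding s by (rule distr_id)
    show "(\<lambda>q. x (source_map (\<lambda>i. i - l) (source_map (\<lambda>i. i - k) q))) = (\<lambda>q. x (source_map (\<lambda>i. i - (k + l)) q))"
      for k l :: int and x :: "index \<Rightarrow> real set \<times> site"
      by (auto simp: source_map_def fun_eq_iff algebra_simps split: sum.splits)
    show "eventually (\<lambda>k. source_map (\<lambda>i. i - k) q \<noteq> q') (filtercomap abs at_top)" for q q'
    proof -
      \<comment> \<open>The level of the source owning a coordinate; the shift by \<open>k\<close>
        changes it by exactly \<open>k\<close>, so a fixed coordinate is hit only for bounded
        \<open>k\<close>.\<close>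
      define lev where "lev = (\<lambda>q :: index. case q of Inl i \<Rightarrow> i | Inr (i, j, l) \<Rightarrow> i)"
      have "source_map (\<lambda>i. i - k) q \<noteq> q'" if "\<bar>k\<bar> \<ge> \<bar>lev q\<bar> + \<bar>lev q'\<bar> + 1" for k
      proof -
        have "lev (source_map (\<lambda>i. i - k) q) = lev q - k"
          by (auto simp: lev_def source_map_def split: sum.splits)
        then show ?thesis using that by auto
      qed
      then show ?thesis unfolding eventually_filtercomap_at_top_linorder by blast
    qed
  qed
qed

section \<open>Almost sure regularity\<close>

text \<open>A finite configuration has an eventually constant count in \<open>{0..n}\<close>, while
  the Poisson probability of any fixed count tends to 0 as the interval grows.\<close>

lemma AE_infinite_points: "AE \<eta> in \<pi>. infinite \<eta>"
proof -
  have cm: "(\<lambda>\<eta>. card (\<eta> \<inter> {0..real n})) \<in> \<pi> \<rightarrow>\<^sub>M count_space UNIV" for n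
    by (subst measurable_cong_sets[OF sets_\<pi> refl]) (rule measurable_card_config, auto)
  have "AE \<eta> in \<pi>. \<not> (\<forall>n\<ge>m. card (\<eta> \<inter> {0..real n}) = k)" for m k :: nat
  proof -
    let ?D = "\<lambda>n::nat. {\<eta> \<in> space \<pi>. card (\<eta> \<inter> {0..real n}) = k}"
    let ?B = "{\<eta> \<in> space \<pi>. \<forall>n\<ge>m. card (\<eta> \<inter> {0..real n}) = k}"
    note [measurable] = cm
    have D: "?D n \<in> sets \<pi>" for n by measurable
    have B: "?B \<in> sets \<pi>" by measurable
    have "(\<lambda>n. exp (- real n) * real n ^ k / fact k) \<longlonglongrightarrow> 0"
    proof -
      have "((\<lambda>x::real. x ^ k / exp x) \<longlongrightarrow> 0) at_top" by (rule tendsto_power_div_exp_0)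
      then have "(\<lambda>n. real n ^ k / exp (real n)) \<longlonglongrightarrow> 0"
        by (rule filterlim_compose[OF _ filterlim_real_sequentially])
      then have "(\<lambda>n. real n ^ k / exp (real n) / fact k) \<longlonglongrightarrow> 0 / fact k" by (intro tendsto_divide) auto
      then show ?thesis by (simp add: exp_minus field_simps)
    qed
    moreover have "measure \<pi> (?D n) = exp (- real n) * real n ^ k / fact k" for n
      by (subst poisson_counts) auto
    ultimately have "(\<lambda>n. measure \<pi> (?D n)) \<longlonglongrightarrow> 0" by simp
    moreover have "\<forall>n\<ge>m. measure \<pi> ?B \<le> measure \<pi> (?D n)" using D by (intro allI impI pi.finite_measure_mono) auto
    ultimately have "measure \<pi> ?B \<le> 0" using LIMSEQ_le_const by blast
    then have "measure \<pi> ?B = 0" using measure_nonneg[of \<pi> ?B] by linarith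
    then have "AE \<eta> in \<pi>. \<eta> \<notin> ?B" using B by (simp add: pi.prob_eq_0)
    with AE_space show ?thesis by eventually_elim auto
  qed
  then have "AE \<eta> in \<pi>. \<forall>m k. \<not> (\<forall>n\<ge>m. card (\<eta> \<inter> {0..real n}) = k)" by (simp add: AE_all_countable)
  with AE_space show ?thesis
  proof eventually_elim
    case (elim \<eta>)
    show ?case
    proof
      assume fin: "finite \<eta>"
      obtain m :: nat where m: "Max (insert 0 \<eta>) \<le> real m" using real_arch_simple by blast
      have "\<eta> \<inter> {0..real n} = \<eta>" if "n \<ge> m" for n
      proof -
        have "t \<le> real n" if "t \<in> \<eta>" for t
        proof -
          have "t \<le> Max (insert 0 \<eta>)" using fin that by (intro Max_ge) auto
          also have "\<dots> \<le> real n" using m \<open>n \<ge> m\<close> by (meson of_nat_mono order_trans)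
          finally show ?thesis .
        qed
        then show ?thesis using elim(1) by (auto simp: space_\<pi> locally_finite_configs_def)
      qed
      then show False using elim(2)[rule_format, of m "card \<eta>"] by simp
    qed
  qed
qed

text \<open>Cut \<open>{0..t}\<close> into \<open>m\<close> intervals: by independence both
  processes meet a given one with probability at most \<open>(t/m)^2\<close>, hence some common one
  with probability at most \<open>t^2/m\<close>, which vanishes as \<open>m\<close> grows.\<close>

lemma AE_disjoint_points:
  assumes "i \<noteq> i'"
  shows "AE x in P. points_of x i \<inter> points_of x i' = {}"
proof -
  have "AE x in P. points_of x i \<inter> points_of x i' \<inter> {0..real t} = {}" for t :: nat
  proof -
    define B where "B m l = {real l * real t / real m..real (Suc l) * real t / real m}" for m l :: nat
    have B: "B m l \<in> sets borel" "bounded (B m l)" "B m l \<subseteq> {0..}" for m l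
      by (auto simp: B_def intro: order_trans[rotated])
    have len: "measure lborel (B m l) = real t / real m" if "m > 0" for m l
      using that by (simp add: B_def field_simps)
    define C where "C m l i = {x \<in> space P. card (points_of x i \<inter> B m l) \<noteq> 0}" for m l i
    have cm[measurable]: "(\<lambda>x. card (points_of x i \<inter> B m l)) \<in> P \<rightarrow>\<^sub>M count_space UNIV" for m l i
      by (rule measurable_compose[OF points_measurable measurable_card_config]) (use B in auto)
    have C: "C m l i \<in> sets P" and C0: "{x \<in> space P. card (points_of x i \<inter> B m l) = 0} \<in> sets P" for m l i
      unfolding C_def by measurable
    have "measure P (C m l i) \<le> real t / real m" if "m > 0" for m l i
    proof -
      have "measure P {x \<in> space P. card (points_of x i \<inter> B m l) = 0} = measure \<pi> {\<eta> \<in> space \<pi>. card (\<eta> \<inter> B m l) = 0}"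
      proof -
        have "{\<eta> \<in> space config_space. card (\<eta> \<inter> B m l) = 0} \<in> sets config_space"
          using measurable_sets[OF measurable_card_config[OF B(1,2)], of "{0}"]
          by (simp add: vimage_def Int_def conj_commute)
        then have "measure \<pi> {\<eta> \<in> space config_space. card (\<eta> \<inter> B m l) = 0} =
            measure P ((\<lambda>x. points_of x i) -` {\<eta> \<in> space config_space. card (\<eta> \<inter> B m l) = 0} \<inter> space P)"
          by (subst points_distr[of i, symmetric]) (rule measure_distr[OF points_measurable])
        also have "(\<lambda>x. points_of x i) -` {\<eta> \<in> space config_space. card (\<eta> \<inter> B m l) = 0} \<inter> space P =
            {x \<in> space P. card (points_of x i \<inter> B m l) = 0}"
          using measurable_space[OF points_measurable] by auto
        finally show ?thesis by (simp add: space_\<pi>)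
      qed
      also have "\<dots> = exp (- (real t / real m))" using poisson_counts[OF B, of m l 0] len[OF that] by simp
      finally have e: "measure P {x \<in> space P. card (points_of x i \<inter> B m l) = 0} = exp (- (real t / real m))" .
      have "C m l i = space P - {x \<in> space P. card (points_of x i \<inter> B m l) = 0}" by (auto simp: C_def)
      then have "measure P (C m l i) = 1 - exp (- (real t / real m))"
        by (simp only: P.prob_compl[OF C0] e)
      \<comment> \<open>The bound \<open>1 - exp (- u) \<le> u\<close> for the chance of at least
        one point.\<close>
      then show ?thesis using exp_ge_add_one_self[of "- (real t / real m)"] by simp
    qed
    note Cle = this
    have CC: "measure P (C m l i \<inter> C m l i') \<le> (real t / real m) ^ 2" if "m > 0" for m l
    proof -
      have "emeasure P (C m l i \<inter> C m l i') = emeasure P (C m l i) * emeasure P (C m l i')"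
        using assms by (intro disjoint_coordinates_indep[where J = "{Inl i}"] C) (auto simp: C_def points_of_def)
      then have "measure P (C m l i \<inter> C m l i') = measure P (C m l i) * measure P (C m l i')"
        by (simp add: P.emeasure_eq_measure ennreal_mult'[symmetric])
      also have "\<dots> \<le> (real t / real m) * (real t / real m)" by (intro mult_mono Cle that) auto
      finally show ?thesis by (simp add: power2_eq_square)
    qed
    define E where "E m = (\<Union>l<m. C m l i \<inter> C m l i')" for m
    have E: "E m \<in> sets P" for m unfolding E_def using C by auto
    have Ele: "measure P (E (Suc m)) \<le> real t ^ 2 / real (Suc m)" for m
    proof -
      have "measure P (E (Suc m)) \<le> (\<Sum>l<Suc m. measure P (C (Suc m) l i \<inter> C (Suc m) l i'))"
        unfolding E_def using C by (intro P.finite_measure_subadditive_finite) auto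
      also have "\<dots> \<le> (\<Sum>l<Suc m. (real t / real (Suc m)) ^ 2)" by (intro sum_mono CC) auto
      also have "\<dots> = real t ^ 2 / real (Suc m)" by (simp add: power2_eq_square field_simps del: of_nat_Suc)
      finally show ?thesis .
    qed
    have "measure P (\<Inter>m. E (Suc m)) \<le> 0"
    proof (rule LIMSEQ_le_const)
      show "(\<lambda>m. real t ^ 2 / real (Suc m)) \<longlonglongrightarrow> 0" by (rule LIMSEQ_Suc[OF lim_const_over_n])
      have "measure P (\<Inter>m. E (Suc m)) \<le> measure P (E (Suc m))" for m
        using E by (intro P.finite_measure_mono) auto
      then show "\<exists>N. \<forall>n\<ge>N. measure P (\<Inter>m. E (Suc m)) \<le> real t ^ 2 / real (Suc n)" using Ele order_trans by blast
    qed
    then have "measure P (\<Inter>m. E (Suc m)) = 0" using measure_nonneg[of P] by (simp add: antisym)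
    then have "AE x in P. x \<notin> (\<Inter>m. E (Suc m))" using E by (subst P.prob_eq_0[symmetric]) auto
    with AE_space show ?thesis
    proof eventually_elim
      case (elim x)
      show ?case
      proof (rule ccontr)
        assume "points_of x i \<inter> points_of x i' \<inter> {0..real t} \<noteq> {}"
        then obtain s where s: "s \<in> points_of x i" "s \<in> points_of x i'" "0 \<le> s" "s \<le> real t" by auto
        have "x \<in> E (Suc m)" for m
        proof -
          have "\<exists>l<Suc m. s \<in> B (Suc m) l"
          \<comment> \<open>The right end point is treated apart because the floor below would give
            the index \<open>Suc m\<close>, one too large.\<close>
          proof (cases "s = real t")
            case True
            then have "s \<in> B (Suc m) m" by (simp add: B_def field_simps)
            then show ?thesis by blast
          next
            case False
            then have st: "s < real t" "0 < real t" using s by auto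
            define l where "l = nat \<lfloor>s * real (Suc m) / real t\<rfloor>"
            have "real l \<le> s * real (Suc m) / real t" "s * real (Suc m) / real t < real l + 1"
              unfolding l_def using st s(3) by (auto simp: of_nat_nat)
            moreover from this(1) have "real l < real (Suc m)"
            proof (rule le_less_trans)
              show "s * real (Suc m) / real t < real (Suc m)" using st by (simp add: field_simps del: of_nat_Suc)
            qed
            ultimately have "s \<in> B (Suc m) l \<and> l < Suc m"
              using st by (simp add: B_def field_simps del: of_nat_Suc) (simp add: algebra_simps)
            then show ?thesis by blast
          qed
          then obtain l where l: "l < Suc m" "s \<in> B (Suc m) l" by blast
          have "finite (points_of x i \<inter> B (Suc m) l)" for i
          proof -
            have "points_of x i \<inter> B (Suc m) l \<subseteq> {r \<in> points_of x i. r \<le> real (Suc l) * real t / real (Suc m)}" by (auto simp: B_def)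
            then show ?thesis using point_space[OF elim(1), of i] unfolding locally_finite_configs_def
              by (blast intro: finite_subset)
          qed
          then have "x \<in> C (Suc m) l i \<inter> C (Suc m) l i'"
            using s l(2) elim(1) by (auto simp: C_def card_gt_0_iff)
          then show ?thesis using l(1) unfolding E_def by blast
        qed
        then show False using elim(2) by blast
      qed
    qed
  qed
  then have "AE x in P. \<forall>t::nat. points_of x i \<inter> points_of x i' \<inter> {0..real t} = {}" by (simp add: AE_all_countable)
  with AE_space show ?thesis
  proof eventually_elim
    case (elim x)
    show ?case
    proof (rule ccontr)
      assume "points_of x i \<inter> points_of x i' \<noteq> {}"
      then obtain s where s: "s \<in> points_of x i" "s \<in> points_of x i'" by auto
      have "0 \<le> s" using s point_space[OF elim(1), of i] by (auto simp: locally_finite_configs_def)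
      moreover obtain t :: nat where "s \<le> real t" using real_arch_simple by blast
      ultimately show False using s elim(2)[rule_format, of t] by auto
    qed
  qed
qed

lemma AE_regular: "AE x in P. regular x"
proof -
  have "AE x in P. \<forall>i. infinite (points_of x i)"
    using AE_points[OF AE_infinite_points] by (simp add: AE_all_countable)
  moreover have "AE x in P. \<forall>i i'. i \<noteq> i' \<longrightarrow> points_of x i \<inter> points_of x i' = {}"
    using AE_disjoint_points by (simp add: AE_all_countable)
  ultimately show ?thesis
    using AE_lattice_walks AE_space
    by eventually_elim (auto simp: regular_def admissible_def point_space)
qed

lemma AE_act:
  assumes "\<sigma> * \<sigma> = 1" "\<tau> * \<tau> = 1" "inj h" "AE x in P. Q x"
  shows "AE x in P. Q (act (sign_map \<sigma> \<tau>) h x)"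
  by (rule AE_distrD[OF act_preserving(1)[OF assms(1-3)]]) (simp only: act_preserving(2)[OF assms(1-3)] assms(4))

lemma AE_site_symmetry:
  fixes c :: int
  assumes "\<sigma> * \<sigma> = 1" "\<tau> * \<tau> = 1"
  defines "T \<equiv> act (sign_map \<sigma> \<tau>) (\<lambda>i. \<tau> * (i - c))"
  shows "T \<in> P \<rightarrow>\<^sub>M P" "distr P P T = P"
    "AE x in P. site_symmetry (points_of x) (walks_of x) (points_of (T x)) (walks_of (T x)) (site_map \<sigma> \<tau> c) (\<lambda>i. \<tau> * i + c) c"
proof -
  have "inj (\<lambda>i. \<tau> * (i - c))" using assms(2) by (auto simp: inj_def)
  note T = act_preserving[OF assms(1,2) this] AE_act[OF assms(1,2) this AE_regular]
  show "T \<in> P \<rightarrow>\<^sub>M P" "distr P P T = P" unfolding T_def by (rule T)+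
  show "AE x in P. site_symmetry (points_of x) (walks_of x) (points_of (T x)) (walks_of (T x)) (site_map \<sigma> \<tau> c) (\<lambda>i. \<tau> * i + c) c"
    unfolding T_def using T(3) AE_regular by eventually_elim (rule site_symmetry_act[OF assms(1,2)])
qed

end

section \<open>Empty levels have positive probability\<close>

text \<open>Together with the site at time \<open>k\<close>, the run of \<open>W\<close> steps meets
  \<open>W + 1\<close> distinct sites of the level, of which at most \<open>W\<close> are occupied.
  The exit thus happens during the run and on the level.\<close>

lemma right_run_settles:
  assumes "finite B" "card (B \<inter> level y) \<le> W" "s k \<in> level y" "\<And>k'. k' < k \<Longrightarrow> s k' \<in> B"
    and run: "\<And>l. k \<le> l \<Longrightarrow> l < k + W \<Longrightarrow> s (Suc l) = s l + (1, 0)"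
  shows "\<exists>k'. s k' \<in> level y \<and> first_exit s B k'"
proof -
  have s: "s (k + r) = s k + (int r, 0)" if "r \<le> W" for r
    using that by (induction r) (auto simp: run zero_prod_def[symmetric] add.assoc)
  then have lev: "r \<le> W \<Longrightarrow> s (k + r) \<in> level y" for r using assms(3) by (simp add: level_def)
  have "\<exists>r\<le>W. s (k + r) \<notin> B"
  proof (rule ccontr)
    assume "\<not> (\<exists>r\<le>W. s (k + r) \<notin> B)"
    then have "(\<lambda>r. s (k + r)) ` {..W} \<subseteq> B \<inter> level y" using lev by auto
    then have "card ((\<lambda>r. s (k + r)) ` {..W}) \<le> card (B \<inter> level y)" using assms(1) by (intro card_mono) auto
    moreover have "inj_on (\<lambda>r. s (k + r)) {..W}" by (auto simp: inj_on_def s)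
    ultimately show False using assms(2) by (simp add: card_image)
  qed
  then obtain r k' where r: "r \<le> W" "k' \<le> k + r" "first_exit s B k'" using first_exit_exists by metis
  then have "k \<le> k'" using assms(4)[of k'] by (auto simp: first_exit_def not_less[symmetric])
  then have "s k' \<in> level y" using lev[of "k' - k"] r by simp
  then show ?thesis using r by blast
qed

lemma walks_of_Suc: "walks_of x i j (Suc l) = walks_of x i j l + snd (x (Inr (i, j - 1, l)))"
  by (simp add: walks_of_def add.assoc)

abbreviation sched :: "nat \<Rightarrow> (index \<Rightarrow> real set \<times> site) \<Rightarrow> nat \<Rightarrow> (int \<times> nat) list" where
  "sched n x m \<equiv> schedule (points_of x) n [- int m..int m]"

context canonical_input
begin

definition mean_count :: "nat \<Rightarrow> ennreal" where
  "mean_count n = (\<integral>\<^sup>+ \<eta>. of_nat (npoints \<eta> n) \<partial>\<pi>)"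

lemma mean_count_finite: "mean_count n < \<top>"
proof -
  let ?f = "\<lambda>\<eta>. card (\<eta> \<inter> {0..real n})"
  let ?D = "\<lambda>k. {\<eta> \<in> space \<pi>. ?f \<eta> = k}"
  have [measurable]: "?f \<in> \<pi> \<rightarrow>\<^sub>M count_space UNIV"
    by (subst measurable_cong_sets[OF sets_\<pi> refl]) (rule measurable_card_config, auto)
  have D: "?D k \<in> sets \<pi>" for k
    using measurable_sets[OF \<open>?f \<in> \<pi> \<rightarrow>\<^sub>M count_space UNIV\<close>, of "{k}"]
    by (simp add: vimage_def Int_def conj_commute)
  have "mean_count n = (\<integral>\<^sup>+ \<eta>. (\<Sum>k. of_nat k * indicator (?D k) \<eta>) \<partial>\<pi>)"
    unfolding mean_count_def
  proof (rule nn_integral_cong)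
    fix \<eta> assume \<eta>: "\<eta> \<in> space \<pi>"
    have "(\<Sum>k. of_nat k * indicator (?D k) \<eta>) = (\<Sum>k\<in>{?f \<eta>}. of_nat k * indicator (?D k) \<eta> :: ennreal)"
      by (rule suminf_finite) (auto simp: indicator_def)
    also have "\<dots> = of_nat (?f \<eta>)" using \<eta> by simp
    also have "?f \<eta> = npoints \<eta> n" using \<eta> by (subst npoints_eq_card) (simp_all only: space_\<pi>)
    finally show "of_nat (npoints \<eta> n) = (\<Sum>k. of_nat k * indicator (?D k) \<eta> :: ennreal)" by (rule sym)
  qed
  also have "\<dots> = (\<Sum>k. of_nat k * emeasure \<pi> (?D k))"
    using D by (subst nn_integral_suminf) (auto simp: nn_integral_cmult_indicator)
  also have "\<dots> = (\<Sum>k. ennreal (real k * (exp (- real n) * real n ^ k / fact k)))"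
  proof (intro suminf_cong)
    fix k
    have "emeasure \<pi> (?D k) = ennreal (exp (- real n) * real n ^ k / fact k)"
      by (subst pi.emeasure_eq_measure, subst poisson_counts) auto
    then show "of_nat k * emeasure \<pi> (?D k) = ennreal (real k * (exp (- real n) * real n ^ k / fact k))"
      unfolding ennreal_of_nat_eq_real_of_nat by (simp only:) (rule ennreal_mult[symmetric], auto)
  qed
  also have "\<dots> < \<top>"
  proof -
    have "summable (\<lambda>k. exp (- real n) * (inverse (fact k) * (2 * real n) ^ k))"
      by (intro summable_mult summable_exp)
    then have "summable (\<lambda>k. real k * (exp (- real n) * real n ^ k / fact k))"
    proof (rule summable_comparison_test')
      fix k :: nat
      \<comment> \<open>Trades the factor \<open>k\<close> for a doubling of the parameter, which
        leaves an exponential series.\<close>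
      have "real k \<le> 2 ^ k" using less_exp[of k] by (metis less_imp_le of_nat_le_iff of_nat_numeral of_nat_power)
      then have "real k * (exp (- real n) * real n ^ k / fact k) \<le> 2 ^ k * (exp (- real n) * real n ^ k / fact k)"
        by (intro mult_right_mono) auto
      then show "norm (real k * (exp (- real n) * real n ^ k / fact k)) \<le> exp (- real n) * (inverse (fact k) * (2 * real n) ^ k)"
        by (simp add: power_mult_distrib field_simps)
    qed
    then show ?thesis by (subst suminf_ennreal2) auto
  qed
  finally show ?thesis .
qed

lemma mean_points: "(\<integral>\<^sup>+ x. of_nat (npoints (points_of x i) n) \<partial>P) = mean_count n"
proof -
  have "mean_count n = (\<integral>\<^sup>+ \<eta>. of_nat (npoints \<eta> n) \<partial>distr P config_space (\<lambda>x. points_of x i))"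
    by (simp only: points_distr mean_count_def)
  also have "\<dots> = (\<integral>\<^sup>+ x. of_nat (npoints (points_of x i) n) \<partial>P)"
    by (rule nn_integral_distr[OF points_measurable]) measurable
  finally show ?thesis ..
qed

lemma window_measurable [measurable]: "(\<lambda>x. window n x is) \<in> P \<rightarrow>\<^sub>M forest_space"
  unfolding window_def by (rule measurable_window[OF points_measurable walks_measurable])

lemma window_finite: "finite (pverts (window n x is))"
  by (simp add: window_def grow_finite)

lemma card_window_measurable [measurable]:
  "(\<lambda>x. card (pverts (window n x is) \<inter> R)) \<in> P \<rightarrow>\<^sub>M count_space UNIV"
proof (rule measurable_card_verts)
  show "Measurable.pred P (\<lambda>x. v \<in> pverts (window n x is) \<inter> R)" for v
  proof -
    have "Measurable.pred P (\<lambda>x. v \<in> pverts (window n x is) \<and> v \<in> R)" by measurable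
    then show ?thesis by simp
  qed
qed (simp add: window_finite)

lemma mean_window_card:
  assumes "distinct is"
  shows "(\<integral>\<^sup>+ x. of_nat (card (pverts (window n x is))) \<partial>P) \<le> of_nat (length is) * mean_count n"
proof -
  have "AE x in P. (of_nat (card (pverts (window n x is))) :: ennreal) \<le> (\<Sum>i\<in>set is. of_nat (npoints (points_of x i) n))"
    using AE_regular
  proof eventually_elim
    case (elim x)
    have "card (pverts (window n x is)) \<le> length (schedule (points_of x) n is)"
      unfolding window_def by (rule card_grow)
    also have "\<dots> = card (set (schedule (points_of x) n is))"
      using schedule_distinct[OF assms] by (simp add: distinct_card)
    also have "set (schedule (points_of x) n is) = Sigma (set is) (\<lambda>i. {1..npoints (points_of x i) n})"
      using elim by (auto simp: set_schedule regular_def)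
    also have "card \<dots> = (\<Sum>i\<in>set is. npoints (points_of x i) n)" by (subst card_SigmaI) auto
    finally have "(of_nat (card (pverts (window n x is))) :: ennreal) \<le> of_nat (\<Sum>i\<in>set is. npoints (points_of x i) n)"
      by (rule of_nat_mono)
    then show ?case by simp
  qed
  then have "(\<integral>\<^sup>+ x. of_nat (card (pverts (window n x is))) \<partial>P) \<le> (\<integral>\<^sup>+ x. (\<Sum>i\<in>set is. of_nat (npoints (points_of x i) n)) \<partial>P)"
    by (rule nn_integral_mono_AE)
  also have "\<dots> = (\<Sum>i\<in>set is. \<integral>\<^sup>+ x. of_nat (npoints (points_of x i) n) \<partial>P)"
    using points_measurable by (intro nn_integral_sum) measurable
  also have "\<dots> = of_nat (length is) * mean_count n" using assms by (simp add: mean_points distinct_card)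
  finally show ?thesis .
qed

lemma site_map_vshift: "site_map 1 1 = vshift"
  by (auto simp: site_map_def vshift_def fun_eq_iff)

lemma AE_shift_symmetry:
  "AE x in P. site_symmetry (points_of x) (walks_of x) (points_of (shift k x)) (walks_of (shift k x)) (vshift k) (\<lambda>i. i + k) k"
  using AE_site_symmetry(3)[of 1 1 k] unfolding shift_def site_map_vshift by simp

lemma level_count_shift:
  "(\<integral>\<^sup>+ x. of_nat (card (pverts (window n x [a + k..b + k]) \<inter> level (y + k))) \<partial>P) =
   (\<integral>\<^sup>+ x. of_nat (card (pverts (window n x [a..b]) \<inter> level y)) \<partial>P)"
proof -
  let ?F = "\<lambda>x. of_nat (card (pverts (window n x [a + k..b + k]) \<inter> level (y + k))) :: ennreal"
  have F: "?F \<in> borel_measurable P" by measurable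
  have "(\<integral>\<^sup>+ x. ?F x \<partial>P) = (\<integral>\<^sup>+ x. ?F x \<partial>distr P P (shift k))" by (simp only: shift.T_preserving)
  also have "\<dots> = (\<integral>\<^sup>+ x. ?F (shift k x) \<partial>P)"
    by (rule nn_integral_distr[OF shift.T_measurable]) (use F in simp)
  also have "\<dots> = (\<integral>\<^sup>+ x. of_nat (card (pverts (window n x [a..b]) \<inter> level y)) \<partial>P)"
  proof (rule nn_integral_cong_AE)
    show "AE x in P. ?F (shift k x) = of_nat (card (pverts (window n x [a..b]) \<inter> level y))"
      using AE_shift_symmetry[of k]
    proof eventually_elim
      case (elim x)
      have "(\<lambda>i. i + k) ` {a..b} = {a + k..b + k}" by simp
      then have "window n (shift k x) [a + k..b + k] = graph_image (vshift k) (window n x [a..b])"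
        unfolding window_def by (intro site_symmetry.grow_window_image[OF elim]) auto
      then have "pverts (window n (shift k x) [a + k..b + k]) \<inter> level (y + k) =
          vshift k ` (pverts (window n x [a..b]) \<inter> level y)"
        by (auto simp: graph_image_def level_def vshift_def)
      moreover have "inj (vshift k)" by (auto simp: inj_def vshift_def)
      ultimately show ?case by (simp add: card_image inj_on_subset)
    qed
  qed
  finally show ?thesis .
qed

text \<open>Each of the \<open>2 L + 1\<close> central levels of the window \<open>[0, 4 L]\<close> receives at least as many sites
  as level \<open>0\<close> of the window \<open>[-L, L]\<close>.\<close>

lemma mean_level_bound:
  "(\<integral>\<^sup>+ x. of_nat (card (pverts (window n x [- int L..int L]) \<inter> level 0)) \<partial>P) \<le> 2 * mean_count n"
proof -
  let ?e = "\<integral>\<^sup>+ x. of_nat (card (pverts (window n x [- int L..int L]) \<inter> level 0)) \<partial>P"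
  \<comment> \<open>For these heights the window of radius \<open>L\<close> around the level is
    contained in \<open>{0..4 * L}\<close>.\<close>
  let ?Y = "{int L..3 * int L}"
  have "of_nat (2 * L + 1) * ?e = (\<Sum>y\<in>?Y. \<integral>\<^sup>+ x. of_nat (card (pverts (window n x [- int L + y..int L + y]) \<inter> level (0 + y))) \<partial>P)"
    unfolding level_count_shift by (simp add: nat_add_distrib nat_mult_distrib)
  also have "\<dots> = (\<integral>\<^sup>+ x. (\<Sum>y\<in>?Y. of_nat (card (pverts (window n x [- int L + y..int L + y]) \<inter> level (0 + y)))) \<partial>P)"
    by (intro nn_integral_sum[symmetric]) measurable
  also have "\<dots> \<le> (\<integral>\<^sup>+ x. of_nat (card (pverts (window n x [0..4 * int L]))) \<partial>P)"
  proof (rule nn_integral_mono_AE)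
    show "AE x in P. (\<Sum>y\<in>?Y. of_nat (card (pverts (window n x [- int L + y..int L + y]) \<inter> level (0 + y)))) \<le>
       (of_nat (card (pverts (window n x [0..4 * int L]))) :: ennreal)"
      using AE_regular
    proof eventually_elim
      case (elim x)
      let ?A = "pverts (window n x [0..4 * int L])"
      have "(\<Sum>y\<in>?Y. card (pverts (window n x [- int L + y..int L + y]) \<inter> level (0 + y))) \<le> (\<Sum>y\<in>?Y. card (?A \<inter> level y))"
      proof (rule sum_mono)
        fix y assume "y \<in> ?Y"
        then have "pverts (window n x [- int L + y..int L + y]) \<subseteq> ?A"
          unfolding window_def using elim by (intro grow_window_mono) (auto simp: regular_def)
        then show "card (pverts (window n x [- int L + y..int L + y]) \<inter> level (0 + y)) \<le> card (?A \<inter> level y)"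
          using window_finite by (intro card_mono) auto
      qed
      also have "\<dots> = card (\<Union>y\<in>?Y. ?A \<inter> level y)"
        using window_finite by (intro card_UN_disjoint[symmetric]) (auto simp: level_def)
      also have "\<dots> \<le> card ?A" using window_finite by (intro card_mono) auto
      finally have "of_nat (\<Sum>y\<in>?Y. card (pverts (window n x [- int L + y..int L + y]) \<inter> level (0 + y))) \<le> (of_nat (card ?A) :: ennreal)"
        by (rule of_nat_mono)
      then show ?case by simp
    qed
  qed
  also have "\<dots> \<le> of_nat (length [0..4 * int L]) * mean_count n" by (rule mean_window_card) simp
  \<comment> \<open>Origin of the factor 2: the \<open>4 * L + 1\<close> sources are at most twice
    the \<open>2 * L + 1\<close> central levels.\<close>
  also have "\<dots> \<le> of_nat (2 * (2 * L + 1)) * mean_count n"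
    by (intro mult_right_mono of_nat_mono) auto
  also have "\<dots> = of_nat (2 * L + 1) * (2 * mean_count n)"
    by (simp only: of_nat_mult of_nat_numeral mult.left_commute mult.assoc)
  finally have le: "of_nat (2 * L + 1) * ?e \<le> of_nat (2 * L + 1) * (2 * mean_count n)" .
  have "of_nat (2 * L + 1) \<noteq> (0 :: ennreal)" by (simp only: of_nat_eq_0_iff)
  then show ?thesis using le ennreal_mult_le_mult_iff[OF _ ennreal_of_nat_neq_top] by blast
qed

text \<open>The counts increase with the window, so monotone convergence bounds the mean of their
  supremum by the uniform bound, and the supremum is almost surely finite.\<close>

lemma AE_level_bounded: "AE x in P. \<exists>W. \<forall>m. card (pverts (window n x [- int m..int m]) \<inter> level 0) \<le> W"
proof -
  let ?f = "\<lambda>m x. of_nat (card (pverts (window n x [- int m..int m]) \<inter> level 0)) :: ennreal"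
  have "(\<integral>\<^sup>+ x. (SUP m. ?f m x) \<partial>P) = (SUP m. \<integral>\<^sup>+ x. ?f m x \<partial>P)"
  proof (rule nn_integral_monotone_convergence_SUP_AE)
    show "AE x in P. ?f m x \<le> ?f (Suc m) x" for m
      using AE_regular
    proof eventually_elim
      case (elim x)
      have "pverts (window n x [- int m..int m]) \<subseteq> pverts (window n x [- int (Suc m)..int (Suc m)])"
        unfolding window_def using elim by (intro grow_window_mono) (auto simp: regular_def)
      then show ?case using window_finite by (intro of_nat_mono card_mono) auto
    qed
  qed measurable
  also have "\<dots> \<le> 2 * mean_count n" by (intro SUP_least mean_level_bound)
  also have "\<dots> < \<top>" using mean_count_finite by (simp add: ennreal_mult_less_top)
  finally have "AE x in P. (SUP m. ?f m x) \<noteq> \<infinity>"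
    by (intro nn_integral_PInf_AE) (auto simp: less_top[symmetric])
  then show ?thesis
  proof eventually_elim
    case (elim x)
    then have "(SUP m. ?f m x) < \<top>" unfolding infinity_ennreal_def by (rule less_top[THEN iffD1])
    then obtain W where W: "(SUP m. ?f m x) < of_nat W" using ennreal_Ex_less_of_nat by blast
    have "card (pverts (window n x [- int m..int m]) \<inter> level 0) \<le> W" for m
    proof -
      have "?f m x \<le> (SUP m. ?f m x)" by (rule SUP_upper) simp
      then have "?f m x < of_nat W" using W by (rule le_less_trans)
      then show ?thesis by simp
    qed
    then show ?case by blast
  qed
qed

section \<open>Visits to level 0 and the probability of settling there\<close>

definition previous :: "nat \<Rightarrow> nat \<Rightarrow> int \<times> nat \<Rightarrow> (index \<Rightarrow> real set \<times> site) \<Rightarrow> site_graph" where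
  "previous n m p x = grow (walks_of x) (before p (sched n x m))"

text \<open>With the time \<open>k\<close> of the first visit fixed, this event depends only on the
  point processes, on the other walks and on the steps of \<open>p\<close> before \<open>k\<close>.
  The steps from \<open>k\<close> on remain fresh, and different \<open>k\<close> give disjoint
  events.\<close>

definition first_visit :: "nat \<Rightarrow> nat \<Rightarrow> nat \<Rightarrow> int \<times> nat \<Rightarrow> nat \<Rightarrow> (index \<Rightarrow> real set \<times> site) set" where
  "first_visit n m W p k = {x \<in> space P. p \<in> set (sched n x m) \<and>
     (\<forall>k'. k' < k \<longrightarrow> walk_of (walks_of x) p k' \<notin> level 0 \<and> walk_of (walks_of x) p k' \<in> pverts (previous n m p x)) \<and>
     walk_of (walks_of x) p k \<in> level 0 \<and> card (pverts (previous n m p x) \<inter> level 0) \<le> W}"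

definition right_run :: "nat \<Rightarrow> int \<times> nat \<Rightarrow> nat \<Rightarrow> (index \<Rightarrow> real set \<times> site) set" where
  "right_run W p k = {x \<in> space P. \<forall>q\<in>(\<lambda>l. Inr (fst p, snd p - 1, l)) ` {k..<k + W}. snd (x q) = (1, 0)}"

definition settle_event :: "nat \<Rightarrow> nat \<Rightarrow> int \<times> nat \<Rightarrow> (index \<Rightarrow> real set \<times> site) set" where
  "settle_event n m p = {x \<in> space P. p \<in> settlers (walks_of x) (level 0) (sched n x m)}"

lemma sched_measurable [measurable]: "(\<lambda>x. sched n x m) \<in> P \<rightarrow>\<^sub>M count_space UNIV"
  by (rule measurable_schedule[OF points_measurable])

lemma previous_measurable [measurable]: "previous n m p \<in> P \<rightarrow>\<^sub>M forest_space"
  unfolding previous_def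
proof (rule measurable_grow_random[OF walks_measurable])
  show "(\<lambda>x. before p (sched n x m)) \<in> P \<rightarrow>\<^sub>M count_space UNIV"
    by (rule measurable_compose[OF sched_measurable]) simp
  show "1 \<le> snd q" if "q \<in> set (before p (sched n x m))" for x q
    using that schedule_labels(2) set_takeWhileD unfolding before_def by fast
qed

lemma walk_site_measurable [measurable]: "(\<lambda>x. walks_of x i j k) \<in> P \<rightarrow>\<^sub>M count_space UNIV"
  by (rule measurable_walk[OF walks_measurable])

lemma previous_site_measurable [measurable]:
  "Measurable.pred P (\<lambda>x. walks_of x i j k \<in> pverts (previous n m p x))"
  by (rule measurable_site_in_pverts) measurable

lemma sched_member_measurable [measurable]: "Measurable.pred P (\<lambda>x. p \<in> set (sched n x m))"
  by (rule measurable_compose[OF sched_measurable]) simp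

lemma level_measurable [measurable]: "Measurable.pred P (\<lambda>x. walks_of x i j k \<in> R)"
  by (rule measurable_compose[OF walk_site_measurable]) simp

lemma first_visit_sets: "first_visit n m W p k \<in> sets P"
proof -
  have [measurable]: "(\<lambda>x. card (pverts (previous n m p x) \<inter> level 0)) \<in> P \<rightarrow>\<^sub>M count_space UNIV"
  proof (rule measurable_card_verts)
    show "Measurable.pred P (\<lambda>x. v \<in> pverts (previous n m p x) \<inter> level 0)" for v
    proof -
      have "Measurable.pred P (\<lambda>x. v \<in> pverts (previous n m p x) \<and> v \<in> level 0)" by measurable
      then show ?thesis by simp
    qed
  qed (simp add: previous_def grow_finite)
  show ?thesis unfolding first_visit_def by measurable
qed

lemma settle_event_sets: "settle_event n m p \<in> sets P"
proof -
  have [measurable]: "Measurable.pred P (\<lambda>x. first_exit (walk_of (walks_of x) p) (pverts (previous n m p x)) k)" for k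
    by (rule measurable_first_exit[OF previous_measurable walks_measurable])
  show ?thesis unfolding settle_event_def settlers_def previous_def[symmetric] mem_Collect_eq by measurable
qed

lemma steps_prob:
  assumes "finite J" "s \<in> unit_steps"
  shows "{x \<in> space P. \<forall>p\<in>J. snd (x (Inr p)) = s} \<in> sets P"
    "emeasure P {x \<in> space P. \<forall>p\<in>J. snd (x (Inr p)) = s} = (1 / 4) ^ card J"
proof -
  let ?J = "Inr ` J :: index set"
  let ?A = "{v \<in> space value_space. snd v = s}"
  have A: "?A \<in> sets (coord_law \<pi> q)" for q
    unfolding sets_coord_law using measurable_sets[OF measurable_snd_value, of "{s}"]
    by (simp add: vimage_def Int_def conj_commute)
  have eq: "{x \<in> space P. \<forall>p\<in>J. snd (x (Inr p)) = s} = {x \<in> space P. \<forall>q\<in>?J. x q \<in> ?A}"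
    by (auto simp: space_PiM PiE_iff space_coord_law space_value_space)
  have "finite ?J" using assms by simp
  then show "{x \<in> space P. \<forall>p\<in>J. snd (x (Inr p)) = s} \<in> sets P" unfolding eq using A by (rule cylinder_sets)
  have "emeasure (coord_law \<pi> (Inr p)) ?A = 1 / 4" for p
  proof -
    have 2: "(\<lambda>s. ({}, s)) \<in> measure_pmf (pmf_of_set unit_steps) \<rightarrow>\<^sub>M value_space"
      using measurable_step_value by simp
    have "emeasure (coord_law \<pi> (Inr p)) ?A = emeasure (measure_pmf (pmf_of_set unit_steps)) {s}"
      using A[of "Inr p"] unfolding coord_law_def sum.case
      by (subst emeasure_distr[OF 2]) (auto simp: space_value_space empty_config intro!: arg_cong[where f = "emeasure _"])
    also have "\<dots> = ennreal (1 / 4)"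
      using unit_steps_facts assms(2) by (simp add: emeasure_pmf_single)
    also have "\<dots> = 1 / 4" by (simp add: ennreal_divide_numeral[symmetric])
    finally show ?thesis .
  qed
  then have "(\<Prod>q\<in>?J. emeasure (coord_law \<pi> q) ?A) = (\<Prod>q\<in>?J. 1 / 4)" by (intro prod.cong) auto
  also have "\<dots> = (1 / 4) ^ card J" by (simp add: card_image)
  finally show "emeasure P {x \<in> space P. \<forall>p\<in>J. snd (x (Inr p)) = s} = (1 / 4) ^ card J"
    unfolding eq using A assms(1) by (subst emeasure_PiM_Collect) auto
qed

lemma right_run_prob: "right_run W p k \<in> sets P" "emeasure P (right_run W p k) = (1 / 4) ^ W"
proof -
  let ?J = "(\<lambda>l. (fst p, snd p - 1, l)) ` {k..<k + W}"
  have "right_run W p k = {x \<in> space P. \<forall>q\<in>?J. snd (x (Inr q)) = (1, 0)}" by (auto simp: right_run_def)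
  moreover have "card ?J = W" by (simp add: card_image inj_on_def)
  moreover have "(1, 0) \<in> unit_steps" by (simp add: unit_steps_def)
  ultimately show "right_run W p k \<in> sets P" "emeasure P (right_run W p k) = (1 / 4) ^ W"
    using steps_prob[of ?J "(1, 0)"] by simp_all
qed

text \<open>The two events use disjoint coordinates, and a prescribed run of \<open>W\<close> steps
  has probability \<open>(1 / 4) ^ W\<close>. Fixing \<open>k\<close> avoids a Markov property at a
  random time.\<close>

lemma first_visit_indep:
  "emeasure P (first_visit n m W p k) = 4 ^ W * emeasure P (first_visit n m W p k \<inter> right_run W p k)"
proof -
  let ?J = "(\<lambda>l. Inr (fst p, snd p - 1, l) :: index) ` {k..<k + W}"
  have "emeasure P (right_run W p k \<inter> first_visit n m W p k) = emeasure P (right_run W p k) * emeasure P (first_visit n m W p k)"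
  proof (rule disjoint_coordinates_indep[where J = ?J, OF right_run_prob(1) first_visit_sets])
    show "x \<in> right_run W p k \<longleftrightarrow> y \<in> right_run W p k"
      if "x \<in> space P" "y \<in> space P" and eq: "\<And>q. q \<in> ?J \<Longrightarrow> x q = y q" for x y
      using that(1,2) eq by (simp add: right_run_def)
    have imp: "y \<in> first_visit n m W p k"
      if "x \<in> first_visit n m W p k" "y \<in> space P" and eq: "\<And>q. q \<notin> ?J \<Longrightarrow> x q = y q" for x y
    proof -
      have "x (Inl i) = y (Inl i)" for i by (rule eq) auto
      then have pts: "points_of x = points_of y" by (simp add: points_of_def fun_eq_iff)
      have p: "p \<in> set (sched n x m)" using that(1) by (simp add: first_visit_def)
      have wq: "walk_of (walks_of x) q = walk_of (walks_of y) q" if "q \<noteq> p" "q \<in> set (sched n x m)" for q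
      proof -
        \<comment> \<open>Truncated subtraction of 1 is injective only on positive labels; this is
          what separates the coordinates of \<open>q\<close> from those of \<open>p\<close>.\<close>
        have "1 \<le> snd p" "1 \<le> snd q" using p that schedule_labels(2) by blast+
        then have "Inr (fst q, snd q - 1, l) \<notin> ?J" for l
          using that(1) by (cases p; cases q) auto
        then show ?thesis by (auto simp: walks_of_def fun_eq_iff eq)
      qed
      have wp: "walk_of (walks_of x) p k' = walk_of (walks_of y) p k'" if "k' \<le> k" for k'
      proof -
        have "Inr (fst p, snd p - 1, l) \<notin> ?J" if "l < k'" for l using that \<open>k' \<le> k\<close> by auto
        then show ?thesis unfolding walks_of_def using eq by (intro arg_cong2[where f = "(+)"] refl sum.cong) auto
      qed
      have "previous n m p x = previous n m p y"
        unfolding previous_def pts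
      proof (rule grow_cong, rule wq)
        fix q assume q: "q \<in> set (before p (sched n y m))"
        then show "q \<noteq> p" using before_notin by metis
        show "q \<in> set (sched n x m)" using q set_takeWhileD unfolding before_def pts by fast
      qed
      moreover have "p \<in> set (sched n y m)" using p unfolding pts .
      ultimately show ?thesis using that(1,2) wp unfolding first_visit_def by simp
    qed
    show "x \<in> first_visit n m W p k \<longleftrightarrow> y \<in> first_visit n m W p k"
      if "x \<in> space P" "y \<in> space P" and eq: "\<And>q. q \<notin> ?J \<Longrightarrow> x q = y q" for x y
      using imp[of x y] imp[of y x] that(1,2) eq by metis
  qed
  then have "4 ^ W * emeasure P (first_visit n m W p k \<inter> right_run W p k) =
      (4 ^ W * (1 / 4) ^ W) * emeasure P (first_visit n m W p k)"
    by (simp add: right_run_prob(2) Int_commute mult.assoc)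
  also have "4 ^ W * (1 / 4) ^ W = (1 :: ennreal)"
  proof -
    have "(4::ennreal) * (1 / 4) = 1" by (simp add: ennreal_times_divide ennreal_divide_self)
    then show ?thesis by (simp add: power_mult_distrib[symmetric])
  qed
  finally show ?thesis by simp
qed

lemma first_visit_settles: "first_visit n m W p k \<inter> right_run W p k \<subseteq> settle_event n m p"
proof
  fix x assume x: "x \<in> first_visit n m W p k \<inter> right_run W p k"
  have "\<exists>k'. walk_of (walks_of x) p k' \<in> level 0 \<and> first_exit (walk_of (walks_of x) p) (pverts (previous n m p x)) k'"
  proof (rule right_run_settles)
    show "finite (pverts (previous n m p x))" by (simp add: previous_def grow_finite)
    show "walk_of (walks_of x) p (Suc l) = walk_of (walks_of x) p l + (1, 0)" if "k \<le> l" "l < k + W" for l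
      using x that by (simp add: walks_of_Suc right_run_def)
  qed (use x in \<open>auto simp: first_visit_def\<close>)
  then show "x \<in> settle_event n m p"
    using x by (auto simp: settle_event_def settlers_def first_visit_def previous_def)
qed

lemma first_visit_disjoint: "disjoint_family (first_visit n m W p)"
proof -
  have "first_visit n m W p k \<inter> first_visit n m W p k' = {}" if "k < k'" for k k'
    using that by (auto simp: first_visit_def)
  then show ?thesis by (auto simp: disjoint_family_on_def) (metis disjoint_iff linorder_neqE_nat)
qed

text \<open>Each visit leads to settling with conditional probability at least
  \<open>4 ^ (- W)\<close>, and settlers are counted by the occupied sites of level 0. The bound is
  uniform in \<open>Q\<close> and in the window \<open>m\<close>, as summation over all labels
  requires.\<close>

lemma visit_sum_bound:
  assumes "finite Q"
  shows "(\<Sum>p\<in>Q. emeasure P (\<Union>k. first_visit n m W p k)) \<le> 4 ^ W * (2 * mean_count n)"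
proof -
  have "(\<Sum>p\<in>Q. emeasure P (\<Union>k. first_visit n m W p k)) \<le> (\<Sum>p\<in>Q. 4 ^ W * emeasure P (settle_event n m p))"
  proof (rule sum_mono)
    fix p
    let ?V = "first_visit n m W p" and ?D = "right_run W p"
    have V: "?V k \<in> sets P" for k by (rule first_visit_sets)
    have "emeasure P (\<Union>k. ?V k) = (\<Sum>k. emeasure P (?V k))"
      by (rule suminf_emeasure[symmetric]) (use V first_visit_disjoint in blast)+
    also have "\<dots> = (\<Sum>k. 4 ^ W * emeasure P (?V k \<inter> ?D k))" by (simp only: first_visit_indep[symmetric])
    also have "\<dots> = 4 ^ W * (\<Sum>k. emeasure P (?V k \<inter> ?D k))" by (rule ennreal_suminf_cmult)
    finally have eq: "emeasure P (\<Union>k. ?V k) = 4 ^ W * (\<Sum>k. emeasure P (?V k \<inter> ?D k))" .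
    have "(\<Sum>k. emeasure P (?V k \<inter> ?D k)) = emeasure P (\<Union>k. ?V k \<inter> ?D k)"
    proof (rule suminf_emeasure)
      show "range (\<lambda>k. ?V k \<inter> ?D k) \<subseteq> sets P" using V right_run_prob(1) by blast
      show "disjoint_family (\<lambda>k. ?V k \<inter> ?D k)"
        using first_visit_disjoint[of n m W p] unfolding disjoint_family_on_def by blast
    qed
    also have "\<dots> \<le> emeasure P (settle_event n m p)"
      by (intro emeasure_mono UN_least first_visit_settles settle_event_sets)
    finally show "emeasure P (\<Union>k. ?V k) \<le> 4 ^ W * emeasure P (settle_event n m p)"
      unfolding eq by (rule mult_left_mono) simp
  qed
  also have "\<dots> = 4 ^ W * (\<Sum>p\<in>Q. emeasure P (settle_event n m p))" by (simp add: sum_distrib_left)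
  finally have le: "(\<Sum>p\<in>Q. emeasure P (\<Union>k. first_visit n m W p k)) \<le> 4 ^ W * (\<Sum>p\<in>Q. emeasure P (settle_event n m p))" .
  have "(\<Sum>p\<in>Q. emeasure P (settle_event n m p)) = (\<integral>\<^sup>+ x. (\<Sum>p\<in>Q. indicator (settle_event n m p) x) \<partial>P)"
    using settle_event_sets by (subst nn_integral_sum) auto
  also have "\<dots> \<le> (\<integral>\<^sup>+ x. of_nat (card (pverts (window n x [- int m..int m]) \<inter> level 0)) \<partial>P)"
  proof (rule nn_integral_mono)
    fix x assume x: "x \<in> space P"
    let ?S = "settlers (walks_of x) (level 0) (sched n x m)"
    have "(\<Sum>p\<in>Q. indicator (settle_event n m p) x :: ennreal) = of_nat (card (Q \<inter> ?S))"
      using assms x by (simp add: settle_event_def indicator_def sum.If_cases Int_def)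
    also have "card (Q \<inter> ?S) \<le> card ?S" by (intro card_mono) (auto simp: settlers_def)
    also have "card ?S = card (pverts (window n x [- int m..int m]) \<inter> level 0)"
      unfolding window_def by (rule card_settlers) (simp add: schedule_distinct)
    finally show "(\<Sum>p\<in>Q. indicator (settle_event n m p) x :: ennreal) \<le> of_nat (card (pverts (window n x [- int m..int m]) \<inter> level 0))"
      by simp
  qed
  also have "\<dots> \<le> 2 * mean_count n" by (rule mean_level_bound)
  finally show ?thesis by (intro order_trans[OF le] mult_left_mono) simp_all
qed

end

lemma bij_nat_labels: obtains e :: "nat \<Rightarrow> int \<times> nat" where "bij e"
proof -
  have "infinite (UNIV :: (int \<times> nat) set)"
    using infinite_iff_countable_subset[of "UNIV :: (int \<times> nat) set"]
    by (auto intro!: exI[of _ "\<lambda>n::nat. (0::int, n)"] simp: inj_def)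
  then show ?thesis using that bij_betw_from_nat_into[of "UNIV :: (int \<times> nat) set"] by simp
qed

definition far_sources :: "nat \<Rightarrow> nat \<Rightarrow> int list" where
  "far_sources L m = filter (\<lambda>i. int L < \<bar>i\<bar>) [- int m..int m]"

lemma far_schedule:
  assumes "admissible \<eta>"
  shows "schedule \<eta> n (far_sources L m) = filter (\<lambda>p. int L < \<bar>fst p\<bar>) (schedule \<eta> n [- int m..int m])"
  unfolding far_sources_def by (rule schedule_filter[OF assms]) auto

context canonical_input
begin

text \<open>On \<open>G W\<close> the visiting probabilities, taken over all windows, are summable
  over labels, so Borel-Cantelli leaves finitely many visitors. By \<open>AE_level_bounded\<close>
  the events \<open>G W\<close> cover almost everything.\<close>

lemma AE_finite_visitors: "AE x in P. finite (\<Union>m. visitors (walks_of x) (level 0) (sched n x m))"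
proof -
  define G where "G W = {x \<in> space P. \<forall>m. card (pverts (window n x [- int m..int m]) \<inter> level 0) \<le> W}" for W
  define Vis where "Vis m p = {x \<in> space P. p \<in> visitors (walks_of x) (level 0) (sched n x m)}" for m p
  have G: "G W \<in> sets P" for W unfolding G_def by measurable
  have Vis: "Vis m p \<in> sets P" for m p
  proof -
    have "{x \<in> space P. p \<in> set (sched n x m) \<and> (\<exists>k. walk_of (walks_of x) p k \<in> level 0 \<and>
        (\<forall>k'. k' < k \<longrightarrow> walk_of (walks_of x) p k' \<in> pverts (previous n m p x)))} \<in> sets P"
      by measurable
    then show ?thesis unfolding Vis_def visitors_def previous_def mem_Collect_eq .
  qed
  have "AE x in P. x \<in> G W \<longrightarrow> finite (\<Union>m. visitors (walks_of x) (level 0) (sched n x m))" for W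
  proof -
    \<comment> \<open>The union over smaller windows makes \<open>U p\<close> increasing everywhere;
      visits themselves grow with the window only for regular inputs.\<close>
    define U where "U p m = (\<Union>m'\<le>m. Vis m' p) \<inter> G W" for p m
    have U: "U p m \<in> sets P" for p m unfolding U_def using Vis G by auto
    define b where "b = enn2real (4 ^ W * (2 * mean_count n))"
    have b: "ennreal b = 4 ^ W * (2 * mean_count n)"
      unfolding b_def
      by (rule ennreal_enn2real) (simp add: ennreal_mult_less_top mean_count_finite power_less_top_ennreal)
    have Ule: "emeasure P (U p m) \<le> emeasure P (\<Union>k. first_visit n m W p k)" for p m
    proof (rule emeasure_mono_AE)
      show "AE x in P. x \<in> U p m \<longrightarrow> x \<in> (\<Union>k. first_visit n m W p k)"
        using AE_regular
      proof eventually_elim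
        case (elim x)
        show ?case
        proof
          assume xU: "x \<in> U p m"
          then obtain m' where m': "m' \<le> m" "p \<in> visitors (walks_of x) (level 0) (sched n x m')"
            by (auto simp: U_def Vis_def)
          have "sched n x m' = filter (\<lambda>q. \<bar>fst q\<bar> \<le> int m') (sched n x m)"
            by (rule schedule_filter) (use elim m' in \<open>auto simp: regular_def\<close>)
          then have p: "p \<in> visitors (walks_of x) (level 0) (sched n x m)"
            using m'(2) visitors_filter by (metis subsetD)
          let ?s = "walk_of (walks_of x) p"
          obtain k where k: "?s k \<in> level 0" "\<forall>k'<k. ?s k' \<in> pverts (previous n m p x)"
            using p by (auto simp: visitors_def previous_def)
          \<comment> \<open>The witness \<open>k\<close> may be a later return to the level; its
            first hitting time is no later, so the sites before it are still occupied ones.\<close>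
          define k0 where "k0 = (LEAST k. ?s k \<in> level 0)"
          have k0: "?s k0 \<in> level 0" "k0 \<le> k" "\<And>k'. k' < k0 \<Longrightarrow> ?s k' \<notin> level 0"
            unfolding k0_def by (rule LeastI[of _ k], rule k) (rule Least_le, rule k, rule not_less_Least)
          have "card (pverts (previous n m p x) \<inter> level 0) \<le> card (pverts (window n x [- int m..int m]) \<inter> level 0)"
            using grow_before_subset[of "walks_of x" p "sched n x m"] window_finite[of n x]
            by (intro card_mono) (auto simp: previous_def window_def)
          also have "\<dots> \<le> W" using xU by (simp add: U_def G_def)
          finally have card: "card (pverts (previous n m p x) \<inter> level 0) \<le> W" .
          have "x \<in> space P" using xU by (simp add: U_def G_def)
          then have "x \<in> first_visit n m W p k0"
            using card k k0 p by (auto simp: first_visit_def visitors_def)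
          then show "x \<in> (\<Union>k. first_visit n m W p k)" by blast
        qed
      qed
      show "(\<Union>k. first_visit n m W p k) \<in> sets P" using first_visit_sets by blast
    qed
    have sum_le: "(\<Sum>p\<in>Q. measure P (U p m)) \<le> b" if "finite Q" for Q m
    proof -
      have "ennreal (\<Sum>p\<in>Q. measure P (U p m)) = (\<Sum>p\<in>Q. emeasure P (U p m))"
        by (simp add: P.emeasure_eq_measure)
      also have "\<dots> \<le> (\<Sum>p\<in>Q. emeasure P (\<Union>k. first_visit n m W p k))" by (intro sum_mono Ule)
      also have "\<dots> \<le> ennreal b" unfolding b by (rule visit_sum_bound[OF that])
      finally show ?thesis by (subst (asm) ennreal_le_iff) (simp_all add: b_def)
    qed
    define V where "V p = (\<Union>m. U p m)" for p
    have V: "V p \<in> sets P" for p unfolding V_def using U by blast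
    have V_le: "(\<Sum>p\<in>Q. measure P (V p)) \<le> b" if "finite Q" for Q
    proof (rule LIMSEQ_le_const2)
      show "(\<lambda>m. \<Sum>p\<in>Q. measure P (U p m)) \<longlonglongrightarrow> (\<Sum>p\<in>Q. measure P (V p))"
      proof (rule tendsto_sum)
        fix p
        have "incseq (U p)" unfolding U_def by (intro monoI Int_mono UN_mono) auto
        then show "(\<lambda>m. measure P (U p m)) \<longlonglongrightarrow> measure P (V p)"
          unfolding V_def using U[of p] by (intro P.finite_Lim_measure_incseq) blast+
      qed
    qed (use sum_le[OF that] in blast)
    obtain e :: "nat \<Rightarrow> int \<times> nat" where e: "bij e" by (rule bij_nat_labels)
    have "AE x in P. eventually (\<lambda>j. x \<in> space P - V (e j)) sequentially"
    proof (rule borel_cantelli_AE1)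
      show "summable (\<lambda>j. measure P (V (e j)))"
      proof (rule summableI_nonneg_bounded)
        show "(\<Sum>j<k. measure P (V (e j))) \<le> b" for k
          using V_le[of "e ` {..<k}"] sum.reindex[OF inj_on_subset[OF bij_is_inj[OF e] subset_UNIV[of "{..<k}"]], where g = "\<lambda>p. measure P (V p)"]
          by (simp add: comp_def)
      qed simp
      show "emeasure P (V (e j)) < \<infinity>" for j by (simp add: P.emeasure_eq_measure)
    qed (rule V)
    then show ?thesis
    proof eventually_elim
      case (elim x)
      then obtain k where k: "\<And>j. j \<ge> k \<Longrightarrow> x \<notin> V (e j)" by (auto simp: eventually_sequentially)
      show ?case
      proof
        assume xG: "x \<in> G W"
        have "(\<Union>m. visitors (walks_of x) (level 0) (sched n x m)) \<subseteq> e ` {..<k}"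
        proof
          fix p assume "p \<in> (\<Union>m. visitors (walks_of x) (level 0) (sched n x m))"
          then obtain m where "x \<in> Vis m p" using xG sets.sets_into_space[OF G] by (auto simp: Vis_def)
          then have "x \<in> V p" using xG by (auto simp: V_def U_def)
          moreover obtain j where "p = e j" using e by (metis bij_pointE)
          ultimately show "p \<in> e ` {..<k}" using k by (metis image_eqI lessThan_iff not_less)
        qed
        then show "finite (\<Union>m. visitors (walks_of x) (level 0) (sched n x m))" by (rule finite_subset) simp
      qed
    qed
  qed
  then have "AE x in P. \<forall>W. x \<in> G W \<longrightarrow> finite (\<Union>m. visitors (walks_of x) (level 0) (sched n x m))"
    unfolding AE_all_countable ..
  with AE_level_bounded[of n] AE_space show ?thesis
    by eventually_elim (auto simp: G_def)
qed

text \<open>A particle from a far source that visits level \<open>0\<close> without the help of the near sources also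
  visits it with their help, and only finitely many particles do that.\<close>

lemma AE_far_sources_avoid: "AE x in P. \<exists>L. \<forall>m. pverts (window n x (far_sources L m)) \<inter> level 0 = {}"
  using AE_finite_visitors[of n] AE_regular
proof eventually_elim
  case (elim x)
  let ?V = "\<Union>m. visitors (walks_of x) (level 0) (sched n x m)"
  \<comment> \<open>The greatest distance of a source of one of the finitely many visitors.\<close>
  define L where "L = nat (Max (insert 0 ((\<lambda>p. \<bar>fst p\<bar>) ` ?V)))"
  have L: "\<bar>fst p\<bar> \<le> int L" if "p \<in> ?V" for p
  proof -
    have "\<bar>fst p\<bar> \<le> Max (insert 0 ((\<lambda>p. \<bar>fst p\<bar>) ` ?V))" using elim(1) that by (intro Max_ge) auto
    moreover have "z \<le> int (nat z)" for z by simp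
    ultimately show ?thesis unfolding L_def by (rule order_trans)
  qed
  have "pverts (window n x (far_sources L m)) \<inter> level 0 = {}" for m
    unfolding window_def
  proof (rule no_visitors)
    have f: "schedule (points_of x) n (far_sources L m) = filter (\<lambda>p. int L < \<bar>fst p\<bar>) (sched n x m)"
      using elim(2) by (intro far_schedule) (simp add: regular_def)
    show "distinct (schedule (points_of x) n (far_sources L m))" unfolding f by (simp add: schedule_distinct)
    show "visitors (walks_of x) (level 0) (schedule (points_of x) n (far_sources L m)) = {}"
    proof (rule ccontr)
      assume "visitors (walks_of x) (level 0) (schedule (points_of x) n (far_sources L m)) \<noteq> {}"
      then obtain p where p: "p \<in> visitors (walks_of x) (level 0) (filter (\<lambda>p. int L < \<bar>fst p\<bar>) (sched n x m))"
        unfolding f by blast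
      then have "p \<in> visitors (walks_of x) (level 0) (sched n x m)" using visitors_filter by blast
      then have "\<bar>fst p\<bar> \<le> int L" using L by blast
      then show False using p by (simp add: visitors_def)
    qed
  qed
  then show ?case by blast
qed

section \<open>Probability and recurrence of empty levels\<close>

definition empty_at_0 :: "nat \<Rightarrow> (index \<Rightarrow> real set \<times> site) set" where
  "empty_at_0 n = {x \<in> space P. empty_level (points_of x) (walks_of x) n 0}"

lemma avoid_measurable:
  fixes f :: "nat \<Rightarrow> int list"
  shows "{x \<in> space P. \<forall>m. pverts (window n x (f m)) \<inter> level 0 = {}} \<in> sets P"
proof -
  have "{x \<in> space P. \<forall>m::nat. \<forall>v. v \<in> level 0 \<longrightarrow> v \<notin> pverts (window n x (f m))} \<in> sets P" by measurable
  also have "{x \<in> space P. \<forall>m::nat. \<forall>v. v \<in> level 0 \<longrightarrow> v \<notin> pverts (window n x (f m))} =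
      {x \<in> space P. \<forall>m. pverts (window n x (f m)) \<inter> level 0 = {}}" by blast
  finally show ?thesis .
qed

lemma empty_at_0_sets: "empty_at_0 n \<in> sets P"
  using avoid_measurable[of n "\<lambda>m. [- int m..int m]"]
  by (simp add: empty_at_0_def empty_level_def finite_forest_eq window_def)

lemma prob_no_points:
  "emeasure (coord_law \<pi> (Inl i)) {v \<in> space value_space. card (fst v \<inter> {0..real n}) = 0} = ennreal (exp (- real n))"
  "{v \<in> space value_space. card (fst v \<inter> {0..real n}) = 0} \<in> sets value_space"
proof -
  have 1: "(\<lambda>\<eta>. (\<eta>, 0)) \<in> \<pi> \<rightarrow>\<^sub>M value_space"
    using measurable_config_value measurable_cong_sets[OF sets_\<pi> refl] by blast
  have "(\<lambda>v. card (fst v \<inter> {0..real n})) \<in> value_space \<rightarrow>\<^sub>M count_space UNIV"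
    by (rule measurable_compose[OF measurable_fst_value measurable_card_config]) auto
  from measurable_sets[OF this, of "{0}"]
  show A: "{v \<in> space value_space. card (fst v \<inter> {0..real n}) = 0} \<in> sets value_space"
    by (simp add: vimage_def Int_def conj_commute)
  have "emeasure (coord_law \<pi> (Inl i)) {v \<in> space value_space. card (fst v \<inter> {0..real n}) = 0} =
      emeasure \<pi> {\<eta> \<in> space \<pi>. card (\<eta> \<inter> {0..real n}) = 0}"
    unfolding coord_law_def sum.case emeasure_distr[OF 1 A]
    by (rule arg_cong[where f = "emeasure \<pi>"]) (auto simp: space_value_space space_\<pi>)
  also have "\<dots> = ennreal (exp (- real n))"
    by (subst pi.emeasure_eq_measure, subst poisson_counts) auto
  finally show "emeasure (coord_law \<pi> (Inl i)) {v \<in> space value_space. card (fst v \<inter> {0..real n}) = 0} = ennreal (exp (- real n))" .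
qed

lemma empty_at_0_prob: "measure P (empty_at_0 n) > 0"
proof -
  define G where "G L = {x \<in> space P. \<forall>m. pverts (window n x (far_sources L m)) \<inter> level 0 = {}}" for L
  have G: "G L \<in> sets P" for L unfolding G_def by (rule avoid_measurable)
  \<comment> \<open>The radius found before is random; since countably many \<open>G L\<close> cover
    almost everything, one deterministic radius has positive probability.\<close>
  have "\<exists>L. emeasure P (G L) \<noteq> 0"
  proof (rule ccontr)
    assume "\<not> (\<exists>L. emeasure P (G L) \<noteq> 0)"
    then have "G L \<in> null_sets P" for L using G by (auto simp: null_sets_def)
    then have "AE x in P. x \<notin> G L" for L by (rule AE_not_in)
    then have "AE x in P. \<forall>L. x \<notin> G L" by (simp add: AE_all_countable)
    with AE_far_sources_avoid[of n] AE_space have "AE x in P. False"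
      by eventually_elim (auto simp: G_def)
    then show False by simp
  qed
  then obtain L where L: "emeasure P (G L) \<noteq> 0" by blast
  let ?J = "Inl ` {- int L..int L} :: index set"
  let ?A = "{v \<in> space value_space. card (fst v \<inter> {0..real n}) = 0}"
  define H where "H = {x \<in> space P. \<forall>q\<in>?J. x q \<in> ?A}"
  have A: "?A \<in> sets (coord_law \<pi> q)" for q unfolding sets_coord_law by (rule prob_no_points)
  have H: "H \<in> sets P" unfolding H_def using A by (intro cylinder_sets) auto
  have "emeasure P H = (\<Prod>q\<in>?J. emeasure (coord_law \<pi> q) ?A)"
    unfolding H_def using A by (intro emeasure_PiM_Collect) auto
  also have "\<dots> = (\<Prod>q\<in>?J. ennreal (exp (- real n)))" by (intro prod.cong refl) (auto simp: prob_no_points(1))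
  also have "\<dots> \<noteq> 0" by (simp add: ennreal_eq_0_iff not_le)
  finally have H0: "emeasure P H \<noteq> 0" .
  have "emeasure P (H \<inter> G L) = emeasure P H * emeasure P (G L)"
  proof (rule disjoint_coordinates_indep[where J = ?J, OF H G])
    show "x \<in> H \<longleftrightarrow> y \<in> H" if "x \<in> space P" "y \<in> space P" and eq: "\<And>q. q \<in> ?J \<Longrightarrow> x q = y q" for x y
      using that(1,2) eq by (simp add: H_def)
    show "x \<in> G L \<longleftrightarrow> y \<in> G L" if "x \<in> space P" "y \<in> space P" and eq: "\<And>q. q \<notin> ?J \<Longrightarrow> x q = y q" for x y
    proof -
      \<comment> \<open>\<open>G L\<close> may depend on every walk, even those of near sources, but
        it reads no near point process, and those are the only coordinates of
        \<open>H\<close>.\<close>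
      have "x (Inr p) = y (Inr p)" for p by (rule eq) auto
      then have w: "walks_of x = walks_of y" by (simp add: walks_of_def fun_eq_iff)
      have "schedule (points_of x) n (far_sources L m) = schedule (points_of y) n (far_sources L m)" for m
      proof (rule schedule_cong)
        fix i assume "i \<in> set (far_sources L m)"
        then have "x (Inl i) = y (Inl i)" by (intro eq) (auto simp: far_sources_def)
        then show "points_of x i = points_of y i" by (simp add: points_of_def)
      qed
      then show ?thesis using that(1,2) by (simp add: G_def window_def w)
    qed
  qed
  then have "emeasure P (H \<inter> G L) \<noteq> 0" using L H0 by simp
  moreover have "emeasure P (H \<inter> G L) \<le> emeasure P (empty_at_0 n)"
  proof (rule emeasure_mono_AE[OF _ empty_at_0_sets])
    show "AE x in P. x \<in> H \<inter> G L \<longrightarrow> x \<in> empty_at_0 n"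
      using AE_regular
    proof eventually_elim
      case (elim x)
      show ?case
      proof
        assume x: "x \<in> H \<inter> G L"
        have adm: "admissible (points_of x)" using elim by (simp add: regular_def)
        \<comment> \<open>When the near sources have no point up to time \<open>n\<close>, omitting
          them leaves the schedule unchanged.\<close>
        have "schedule (points_of x) n (far_sources L m) = sched n x m" for m
        proof -
          have "int L < \<bar>fst p\<bar>" if p: "p \<in> set (sched n x m)" for p
          proof (rule ccontr)
            assume "\<not> int L < \<bar>fst p\<bar>"
            then have "Inl (fst p) \<in> ?J" by (intro imageI) auto
            then have "x (Inl (fst p)) \<in> ?A" using x unfolding H_def by blast
            moreover have "points_of x (fst p) \<in> locally_finite_configs" using adm by (simp add: admissible_def)
            ultimately have "npoints (points_of x (fst p)) n = 0" by (simp add: npoints_eq_card points_of_def)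
            then show False using p by (auto simp: set_schedule[OF adm])
          qed
          then show ?thesis unfolding far_schedule[OF adm] by (rule filter_True[OF ballI])
        qed
        then show "x \<in> empty_at_0 n"
          using x by (simp add: empty_at_0_def empty_level_def finite_forest_eq G_def window_def)
      qed
    qed
  qed
  ultimately have "emeasure P (empty_at_0 n) \<noteq> 0" by auto
  then show ?thesis by (simp add: P.emeasure_eq_measure zero_less_measure_iff)
qed

lemma AE_separated: "AE x in P. separated (points_of x) (walks_of x)"
proof -
  have "AE x in P. (\<forall>Y. \<exists>k>Y. shift k x \<in> empty_at_0 n) \<and> (\<forall>Y. \<exists>k<Y. shift k x \<in> empty_at_0 n)" for n
    using shift.recurrent_above[OF empty_at_0_sets empty_at_0_prob, of n]
      shift.recurrent_below[OF empty_at_0_sets empty_at_0_prob, of n] by eventually_elim blast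
  then have "AE x in P. \<forall>n. (\<forall>Y. \<exists>k>Y. shift k x \<in> empty_at_0 n) \<and> (\<forall>Y. \<exists>k<Y. shift k x \<in> empty_at_0 n)"
    by (simp add: AE_all_countable)
  moreover have "AE x in P. \<forall>k. site_symmetry (points_of x) (walks_of x) (points_of (shift k x)) (walks_of (shift k x)) (vshift k) (\<lambda>i. i + k) k"
    using AE_shift_symmetry by (simp add: AE_all_countable)
  ultimately show ?thesis
  proof eventually_elim
    case (elim x)
    \<comment> \<open>The shift by \<open>k\<close> carries level \<open>- k\<close> to level 0,
      which is why high empty levels come from recurrence at negative \<open>k\<close>.\<close>
    have e: "empty_level (points_of x) (walks_of x) n (- k)" if "shift k x \<in> empty_at_0 n" for k n
      using that site_symmetry.empty_level_image[OF elim(2)[rule_format, of k], of n "- k"] by (simp add: empty_at_0_def)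
    show ?case
      unfolding separated_def
    proof (intro allI conjI)
      fix n Y
      obtain k where "k < - Y" "shift k x \<in> empty_at_0 n" using elim(1) by blast
      then show "\<exists>y>Y. empty_level (points_of x) (walks_of x) n y" using e by (intro exI[of _ "- k"]) auto
      obtain k where "k > - Y" "shift k x \<in> empty_at_0 n" using elim(1) by blast
      then show "\<exists>y<Y. empty_level (points_of x) (walks_of x) n y" using e by (intro exI[of _ "- k"]) auto
    qed
  qed
qed

text \<open>Recurrence under shifts of the event that source 0 has a point up to time 1, whose
  complement is a void event of probability \<open>exp (- 1)\<close>. It provides launched particles
  above any height.\<close>

lemma AE_busy: "AE x in P. \<forall>Y. \<exists>i>Y. npoints (points_of x i) 1 \<ge> 1"
proof -
  let ?A = "{v \<in> space value_space. card (fst v \<inter> {0..real 1}) = 0}"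
  let ?E = "{x \<in> space P. x (Inl 0) \<in> ?A}"
  have A: "?A \<in> sets (coord_law \<pi> q)" for q unfolding sets_coord_law by (rule prob_no_points)
  have "{x \<in> space P. \<forall>q\<in>{Inl 0}. x q \<in> ?A} \<in> sets P" using A by (intro cylinder_sets) auto
  then have E: "?E \<in> sets P" by simp
  have "emeasure P ?E = emeasure (coord_law \<pi> (Inl 0)) ?A" using A by (intro emeasure_PiM_Collect_single) auto
  also have "\<dots> = ennreal (exp (- real 1))" by (rule prob_no_points(1))
  finally have "measure P ?E = exp (- 1)" by (simp add: P.emeasure_eq_measure)
  then have "measure P (space P - ?E) > 0" by (subst P.prob_compl[OF E]) simp
  from shift.recurrent_below[OF _ this] E
  have "AE x in P. \<forall>Y. \<exists>k<Y. shift k x \<in> space P - ?E" by simp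
  with AE_space show ?thesis
  proof eventually_elim
    case (elim x)
    show ?case
    proof
      fix Y
      obtain k where k: "k < - Y" "shift k x \<in> space P - ?E" using elim(2) by blast
      have "points_of x (- k) \<in> locally_finite_configs" by (rule point_space[OF elim(1)])
      moreover have "shift k x (Inl 0) = x (Inl (- k))" by (simp add: shift_eq source_map_def)
      moreover have "shift k x (Inl 0) \<in> space value_space"
        using k(2) by (auto simp: space_PiM PiE_iff space_coord_law space_value_space)
      ultimately have "npoints (points_of x (- k)) 1 \<noteq> 0"
        using k(2) by (auto simp: npoints_eq_card points_of_def)
      then show "\<exists>i>Y. npoints (points_of x i) 1 \<ge> 1" using k(1) by (intro exI[of _ "- k"]) auto
    qed
  qed
qed

text \<open>Walks with different labels use disjoint coordinates, so the probability that none of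
  \<open>r\<close> consecutive ones starts with \<open>m\<close> steps \<open>s\<close> is
  \<open>q ^ r\<close>, which tends to 0; this applies beyond every label \<open>j0\<close>.\<close>

lemma AE_straight:
  assumes "s \<in> unit_steps"
  shows "AE x in P. infinite {j. \<forall>l<m. snd (x (Inr (y, j, l))) = s}"
proof -
  define D where "D j = {x \<in> space P. \<forall>p\<in>(\<lambda>l. (y, j, l)) ` {..<m}. snd (x (Inr p)) = s}" for j
  define q :: real where "q = 1 - (1 / 4) ^ m"
  have D: "D j \<in> sets P" for j unfolding D_def using assms by (intro steps_prob) auto
  have "emeasure P (D j) = (1 / 4) ^ m" for j
    unfolding D_def using assms by (subst steps_prob) (auto simp: card_image inj_on_def)
  moreover have "((1 / 4) ^ m :: ennreal) = ennreal ((1 / 4) ^ m)"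
    by (subst ennreal_power[symmetric]) (simp_all add: ennreal_divide_numeral[symmetric])
  ultimately have PD: "measure P (D j) = (1 / 4) ^ m" for j
    by (simp add: P.emeasure_eq_measure)
  define A where "A j0 r = {x \<in> space P. \<forall>j. j0 \<le> j \<and> j < j0 + r \<longrightarrow> x \<notin> D j}" for j0 r
  have A: "A j0 r \<in> sets P" for j0 r
  proof -
    have [measurable]: "Measurable.pred P (\<lambda>x. x \<in> D j)" for j using D by simp
    show ?thesis unfolding A_def by measurable
  qed
  have PA: "measure P (A j0 r) = q ^ r" for j0 r
  proof (induction r)
    case 0
    have "A j0 0 = space P" by (auto simp: A_def)
    then show ?case using P.prob_space by simp
  next
    case (Suc r)
    let ?J = "range (\<lambda>l. Inr (y, j0 + r, l)) :: index set"
    have eq: "A j0 (Suc r) = (space P - D (j0 + r)) \<inter> A j0 r" by (auto simp: A_def less_Suc_eq)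
    have "emeasure P ((space P - D (j0 + r)) \<inter> A j0 r) = emeasure P (space P - D (j0 + r)) * emeasure P (A j0 r)"
    proof (rule disjoint_coordinates_indep[where J = ?J])
      show "x \<in> space P - D (j0 + r) \<longleftrightarrow> z \<in> space P - D (j0 + r)"
        if "x \<in> space P" "z \<in> space P" and eq: "\<And>i. i \<in> ?J \<Longrightarrow> x i = z i" for x z
        using that(1,2) eq by (simp add: D_def)
      show "x \<in> A j0 r \<longleftrightarrow> z \<in> A j0 r"
        if "x \<in> space P" "z \<in> space P" and eq: "\<And>i. i \<notin> ?J \<Longrightarrow> x i = z i" for x z
      proof -
        have "x (Inr (y, j, l)) = z (Inr (y, j, l))" if "j < j0 + r" for j l by (rule eq) (use that in auto)
        then have "x \<in> D j \<longleftrightarrow> z \<in> D j" if "j < j0 + r" for j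
          using that \<open>x \<in> space P\<close> \<open>z \<in> space P\<close> by (simp add: D_def)
        then show ?thesis using that(1,2) by (auto simp: A_def)
      qed
    qed (use D A in auto)
    then have "ennreal (measure P (A j0 (Suc r))) = ennreal (measure P (space P - D (j0 + r)) * measure P (A j0 r))"
      unfolding eq by (simp add: P.emeasure_eq_measure ennreal_mult)
    then have "measure P (A j0 (Suc r)) = measure P (space P - D (j0 + r)) * measure P (A j0 r)"
      by (simp add: zero_le_mult_iff)
    then show ?case by (simp add: Suc P.prob_compl[OF D] PD q_def)
  qed
  have "AE x in P. \<exists>j\<ge>j0. x \<in> D j" for j0
  proof -
    have IA: "(\<Inter>r. A j0 r) \<in> sets P" using A by blast
    have q: "0 \<le> q" "q < 1" by (simp_all add: q_def power_le_one)
    have "measure P (\<Inter>r. A j0 r) \<le> 0"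
    proof (rule LIMSEQ_le_const)
      show "(\<lambda>r. q ^ r) \<longlonglongrightarrow> 0" using q by (intro LIMSEQ_realpow_zero) auto
      have "measure P (\<Inter>r. A j0 r) \<le> q ^ r" for r
        unfolding PA[of j0 r, symmetric] by (rule P.finite_measure_mono[OF _ A]) blast
      then show "\<exists>N. \<forall>r\<ge>N. measure P (\<Inter>r. A j0 r) \<le> q ^ r" by blast
    qed
    then have "measure P (\<Inter>r. A j0 r) = 0" using measure_nonneg[of P] by (simp add: antisym)
    then have "AE x in P. x \<notin> (\<Inter>r. A j0 r)" using P.prob_eq_0[OF IA] by simp
    with AE_space show ?thesis by eventually_elim (auto simp: A_def)
  qed
  then have "AE x in P. \<forall>j0. \<exists>j\<ge>j0. x \<in> D j" by (simp add: AE_all_countable)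
  then show ?thesis
  proof eventually_elim
    case (elim x)
    then show ?case unfolding infinite_nat_iff_unbounded_le by (fastforce simp: D_def)
  qed
qed

end

section \<open>Trees, symmetries and mixing of the infinite forest\<close>

definition good :: "(index \<Rightarrow> real set \<times> site) \<Rightarrow> bool" where
  "good x \<longleftrightarrow> regular x \<and> separated (points_of x) (walks_of x) \<and>
     (\<forall>Y. \<exists>i>Y. npoints (points_of x i) 1 \<ge> 1) \<and>
     (\<forall>y m. \<forall>s\<in>unit_steps. infinite {j. \<forall>l<m. snd (x (Inr (y, j, l))) = s})"

lemma good_separated_input: "good x \<Longrightarrow> separated_input (points_of x) (walks_of x)"
  by (simp add: good_def regular_def separated_input_def separated_input_axioms_def regular_input_def)

lemma good_spanning:
  assumes "good x"
  shows "pverts (forest_limit (points_of x) (walks_of x)) = UNIV"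
proof -
  interpret separated_input "points_of x" "walks_of x" using assms by (rule good_separated_input)
  have "(a, y) \<in> pverts F" for a y
  proof -
    \<comment> \<open>The site \<open>(a, y)\<close> is reached from the source
      \<open>(0, y)\<close> by \<open>\<bar>a\<bar>\<close> horizontal steps towards it.\<close>
    define d :: int where "d = (if a < 0 then - 1 else 1)"
    define m where "m = nat \<bar>a\<bar>"
    define c where "c k = int k * d" for k
    have "(d, 0) \<in> unit_steps" by (simp add: d_def unit_steps_def)
    then have "infinite {j. \<forall>l<m. snd (x (Inr (y, j, l))) = (d, 0)}" using assms by (simp add: good_def)
    \<comment> \<open>Coordinate \<open>j\<close> holds the increments of the particle with label
      \<open>Suc j\<close>.\<close>
    then have "infinite (Suc ` {j. \<forall>l<m. snd (x (Inr (y, j, l))) = (d, 0)})"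
      by (simp add: finite_image_iff)
    moreover have "Suc ` {j. \<forall>l<m. snd (x (Inr (y, j, l))) = (d, 0)} \<subseteq>
        {j. j \<ge> 1 \<and> (\<forall>k\<le>m. walks_of x y j k = (c k, y))}"
    proof clarsimp
      fix j k assume steps: "\<forall>l<m. snd (x (Inr (y, j, l))) = (d, 0)" and "k \<le> m"
      from \<open>k \<le> m\<close> show "walks_of x y (Suc j) k = (c k, y)"
      proof (induction k)
        case 0
        then show ?case by (simp add: walks_of_def c_def)
      next
        case (Suc k)
        then show ?case using steps by (simp add: walks_of_Suc c_def algebra_simps)
      qed
    qed
    ultimately have "infinite {j. j \<ge> 1 \<and> (\<forall>k\<le>m. walks_of x y j k = (c k, y))}"
      using finite_subset by blast
    from straight_walks_reach[OF this] have "(c m, y) \<in> pverts F" .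
    moreover have "c m = a" by (simp add: c_def m_def d_def)
    ultimately show ?thesis by simp
  qed
  then show ?thesis by (auto simp: F_def)
qed

lemma good_lattice: "good x \<Longrightarrow> parcs (forest_limit (points_of x) (walks_of x)) \<subseteq> lattice_arcs"
  using separated_input.limit_lattice[OF good_separated_input] separated_input.F_def[OF good_separated_input] by metis

lemma good_trees:
  assumes "good x"
  shows "\<exists>R T. R \<subseteq> {0} \<times> UNIV \<and> countable R \<and> infinite R \<and> (\<forall>r\<in>R. directed_tree (T r) r) \<and>
    disjoint_family_on (\<lambda>r. pverts (T r)) R \<and>
    forest_limit (points_of x) (walks_of x) = graph_Union (T ` R)"
proof -
  interpret separated_input "points_of x" "walks_of x" using assms by (rule good_separated_input)
  have "infinite roots" using assms by (intro infinite_roots) (simp add: good_def)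
  then show ?thesis
    using roots_on_axis tree_directed tree_disjoint tree_Union
    by (intro exI[of _ roots] exI[of _ tree]) (auto simp: F_def)
qed

section \<open>Measurable action of site maps on forests\<close>

lemma graph_image_measurable:
  assumes "bij f"
  shows "graph_image f \<in> forest_space \<rightarrow>\<^sub>M forest_space"
proof -
  have f: "f (inv f v) = v" "inv f (f v) = v" for v
    using assms by (simp_all add: bij_is_surj surj_f_inv_f bij_is_inj)
  have v: "v \<in> f ` A \<longleftrightarrow> inv f v \<in> A" for v and A
  proof
    assume "inv f v \<in> A"
    then have "f (inv f v) \<in> f ` A" by (rule imageI)
    then show "v \<in> f ` A" by (simp only: f)
  qed (auto simp: f)
  have e: "e \<in> map_prod f f ` A \<longleftrightarrow> (inv f (fst e), inv f (snd e)) \<in> A" for e and A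
  proof
    assume "(inv f (fst e), inv f (snd e)) \<in> A"
    then have "map_prod f f (inv f (fst e), inv f (snd e)) \<in> map_prod f f ` A" by (rule imageI)
    then show "e \<in> map_prod f f ` A" by (simp add: f)
  qed (auto simp: f)
  show ?thesis
    unfolding measurable_forest_iff graph_image_def pair_pre_digraph.select_convs v e
    using measurable_pverts[OF measurable_ident] measurable_parcs[OF measurable_ident] by simp
qed

lemma graph_image_comp: "graph_image f (graph_image g G) = graph_image (\<lambda>v. f (g v)) G"
  by (simp add: graph_image_def image_image map_prod_def case_prod_unfold)

lemma graph_image_id: "graph_image (\<lambda>v. v) G = G"
  by (simp add: graph_image_def map_prod_def)

lemma vshift_inverse: "vshift k (vshift (- k) v) = v" "vshift (- k) (vshift k v) = v"
  by (auto simp: vshift_def case_prod_unfold)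

lemma bij_vshift: "bij (vshift k)"
  by (rule o_bij[of "vshift (- k)"]) (auto simp: vshift_inverse fun_eq_iff)

text \<open>Turns the translated event of the mixing property, an image, into a preimage under the
  inverse translation, which is measurable.\<close>

lemma mem_vshift_image: "G \<in> graph_image (vshift k) ` B \<longleftrightarrow> graph_image (vshift (- k)) G \<in> B"
proof
  assume "graph_image (vshift (- k)) G \<in> B"
  then have "graph_image (vshift k) (graph_image (vshift (- k)) G) \<in> graph_image (vshift k) ` B" by (rule imageI)
  then show "G \<in> graph_image (vshift k) ` B" by (simp add: graph_image_comp vshift_inverse graph_image_id)
qed (auto simp: graph_image_comp vshift_inverse graph_image_id)

lemma bij_site_map:
  assumes "\<sigma> * \<sigma> = 1" "\<tau> * \<tau> = 1"
  shows "bij (site_map \<sigma> \<tau> c)"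
  using sign_cases[OF assms(1)] sign_cases[OF assms(2)]
  by (intro o_bij[of "site_map \<sigma> \<tau> (- \<tau> * c)"]) (auto simp: site_map_def fun_eq_iff)

lemma (in canonical_input) AE_good: "AE x in P. good x"
proof -
  have "AE x in P. infinite {j. \<forall>l<m. snd (x (Inr (y, j, l))) = s}" if "s \<in> unit_steps" for m y s
    using that by (rule AE_straight)
  then have "AE x in P. \<forall>y m. \<forall>s\<in>unit_steps. infinite {j. \<forall>l<m. snd (x (Inr (y, j, l))) = s}"
    by (simp add: AE_all_countable AE_ball_countable countable_finite[OF unit_steps_facts(1)])
  with AE_regular AE_separated AE_busy show ?thesis by eventually_elim (auto simp: good_def)
qed

lemma (in canonical_input) forest_symmetry:
  fixes c :: int
  assumes "\<sigma> * \<sigma> = 1" "\<tau> * \<tau> = 1"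
  defines "T \<equiv> act (sign_map \<sigma> \<tau>) (\<lambda>i. \<tau> * (i - c))"
  shows "AE x in P. forest_limit (points_of (T x)) (walks_of (T x)) =
      graph_image (site_map \<sigma> \<tau> c) (forest_limit (points_of x) (walks_of x)) \<and>
    (\<forall>n. forest_at (points_of (T x)) (walks_of (T x)) n =
      graph_image (site_map \<sigma> \<tau> c) (forest_at (points_of x) (walks_of x) n))"
  unfolding T_def using AE_site_symmetry(3)[OF assms(1,2), of c] AE_separated
proof eventually_elim
  case (elim x)
  then show ?case using site_symmetry.forest_at_image site_symmetry.forest_limit_image by blast
qed

context idla
begin

text \<open>The forest is almost surely \<Phi> of the canonical input. Moving it by \<open>f\<close>
  amounts to evaluating \<Phi> at the input moved by \<open>T\<close>, and \<open>T\<close> does not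
  change the law of that input.\<close>

lemma invariance:
  assumes \<Phi>: "\<Phi> \<in> input.P \<rightarrow>\<^sub>M forest_space" and F: "F \<in> M \<rightarrow>\<^sub>M forest_space" "AE \<omega> in M. F \<omega> = \<Phi> (Z \<omega>)"
    and T: "T \<in> input.P \<rightarrow>\<^sub>M input.P" "distr input.P input.P T = input.P"
    and f: "bij f" and eq: "AE x in input.P. \<Phi> (T x) = graph_image f (\<Phi> x)"
  shows "invariant_distribution M F f"
proof -
  have TZ: "(\<lambda>\<omega>. T (Z \<omega>)) \<in> M \<rightarrow>\<^sub>M input.P" by (rule measurable_compose[OF Z_measurable T(1)])
  have "distr M forest_space (\<lambda>\<omega>. graph_image f (F \<omega>)) = distr M forest_space (\<lambda>\<omega>. \<Phi> (T (Z \<omega>)))"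
  proof (rule distr_cong_AE)
    show "AE \<omega> in M. graph_image f (F \<omega>) = \<Phi> (T (Z \<omega>))"
      using F(2) AE_input[OF eq] by eventually_elim simp
  qed (use measurable_compose[OF F(1) graph_image_measurable[OF f]] measurable_compose[OF TZ \<Phi>] in auto)
  also have "\<dots> = distr (distr M input.P (\<lambda>\<omega>. T (Z \<omega>))) forest_space \<Phi>"
    using \<Phi> TZ by (simp add: distr_distr comp_def)
  also have "distr M input.P (\<lambda>\<omega>. T (Z \<omega>)) = distr (distr M input.P Z) input.P T"
    using T Z_measurable by (simp add: distr_distr comp_def)
  also have "\<dots> = distr M input.P Z" by (simp only: Z_distr T(2))
  also have "distr (distr M input.P Z) forest_space \<Phi> = distr M forest_space (\<lambda>\<omega>. \<Phi> (Z \<omega>))"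
    using \<Phi> Z_measurable by (simp add: distr_distr comp_def)
  also have "\<dots> = distr M forest_space F"
    using F \<Phi> Z_measurable by (intro distr_cong_AE) (auto intro: measurable_compose)
  finally show ?thesis by (simp add: invariant_distribution_def)
qed

text \<open>By equivariance both forest events pull back to events of the canonical input, the
  second one shifted by \<open>- k\<close>. The reversed shift is mixing too, and \<bar>k\<bar> is
  unaffected by the sign.\<close>

lemma mixing:
  assumes \<Phi>: "\<Phi> \<in> input.P \<rightarrow>\<^sub>M forest_space" and F: "F \<in> M \<rightarrow>\<^sub>M forest_space" "AE \<omega> in M. F \<omega> = \<Phi> (Z \<omega>)"
    and eq: "\<And>k. AE x in input.P. \<Phi> (input.shift k x) = graph_image (vshift k) (\<Phi> x)"
  shows "mixing_distribution M F"
  unfolding mixing_distribution_def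
proof (intro ballI)
  fix A B assume A: "A \<in> sets forest_space" and B: "B \<in> sets forest_space"
  define U where "U = \<Phi> -` A \<inter> space input.P"
  define V where "V = \<Phi> -` B \<inter> space input.P"
  have U: "U \<in> sets input.P" and V: "V \<in> sets input.P"
    unfolding U_def V_def using measurable_sets[OF \<Phi>] A B by auto
  have FS: "{\<omega> \<in> space M. F \<omega> \<in> C} \<in> sets M" if "C \<in> sets forest_space" for C
    using measurable_sets[OF F(1) that] by (simp add: vimage_def Int_def conj_commute)
  have one: "measure M {\<omega> \<in> space M. F \<omega> \<in> C} = measure input.P (\<Phi> -` C \<inter> space input.P)" if C: "C \<in> sets forest_space" for C
  proof -
    have \<Phi>C: "\<Phi> -` C \<inter> space input.P \<in> sets input.P" using measurable_sets[OF \<Phi> C] .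
    have "measure M {\<omega> \<in> space M. F \<omega> \<in> C} = measure M (Z -` (\<Phi> -` C \<inter> space input.P) \<inter> space M)"
    proof (rule measure_eq_AE)
      show "AE \<omega> in M. \<omega> \<in> {\<omega> \<in> space M. F \<omega> \<in> C} \<longleftrightarrow> \<omega> \<in> Z -` (\<Phi> -` C \<inter> space input.P) \<inter> space M"
        using F(2) AE_space by eventually_elim (auto dest: measurable_space[OF Z_measurable])
    qed (use FS[OF C] measurable_sets[OF Z_measurable \<Phi>C] in auto)
    also have "\<dots> = measure (distr M input.P Z) (\<Phi> -` C \<inter> space input.P)"
      by (rule measure_distr[OF Z_measurable \<Phi>C, symmetric])
    finally show ?thesis by (simp only: Z_distr)
  qed
  have two: "measure M {\<omega> \<in> space M. F \<omega> \<in> A \<and> F \<omega> \<in> graph_image (vshift k) ` B} =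
      measure input.P (U \<inter> (input.shift (- k) -` V \<inter> space input.P))" for k
  proof -
    have "graph_image (vshift k) ` B = graph_image (vshift (- k)) -` B \<inter> space forest_space"
      by (intro set_eqI) (simp add: mem_vshift_image forest_space_def)
    then have C: "A \<inter> graph_image (vshift k) ` B \<in> sets forest_space"
      using A measurable_sets[OF graph_image_measurable[OF bij_vshift] B] by auto
    have "measure M {\<omega> \<in> space M. F \<omega> \<in> A \<and> F \<omega> \<in> graph_image (vshift k) ` B} =
        measure input.P (\<Phi> -` (A \<inter> graph_image (vshift k) ` B) \<inter> space input.P)"
      using one[OF C] by simp
    also have "\<dots> = measure input.P (U \<inter> (input.shift (- k) -` V \<inter> space input.P))"
    proof (rule measure_eq_AE)
      show "AE x in input.P. x \<in> \<Phi> -` (A \<inter> graph_image (vshift k) ` B) \<inter> space input.P \<longleftrightarrow>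
          x \<in> U \<inter> (input.shift (- k) -` V \<inter> space input.P)"
        using eq[of "- k"] AE_space
      proof eventually_elim
        case (elim x)
        have "input.shift (- k) x \<in> space input.P" using measurable_space[OF input.shift.T_measurable elim(2)] .
        then show ?case using elim by (auto simp: U_def V_def mem_vshift_image)
      qed
    qed (use measurable_sets[OF \<Phi> C] U measurable_sets[OF input.shift.T_measurable V] in auto)
    finally show ?thesis .
  qed
  interpret r: shift_action input.P "\<lambda>k. input.shift (- k)" by (rule input.shift.reversed)
  show "((\<lambda>k. measure M {\<omega> \<in> space M. F \<omega> \<in> A \<and> F \<omega> \<in> graph_image (vshift k) ` B}) \<longlongrightarrow>
      measure M {\<omega> \<in> space M. F \<omega> \<in> A} * measure M {\<omega> \<in> space M. F \<omega> \<in> B}) (filtercomap abs at_top)"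
    unfolding two one[OF A] one[OF B] using r.T_mixing[OF U V] by (simp add: U_def V_def)
qed

lemma forest_limit_measurable: "(\<lambda>x. forest_limit (points_of x) (walks_of x)) \<in> input.P \<rightarrow>\<^sub>M forest_space"
  and forest_at_measurable: "(\<lambda>x. forest_at (points_of x) (walks_of x) n) \<in> input.P \<rightarrow>\<^sub>M forest_space"
  using measurable_forest_limit[OF input.points_measurable input.walks_measurable]
    measurable_forest_at[OF input.points_measurable input.walks_measurable] by simp_all

lemma idla_forest_inf_measurable: "idla_forest_inf N S \<in> M \<rightarrow>\<^sub>M forest_space"
  and idla_forest_measurable: "idla_forest N S n \<in> M \<rightarrow>\<^sub>M forest_space"
  unfolding idla_forest_inf_def[abs_def] idla_forest_def[abs_def]
  by (rule measurable_forest_limit[OF N_measurable], rule S_measurable, assumption)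
    (rule measurable_forest_at[OF N_measurable], rule S_measurable, assumption)

lemma AE_forest_limit_Z: "AE \<omega> in M. idla_forest_inf N S \<omega> = forest_limit (points_of (Z \<omega>)) (walks_of (Z \<omega>))"
  and AE_forest_at_Z: "AE \<omega> in M. idla_forest N S n \<omega> = forest_at (points_of (Z \<omega>)) (walks_of (Z \<omega>)) n"
  using AE_forest_Z by (eventually_elim, simp)+

lemma invariant_site_map:
  assumes "\<sigma> * \<sigma> = 1" "\<tau> * \<tau> = 1"
  shows "invariant_distribution M (idla_forest_inf N S) (site_map \<sigma> \<tau> c)"
    "invariant_distribution M (idla_forest N S n) (site_map \<sigma> \<tau> c)"
proof -
  note T = input.AE_site_symmetry(1,2)[OF assms, of c]
  have sym: "AE x in input.P. forest_limit (points_of (act (sign_map \<sigma> \<tau>) (\<lambda>i. \<tau> * (i - c)) x)) (walks_of (act (sign_map \<sigma> \<tau>) (\<lambda>i. \<tau> * (i - c)) x)) =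
      graph_image (site_map \<sigma> \<tau> c) (forest_limit (points_of x) (walks_of x))"
    "AE x in input.P. forest_at (points_of (act (sign_map \<sigma> \<tau>) (\<lambda>i. \<tau> * (i - c)) x)) (walks_of (act (sign_map \<sigma> \<tau>) (\<lambda>i. \<tau> * (i - c)) x)) n =
      graph_image (site_map \<sigma> \<tau> c) (forest_at (points_of x) (walks_of x) n)"
    using input.forest_symmetry[OF assms, of c] by (eventually_elim, blast)+
  show "invariant_distribution M (idla_forest_inf N S) (site_map \<sigma> \<tau> c)"
    by (rule invariance[OF forest_limit_measurable idla_forest_inf_measurable AE_forest_limit_Z T bij_site_map[OF assms] sym(1)])
  show "invariant_distribution M (idla_forest N S n) (site_map \<sigma> \<tau> c)"
    by (rule invariance[OF forest_at_measurable idla_forest_measurable AE_forest_at_Z T bij_site_map[OF assms] sym(2)])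
qed

lemma mixing_forests: "mixing_distribution M (idla_forest_inf N S)" "mixing_distribution M (idla_forest N S n)"
proof -
  have sym: "AE x in input.P. forest_limit (points_of (input.shift k x)) (walks_of (input.shift k x)) =
      graph_image (vshift k) (forest_limit (points_of x) (walks_of x))"
    "AE x in input.P. forest_at (points_of (input.shift k x)) (walks_of (input.shift k x)) n =
      graph_image (vshift k) (forest_at (points_of x) (walks_of x) n)" for k
    using input.forest_symmetry[of 1 1 k] unfolding input.shift_def input.site_map_vshift
    by (simp_all add: AE_conj_iff AE_all_countable)
  show "mixing_distribution M (idla_forest_inf N S)"
    by (rule mixing[OF forest_limit_measurable idla_forest_inf_measurable AE_forest_limit_Z sym(1)])
  show "mixing_distribution M (idla_forest N S n)"
    by (rule mixing[OF forest_at_measurable idla_forest_measurable AE_forest_at_Z sym(2)])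
qed

end

theorem theorem7p4:
  fixes M :: "'a measure"
    and N :: "int \<Rightarrow> 'a \<Rightarrow> real set"
    and S :: "int \<Rightarrow> nat \<Rightarrow> 'a \<Rightarrow> nat \<Rightarrow> site"
  assumes "idla M N S"
  shows
    "(idla_forest_inf N S \<in> M \<rightarrow>\<^sub>M forest_space \<and>
      (\<forall>n\<ge>1. idla_forest N S n \<in> M \<rightarrow>\<^sub>M forest_space)) \<and>
     (AE \<omega> in M. pverts (idla_forest_inf N S \<omega>) = UNIV \<and>
                  parcs (idla_forest_inf N S \<omega>) \<subseteq> lattice_arcs) \<and>
     (AE \<omega> in M. \<exists>R T. R \<subseteq> {0} \<times> UNIV \<and> countable R \<and> infinite R \<and>
        (\<forall>r\<in>R. directed_tree (T r) r) \<and>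
        disjoint_family_on (\<lambda>r. pverts (T r)) R \<and>
        idla_forest_inf N S \<omega> = graph_Union (T ` R)) \<and>
     ((\<forall>k. invariant_distribution M (idla_forest_inf N S) (vshift k)) \<and>
      (\<forall>n\<ge>1. \<forall>k. invariant_distribution M (idla_forest N S n) (vshift k))) \<and>
     (mixing_distribution M (idla_forest_inf N S) \<and>
      (\<forall>n\<ge>1. mixing_distribution M (idla_forest N S n))) \<and>
     ((invariant_distribution M (idla_forest_inf N S) reflect_y_axis \<and>
       (\<forall>k. invariant_distribution M (idla_forest_inf N S) (reflect_half k))) \<and>
      (\<forall>n\<ge>1. invariant_distribution M (idla_forest N S n) reflect_y_axis \<and>
         (\<forall>k. invariant_distribution M (idla_forest N S n) (reflect_half k))))"
proof -
  interpret idla M N S by fact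
  \<comment> \<open>All symmetries of the statement belong to the one family of affine maps with
    signs as linear part.\<close>
  have maps: "vshift k = site_map 1 1 k" "reflect_y_axis = site_map (- 1) 1 0" "reflect_half k = site_map 1 (- 1) k" for k
    by (auto simp: vshift_def reflect_y_axis_def reflect_half_def site_map_def fun_eq_iff)
  have good: "AE \<omega> in M. good (Z \<omega>) \<and> idla_forest_inf N S \<omega> = forest_limit (points_of (Z \<omega>)) (walks_of (Z \<omega>))"
    using AE_input[OF input.AE_good] AE_forest_limit_Z by eventually_elim blast
  have "AE \<omega> in M. pverts (idla_forest_inf N S \<omega>) = UNIV \<and> parcs (idla_forest_inf N S \<omega>) \<subseteq> lattice_arcs"
    using good by eventually_elim (simp add: good_spanning good_lattice)
  moreover have "AE \<omega> in M. \<exists>R T. R \<subseteq> {0} \<times> UNIV \<and> countable R \<and> infinite R \<and>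
        (\<forall>r\<in>R. directed_tree (T r) r) \<and>
        disjoint_family_on (\<lambda>r. pverts (T r)) R \<and>
        idla_forest_inf N S \<omega> = graph_Union (T ` R)"
    using good by eventually_elim (metis good_trees)
  ultimately show ?thesis
    unfolding maps
    by (intro conjI allI impI idla_forest_inf_measurable idla_forest_measurable invariant_site_map mixing_forests) simp_all
qed

end
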